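(* Let $2\le s\le n$ and let $F$ be a monic hyperbolic polynomial of degree $n$ such that $\mathcal H_s(F)$ is generic. Then the boundary complex $\partial(\mathcal L_s^\Delta(F))$ is a combinatorial $(n-s-1)$-sphere.
   Context: A univariate real polynomial is hyperbolic if all its roots are real; $\mathcal H$ is the set of monic hyperbolic polynomials of degree $n$ in $\mathbb R[T]$. For $F=T^n+F_1T^{n-1}+\dots+F_n\in\mathcal H$, the hyperbolic slice is $\mathcal H_s(F)=\{T^n+H_1T^{n-1}+\dots+H_n\in\mathcal H : H_i=F_i \text{ for } 1\le i\le s\}$. It is generic if it contains no polynomial with at most $s-1$ distinct roots. A composition of $n$ is a finite sequence of positive integers with sum $n$. $\mu\le\lambda$ means $\mu$ is obtained from $\lambda$ by summing consecutive blocks of entries. The composition $c(H)$ of $H\in\mathcal H$ is the sequence of multiplicities of its distinct roots listed in increasing order of the roots. The strata are $\mathcal H_s^\mu(F)=\{H\in\mathcal H_s(F): c(H)\le\mu\}$. $\mathcal L_s(F)$ is the poset of strata ordered by inclusion, $\mathcal L_s^\Delta(F)$ its dual (reverse inclusion), and the boundary complex is $\partial(\mathcal L_s^\Delta(F)):=\mathcal L_s^\Delta(F)\setminus\{\emptyset\}$, the nonempty strata ordered by reverse inclusion. In the generic case with $s\ge2$ this poset is (isomorphic to the face poset, including the empty face, of) a simplicial complex, and it is identified with a geometric realization of that complex. A polytope complex is a family $C$ of polytopes in some $\mathbb R^m$ such that each face of a polytope in $C$ is in $C$ and the intersection of two polytopes in $C$ is a face of each. A subdivision of $C$ is a polytope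 complex $S$ with the same union, each of whose faces is contained in a face of $C$; it is simplicial if $S$ is a geometric simplicial complex. A combinatorial (or PL) $m$-sphere is a polytope complex having a simplicial subdivision that is isomorphic to a simplicial subdivision of the boundary of an $(m+1)$-dimensional simplex. *)

theory Defs
  imports "HOL-Analysis.Analysis" "HOL-Computational_Algebra.Polynomial"
begin

section \<open>Hyperbolic polynomials and their slices\<close>

definition hyperbolic :: "real poly \<Rightarrow> bool" where
  "hyperbolic H \<longleftrightarrow> (\<forall>z::complex. poly (map_poly complex_of_real H) z = 0 \<longrightarrow> z \<in> \<real>)"

definition monic_hyperbolic :: "nat \<Rightarrow> real poly set" where
  "monic_hyperbolic n = {H. degree H = n \<and> lead_coeff H = 1 \<and> hyperbolic H}"

text \<open>Writing \<open>H = T^n + H\<^sub>1 T^(n-1) + \<dots> + H\<^sub>n\<close>, the coefficient \<open>H\<^sub>i\<close> is \<open>coeff H (n - i)\<close>.\<close>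

definition hyperbolic_slice :: "nat \<Rightarrow> nat \<Rightarrow> real poly \<Rightarrow> real poly set" where
  "hyperbolic_slice n s F =
     {H \<in> monic_hyperbolic n. \<forall>i. 1 \<le> i \<and> i \<le> s \<longrightarrow> coeff H (n - i) = coeff F (n - i)}"

definition generic_slice :: "nat \<Rightarrow> nat \<Rightarrow> real poly \<Rightarrow> bool" where
  "generic_slice n s F \<longleftrightarrow> \<not> (\<exists>H \<in> hyperbolic_slice n s F. card {x. poly H x = 0} \<le> s - 1)"


section \<open>Compositions and strata\<close>

definition composition :: "nat \<Rightarrow> nat list \<Rightarrow> bool" where
  "composition n \<mu> \<longleftrightarrow> (\<forall>k \<in> set \<mu>. 0 < k) \<and> sum_list \<mu> = n"

definition comp_le :: "nat list \<Rightarrow> nat list \<Rightarrow> bool" where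
  "comp_le \<mu> \<nu> \<longleftrightarrow> (\<exists>bs. [] \<notin> set bs \<and> concat bs = \<nu> \<and> \<mu> = map sum_list bs)"

definition root_composition :: "real poly \<Rightarrow> nat list" where
  "root_composition H = map (\<lambda>x. order x H) (sorted_list_of_set {x. poly H x = 0})"

definition stratum :: "nat \<Rightarrow> nat \<Rightarrow> real poly \<Rightarrow> nat list \<Rightarrow> real poly set" where
  "stratum n s F \<mu> = {H \<in> hyperbolic_slice n s F. comp_le (root_composition H) \<mu>}"

text \<open>Strata are sets of polynomials: two compositions with the same stratum give one
  element of the poset.\<close>

definition strata :: "nat \<Rightarrow> nat \<Rightarrow> real poly \<Rightarrow> real poly set set" where
  "strata n s F = stratum n s F ` {\<mu>. composition n \<mu>}"

text \<open>The carrier of the boundary complex; its order is reverse inclusion.\<close>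

definition boundary_strata :: "nat \<Rightarrow> nat \<Rightarrow> real poly \<Rightarrow> real poly set set" where
  "boundary_strata n s F = strata n s F - {{}}"


section \<open>Polytope complexes and combinatorial spheres\<close>

definition poset_iso ::
    "'a set \<Rightarrow> ('a \<Rightarrow> 'a \<Rightarrow> bool) \<Rightarrow> 'b set \<Rightarrow> ('b \<Rightarrow> 'b \<Rightarrow> bool) \<Rightarrow> bool" where
  "poset_iso A le B le' \<longleftrightarrow>
     (\<exists>f. bij_betw f A B \<and> (\<forall>x \<in> A. \<forall>y \<in> A. le x y \<longleftrightarrow> le' (f x) (f y)))"

text \<open>Complexes are finite, as in the library's \<^const>\<open>simplicial_complex\<close>. In \<^const>\<open>face_of\<close>
  the empty set counts as a face of every polytope, so a nonempty complex contains the empty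
  face.\<close>

definition polytope_complex :: "'v::euclidean_space set set \<Rightarrow> bool" where
  "polytope_complex C \<longleftrightarrow>
     finite C \<and>
     (\<forall>P \<in> C. polytope P) \<and>
     (\<forall>P \<in> C. \<forall>Q. Q face_of P \<longrightarrow> Q \<in> C) \<and>
     (\<forall>P \<in> C. \<forall>Q \<in> C. (P \<inter> Q) face_of P \<and> (P \<inter> Q) face_of Q)"

definition subdivision :: "'v::euclidean_space set set \<Rightarrow> 'v set set \<Rightarrow> bool" where
  "subdivision S C \<longleftrightarrow>
     polytope_complex S \<and> \<Union>S = \<Union>C \<and> (\<forall>P \<in> S. \<exists>Q \<in> C. P \<subseteq> Q)"

definition simplicial_subdivision :: "'v::euclidean_space set set \<Rightarrow> 'v set set \<Rightarrow> bool" where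
  "simplicial_subdivision S C \<longleftrightarrow> subdivision S C \<and> simplicial_complex S"

definition boundary_faces :: "'v::euclidean_space set \<Rightarrow> 'v set set" where
  "boundary_faces D = {P. P face_of D \<and> P \<noteq> D}"

text \<open>Simplicial complexes are isomorphic iff their face posets are. The simplex \<open>D\<close> may be
  taken in the space that contains \<open>C\<close>: an \<open>m\<close>-sphere does not embed in a space of dimension
  less than \<open>m + 1\<close>. The index \<open>m\<close> is an integer because \<open>m = - 1\<close> occurs: there \<open>D\<close> is a
  point, whose boundary complex consists of the empty face only.\<close>

definition combinatorial_sphere :: "int \<Rightarrow> 'v::euclidean_space set set \<Rightarrow> bool" where
  "combinatorial_sphere m C \<longleftrightarrow>
     polytope_complex C \<and>
     (\<exists>(S :: 'v set set) (T :: 'v set set) (D :: 'v set). simplicial_subdivision S C \<and>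
        (m + 1) simplex D \<and> simplicial_subdivision T (boundary_faces D) \<and>
        poset_iso S (\<subseteq>) T (\<subseteq>))"

text \<open>\<open>K\<close> realizes the boundary complex: its face poset, with the empty face, is the poset of
  nonempty strata under reverse inclusion.\<close>

definition realizes_boundary_complex ::
    "nat \<Rightarrow> nat \<Rightarrow> real poly \<Rightarrow> 'v::euclidean_space set set \<Rightarrow> bool" where
  "realizes_boundary_complex n s F K \<longleftrightarrow>
     simplicial_complex K \<and> poset_iso (boundary_strata n s F) (\<supseteq>) K (\<subseteq>)"

end

theory Submission
  imports Defs
    "HOL-Computational_Algebra.Fundamental_Theorem_Algebra"
    "HOL-Computational_Algebra.Formal_Power_Series"
begin

text \<open>
  A monic hyperbolic polynomial of degree \<open>n\<close> is the same thing as a nondecreasing vector \<open>x\<close> of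
  its \<open>n\<close> roots, and by Newton's identities prescribing its first \<open>s\<close> coefficients means
  prescribing the power sums \<open>p\<^sub>1, \<dots>, p\<^sub>s\<close> of \<open>x\<close>. A composition of \<open>n\<close> is determined by its
  partial sums, so a stratum is the part of the slice that lies on a prescribed set of walls
  \<open>x (i - 1) = x i\<close>. The nonempty strata thus correspond to the subsets of the wall sets of points
  of the slice, and these form a simplicial complex whose vertices are walls.

  In the generic case the slice behaves like a simple polytope. Its vertices are the points with
  exactly \<open>s\<close> distinct roots, and the next power sum \<open>p\<^sub>s\<^sub>+\<^sub>1\<close> plays the part of a linear functional
  in general position. At a vertex with distinct roots \<open>y\<^sub>1 < \<dots> < y\<^sub>s\<close>, leaving a wall inside the
  block of \<open>y\<^sub>b\<close> lowers \<open>p\<^sub>s\<^sub>+\<^sub>1\<close> if \<open>s - b\<close> is odd and raises it if \<open>s - b\<close> is even, and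
  a vertex which is a local minimum or maximum of \<open>p\<^sub>s\<^sub>+\<^sub>1\<close> on a stratum in this sense is the only
  global one. The last statement is \<open>psum_compare_vertex\<close>: two vectors with equal \<open>p\<^sub>1, \<dots>, p\<^sub>s\<close>
  have differences with at least \<open>s\<close> sign changes, at a local extremum the block structure allows at
  most \<open>s\<close> of them, and the sign after the last change decides which value of \<open>p\<^sub>s\<^sub>+\<^sub>1\<close> is larger. That
  edges do lead to other vertices follows from compactness together with the fact that the power
  sums of \<open>k\<close> distinct numbers are locally onto (\<open>power_sums_locally_onto\<close>).

  So the facets of the complex, ordered by \<open>p\<^sub>s\<^sub>+\<^sub>1\<close>, form a shelling, and so do they in the
  reverse order. Add the facets one at a time and close the part built so far to a sphere by a cone
  over those of its faces that also lie in facets still to come. The first of these spheres is the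
  boundary of a simplex, each further facet changes the sphere by one bistellar flip
  (\<open>coned_boundary_step\<close>), and after the last facet the cone has disappeared and the whole complex
  is left. If the vertices are basis vectors, a bistellar flip is realised by an explicit piecewise
  linear homeomorphism (\<open>pl_homeomorphic_bistellar_flip\<close>). Composing these maps and
  triangulating so that the composite is affine on every simplex gives the isomorphic
  subdivisions that a combinatorial sphere requires (\<open>combinatorial_sphereI\<close>).
\<close>

section \<open>Piecewise linear homeomorphisms\<close>

text \<open>Closure under faces is left out, so that the pairwise intersections of the cells of two
  families form a family again without further argument; triangulating a family supplies the
  faces.\<close>

definition cell_family :: "'v::euclidean_space set set \<Rightarrow> bool" where
  "cell_family C \<longleftrightarrow> finite C \<and> (\<forall>P\<in>C. polytope P) \<and> (\<forall>P\<in>C. \<forall>Q\<in>C. P \<inter> Q face_of P)"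

text \<open>Affinity is tested on segments inside the cell. This form is inherited by subsets, by
  composites and by inverses without extending the map to the ambient space.\<close>

definition affine_on_cell :: "('v::real_vector \<Rightarrow> 'w::real_vector) \<Rightarrow> 'v set \<Rightarrow> bool" where
  "affine_on_cell f P \<longleftrightarrow>
     (\<forall>x\<in>P. \<forall>y\<in>P. \<forall>u. 0 \<le> u \<and> u \<le> 1 \<longrightarrow> f ((1 - u) *\<^sub>R x + u *\<^sub>R y) = (1 - u) *\<^sub>R f x + u *\<^sub>R f y)"

definition pl_homeomorphic :: "'v::euclidean_space set \<Rightarrow> 'v set \<Rightarrow> bool" where
  "pl_homeomorphic X Y \<longleftrightarrow>
     (\<exists>f S. cell_family S \<and> \<Union>S = X \<and> (\<forall>P\<in>S. affine_on_cell f P) \<and> inj_on f X \<and> f ` X = Y)"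

lemma pl_homeomorphicE:
  assumes "pl_homeomorphic X Y"
  obtains S f where "cell_family S" "\<Union>S = X" "\<forall>P\<in>S. affine_on_cell f P"
    "inj_on f X" "f ` X = Y"
  using assms unfolding pl_homeomorphic_def by blast

lemma affine_on_cell_subset: "affine_on_cell f P \<Longrightarrow> Q \<subseteq> P \<Longrightarrow> affine_on_cell f Q"
  unfolding affine_on_cell_def by blast

lemma affine_on_cellD:
  "affine_on_cell f P \<Longrightarrow> x \<in> P \<Longrightarrow> y \<in> P \<Longrightarrow> 0 \<le> u \<Longrightarrow> u \<le> 1
    \<Longrightarrow> f ((1 - u) *\<^sub>R x + u *\<^sub>R y) = (1 - u) *\<^sub>R f x + u *\<^sub>R f y"
  unfolding affine_on_cell_def by blast

lemma convex_affine_image: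
  assumes "affine_on_cell f P" "convex C" "C \<subseteq> P"
  shows "convex (f ` C)"
  unfolding convex_alt
proof clarify
  fix x y and u :: real assume "x \<in> C" "y \<in> C" "0 \<le> u" "u \<le> 1"
  then have "(1 - u) *\<^sub>R f x + u *\<^sub>R f y = f ((1 - u) *\<^sub>R x + u *\<^sub>R y)"
    using affine_on_cellD[OF assms(1)] assms(3) by (metis subsetD)
  moreover have "(1 - u) *\<^sub>R x + u *\<^sub>R y \<in> C"
    using \<open>x \<in> C\<close> \<open>y \<in> C\<close> \<open>0 \<le> u\<close> \<open>u \<le> 1\<close> assms(2) by (simp add: convex_alt)
  ultimately show "(1 - u) *\<^sub>R f x + u *\<^sub>R f y \<in> f ` C" by simp
qed

lemma affine_on_cell_convex_hull_image:
  assumes f: "affine_on_cell f P" and V: "convex hull V \<subseteq> P"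
  shows "f ` (convex hull V) = convex hull (f ` V)"
proof
  let ?C = "{x \<in> convex hull V. f x \<in> convex hull (f ` V)}"
  have "(1 - u) *\<^sub>R x + u *\<^sub>R y \<in> ?C"
    if "x \<in> ?C" "y \<in> ?C" and u: "0 \<le> u" "u \<le> 1" for x y and u :: real
  proof -
    have xy: "x \<in> convex hull V" "y \<in> convex hull V"
      and fxy: "f x \<in> convex hull (f ` V)" "f y \<in> convex hull (f ` V)" using that by auto
    have "f ((1 - u) *\<^sub>R x + u *\<^sub>R y) = (1 - u) *\<^sub>R f x + u *\<^sub>R f y"
      using affine_on_cellD[OF f] V xy u by blast
    then show ?thesis
      using xy fxy u convex_convex_hull[of V] convex_convex_hull[of "f ` V"]
      by (simp add: convex_alt)
  qed
  then have "convex ?C" unfolding convex_alt by blast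
  moreover have "V \<subseteq> ?C" by (auto simp: hull_inc)
  ultimately have "convex hull V \<subseteq> ?C" by (metis hull_minimal)
  then show "f ` (convex hull V) \<subseteq> convex hull (f ` V)" by blast
next
  have "convex (f ` (convex hull V))"
    using convex_affine_image[OF f _ V] by simp
  moreover have "f ` V \<subseteq> f ` (convex hull V)" by (simp add: hull_subset image_mono)
  ultimately show "convex hull (f ` V) \<subseteq> f ` (convex hull V)" by (metis hull_minimal)
qed

lemma polytope_affine_image:
  assumes "affine_on_cell f P" "polytope P"
  shows "polytope (f ` P)"
proof -
  obtain V where "finite V" "P = convex hull V" using assms(2) polytope_def by blast
  then show ?thesis
    using affine_on_cell_convex_hull_image[OF assms(1), of V] unfolding polytope_def by auto
qed

lemma face_of_affine_image:
  assumes f: "affine_on_cell f P" and inj: "inj_on f P" and P: "convex P" and F: "F face_of P"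
  shows "f ` F face_of f ` P"
  unfolding face_of_def
proof (intro conjI ballI impI)
  have FP: "F \<subseteq> P" using F by (simp add: face_of_imp_subset)
  then show "f ` F \<subseteq> f ` P" by blast
  show "convex (f ` F)" using convex_affine_image[OF f _ FP] F face_of_imp_convex by blast
  fix a b x assume ab: "a \<in> f ` P" "b \<in> f ` P" and x: "x \<in> f ` F" "x \<in> open_segment a b"
  obtain a' b' where a': "a = f a'" "a' \<in> P" and b': "b = f b'" "b' \<in> P" using ab by blast
  obtain x' where x': "x = f x'" "x' \<in> F" using x by blast
  obtain u where u: "0 < u" "u < 1" and ne: "a \<noteq> b" and xu: "x = (1 - u) *\<^sub>R a + u *\<^sub>R b"
    using x(2) unfolding in_segment by blast
  have "f ((1 - u) *\<^sub>R a' + u *\<^sub>R b') = f x'"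
    using affine_on_cellD[OF f a'(2) b'(2), of u] u xu a' b' x' by simp
  moreover have "(1 - u) *\<^sub>R a' + u *\<^sub>R b' \<in> P"
    using P a'(2) b'(2) u by (simp add: convex_alt)
  ultimately have "x' = (1 - u) *\<^sub>R a' + u *\<^sub>R b'"
    using inj x'(2) FP by (metis inj_onD subsetD)
  then have "x' \<in> open_segment a' b'"
    unfolding in_segment using u ne a' b' by blast
  then show "a \<in> f ` F" "b \<in> f ` F"
    using F a' b' x'(2) unfolding face_of_def by blast+
qed


lemma cell_family_image:
  assumes S: "cell_family S" and f: "\<And>P. P \<in> S \<Longrightarrow> affine_on_cell f P" and inj: "inj_on f (\<Union>S)"
  shows "cell_family ((`) f ` S)"
  unfolding cell_family_def
proof (intro conjI ballI; clarify?)
  show "finite ((`) f ` S)" using S by (simp add: cell_family_def)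
  show "polytope (f ` P)" if "P \<in> S" for P
    using that S f by (simp add: cell_family_def polytope_affine_image)
  show "f ` P \<inter> f ` Q face_of f ` P" if PQ: "P \<in> S" "Q \<in> S" for P Q
  proof -
    have "f ` P \<inter> f ` Q = f ` (P \<inter> Q)"
      using inj PQ by (intro inj_on_image_Int[symmetric, of f "\<Union>S"]) auto
    moreover have "f ` (P \<inter> Q) face_of f ` P"
      using PQ S f inj polytope_imp_convex
      by (intro face_of_affine_image) (auto simp: cell_family_def intro: inj_on_subset)
    ultimately show ?thesis by simp
  qed
qed

lemma affine_on_cell_inv_into:
  assumes f: "affine_on_cell f P" and P: "convex P" and inj: "inj_on f X" and "P \<subseteq> X"
  shows "affine_on_cell (inv_into X f) (f ` P)"
  unfolding affine_on_cell_def
proof clarify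
  fix x y and u :: real assume xy: "x \<in> P" "y \<in> P" and u: "0 \<le> u" "u \<le> 1"
  have "(1 - u) *\<^sub>R x + u *\<^sub>R y \<in> X"
    using P xy u \<open>P \<subseteq> X\<close> by (auto simp: convex_alt)
  then show "inv_into X f ((1 - u) *\<^sub>R f x + u *\<^sub>R f y)
     = (1 - u) *\<^sub>R inv_into X f (f x) + u *\<^sub>R inv_into X f (f y)"
    using affine_on_cellD[OF f xy u] xy \<open>P \<subseteq> X\<close> inj
    by (metis inv_into_f_f subsetD)
qed

definition common_refinement :: "'v set set \<Rightarrow> 'v set set \<Rightarrow> 'v set set" where
  "common_refinement S T = (\<lambda>(P, Q). P \<inter> Q) ` (S \<times> T)"

lemma cell_family_common_refinement:
  assumes "cell_family S" "cell_family T"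
  shows "cell_family (common_refinement S T)"
  unfolding cell_family_def common_refinement_def
proof (intro conjI ballI; clarify?)
  show "finite ((\<lambda>(P, Q). P \<inter> Q) ` (S \<times> T))" using assms by (simp add: cell_family_def)
  show "polytope (P \<inter> Q)" if "P \<in> S" "Q \<in> T" for P Q
    using that assms by (simp add: cell_family_def polytope_Int)
  show "P \<inter> Q \<inter> (P' \<inter> Q') face_of P \<inter> Q"
    if "P \<in> S" "Q \<in> T" "P' \<in> S" "Q' \<in> T" for P Q P' Q'
  proof -
    have "(P \<inter> P') \<inter> (Q \<inter> Q') face_of P \<inter> Q"
      using that assms by (intro face_of_Int_Int) (simp_all add: cell_family_def)
    then show ?thesis by (simp add: Int_ac)
  qed
qed

lemma Union_common_refinement: "\<Union>(common_refinement S T) = \<Union>S \<inter> \<Union>T"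
  unfolding common_refinement_def by auto

lemma common_refinement_cases:
  assumes "R \<in> common_refinement S T"
  obtains P Q where "P \<in> S" "Q \<in> T" "R \<subseteq> P" "R \<subseteq> Q" "R = P \<inter> Q"
  using assms unfolding common_refinement_def by auto

text \<open>Subdivisions are transported backwards along a piecewise linear homeomorphism, whose inverse
  is affine on the images of the cells.\<close>

lemma cell_family_inv_image:
  assumes S: "cell_family S" and f: "\<And>P. P \<in> S \<Longrightarrow> affine_on_cell f P" and inj: "inj_on f (\<Union>S)"
    and R: "cell_family R" and RS: "\<And>A. A \<in> R \<Longrightarrow> \<exists>P\<in>S. A \<subseteq> f ` P"
  shows "cell_family ((`) (inv_into (\<Union>S) f) ` R)"
proof (rule cell_family_image[OF R])
  show "affine_on_cell (inv_into (\<Union> S) f) A" if A: "A \<in> R" for A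
  proof -
    obtain P where "P \<in> S" "A \<subseteq> f ` P" using RS[OF A] by blast
    then show ?thesis
      using affine_on_cell_inv_into[OF f[OF \<open>P \<in> S\<close>] _ inj] S polytope_imp_convex affine_on_cell_subset
      unfolding cell_family_def by blast
  qed
  show "inj_on (inv_into (\<Union> S) f) (\<Union> R)"
    by (rule inj_on_inv_into) (use RS in blast)
qed

text \<open>On the middle space the images of the cells of the first map meet the cells of the second
  map. Pulling the common refinement back gives cells on which both maps are affine.\<close>

lemma pl_homeomorphic_trans:
  assumes "pl_homeomorphic X Y" "pl_homeomorphic Y Z"
  shows "pl_homeomorphic X Z"
proof -
  obtain f S where S: "cell_family S" "\<Union>S = X" "\<And>P. P \<in> S \<Longrightarrow> affine_on_cell f P"
      and f: "inj_on f X" "f ` X = Y"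
    using assms(1) unfolding pl_homeomorphic_def by blast
  obtain g T where T: "cell_family T" "\<Union>T = Y" "\<And>P. P \<in> T \<Longrightarrow> affine_on_cell g P"
      and g: "inj_on g Y" "g ` Y = Z"
    using assms(2) unfolding pl_homeomorphic_def by blast
  let ?R = "common_refinement ((`) f ` S) T" and ?f' = "inv_into X f"
  have R: "cell_family ?R"
    using S T f by (intro cell_family_common_refinement cell_family_image) auto
  have UR: "\<Union>?R = Y"
    unfolding Union_common_refinement using S(2) T(2) f(2) by (simp add: image_Union[symmetric])
  have RS: "\<exists>P\<in>S. A \<subseteq> f ` P" if "A \<in> ?R" for A
    using that by (elim common_refinement_cases) auto
  have "cell_family ((`) ?f' ` ?R)"
    using cell_family_inv_image[OF S(1) S(3) _ R RS] f S(2) by simp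
  moreover have "\<Union>((`) ?f' ` ?R) = X"
    using UR f by (metis image_Union inv_into_image_cancel order_refl)
  moreover have "affine_on_cell (g \<circ> f) C" if C: "C \<in> (`) ?f' ` ?R" for C
  proof -
    obtain A where A: "A \<in> ?R" "C = ?f' ` A" using C by blast
    obtain P Q where PQ: "P \<in> S" "Q \<in> T" "A \<subseteq> f ` P" "A \<subseteq> Q"
      using A(1) by (elim common_refinement_cases) auto
    have CP: "C \<subseteq> P"
    proof
      fix c assume "c \<in> C"
      then obtain p where "p \<in> P" "c = ?f' (f p)" using A(2) PQ(3) by blast
      then show "c \<in> P" using f(1) PQ(1) S(2) by (metis UnionI inv_into_f_f)
    qed
    have fC: "f ` C = A"
      using A UR f(2) by (metis Sup_upper image_inv_into_cancel)
    show ?thesis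
      unfolding affine_on_cell_def
    proof clarify
      fix x y and u :: real assume xy: "x \<in> C" "y \<in> C" and u: "0 \<le> u" "u \<le> 1"
      have "f ((1 - u) *\<^sub>R x + u *\<^sub>R y) = (1 - u) *\<^sub>R f x + u *\<^sub>R f y"
        using affine_on_cellD[OF S(3)[OF PQ(1)]] CP xy u by blast
      moreover have "g ((1 - u) *\<^sub>R f x + u *\<^sub>R f y) = (1 - u) *\<^sub>R g (f x) + u *\<^sub>R g (f y)"
        using affine_on_cellD[OF T(3)[OF PQ(2)]] fC xy u PQ(4) by blast
      ultimately show "(g \<circ> f) ((1 - u) *\<^sub>R x + u *\<^sub>R y) = (1 - u) *\<^sub>R (g \<circ> f) x + u *\<^sub>R (g \<circ> f) y"
        by simp
    qed
  qed
  moreover have "inj_on (g \<circ> f) X" using f g by (simp add: comp_inj_on)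
  moreover have "(g \<circ> f) ` X = Z" using f g by (metis image_comp)
  ultimately show ?thesis unfolding pl_homeomorphic_def by blast
qed

text \<open>An affine dependence among the image points would, by Radon's theorem, make the hulls of two
  disjoint sets of vertices meet, and injectivity would carry the intersection back to the
  simplex.\<close>

lemma simplex_affine_image:
  assumes f: "affine_on_cell f P" and inj: "inj_on f P" and P: "k simplex P"
  shows "k simplex (f ` P)"
proof -
  obtain C where C: "finite C" "\<not> affine_dependent C" "int (card C) = k + 1" "P = convex hull C"
    using P unfolding simplex by blast
  have CP: "C \<subseteq> P" using C(4) by (simp add: hull_subset)
  have im: "f ` P = convex hull (f ` C)"
    using affine_on_cell_convex_hull_image[OF f, of C] C(4) by simp
  have injC: "inj_on f C" using inj CP inj_on_subset by blast
  have "\<not> affine_dependent (f ` C)"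
  proof
    assume "affine_dependent (f ` C)"
    then obtain M N where MN: "M \<inter> N = {}" "M \<union> N = f ` C" "convex hull M \<inter> convex hull N \<noteq> {}"
      using Radon_partition[of "f ` C"] C(1) by blast
    define M' N' where "M' = {c \<in> C. f c \<in> M}" and "N' = {c \<in> C. f c \<in> N}"
    have M': "M = f ` M'" and N': "N = f ` N'" and sub: "M' \<subseteq> C" "N' \<subseteq> C" and disj: "M' \<inter> N' = {}"
      using MN(1,2) unfolding M'_def N'_def by auto
    have hM: "convex hull M' \<subseteq> P" and hN: "convex hull N' \<subseteq> P"
      using sub C(4) by (simp_all add: hull_mono)
    have "f ` (convex hull M') \<inter> f ` (convex hull N') \<noteq> {}"
      using affine_on_cell_convex_hull_image[OF f hM] affine_on_cell_convex_hull_image[OF f hN]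
        MN(3) M' N' by simp
    then obtain x y where xy: "x \<in> convex hull M'" "y \<in> convex hull N'" "f x = f y" by blast
    then have "x = y" using inj hM hN by (meson inj_onD subsetD)
    moreover have "convex hull M' \<inter> convex hull N' = {}"
      using convex_hull_Int[of M' N'] disj sub C(2) by (metis affine_independent_subset convex_hull_empty Un_least)
    ultimately show False using xy by blast
  qed
  then show ?thesis
    using C(3) im injC by (simp add: simplex_convex_hull card_image)
qed


lemma face_of_affine_imageE:
  assumes f: "affine_on_cell f P" and inj: "inj_on f P" and P: "convex P" and F: "F face_of f ` P"
  obtains F' where "F' face_of P" "F = f ` F'"
proof
  let ?g = "inv_into P f"
  have "?g ` F face_of ?g ` f ` P"
    using affine_on_cell_inv_into[OF f P inj] convex_affine_image[OF f P] F
    by (intro face_of_affine_image) (auto simp: inj_on_inv_into)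
  then show "?g ` F face_of P" using inj by (simp add: inv_into_image_cancel)
  show "F = f ` ?g ` F" using F by (simp add: face_of_imp_subset image_inv_into_cancel)
qed

lemma simplicial_complex_cell_family: "simplicial_complex T \<Longrightarrow> cell_family T"
  unfolding simplicial_complex_def cell_family_def by (auto intro: simplex_imp_polytope)

lemma simplicial_complex_polytope_complex: "simplicial_complex T \<Longrightarrow> polytope_complex T"
  unfolding simplicial_complex_def polytope_complex_def
  by (metis Int_commute simplex_imp_polytope)

lemma polytope_complex_cell_family: "polytope_complex T \<Longrightarrow> cell_family T"
  unfolding polytope_complex_def cell_family_def by blast

lemma simplicial_complex_image:
  assumes T: "simplicial_complex T" and f: "\<And>P. P \<in> T \<Longrightarrow> affine_on_cell f P" and inj: "inj_on f (\<Union>T)"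
  shows "simplicial_complex ((`) f ` T)"
proof -
  have cf: "cell_family ((`) f ` T)"
    using cell_family_image[OF simplicial_complex_cell_family[OF T] f inj] by simp
  have injP: "inj_on f P" if "P \<in> T" for P using inj that inj_on_subset by blast
  have "\<exists>n. n simplex f ` P" if P: "P \<in> T" for P
    using T P simplex_affine_image[OF f[OF P] injP[OF P]] unfolding simplicial_complex_def by blast
  moreover have "F \<in> (`) f ` T" if P: "P \<in> T" and F: "F face_of f ` P" for P F
  proof -
    obtain F' where "F' face_of P" "F = f ` F'"
      using face_of_affine_imageE[OF f[OF P] injP[OF P] _ F] T P convex_simplex
      unfolding simplicial_complex_def by blast
    then show ?thesis using T P unfolding simplicial_complex_def by blast
  qed
  ultimately show ?thesis
    using cf unfolding simplicial_complex_def cell_family_def by blast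
qed

lemma simplicial_refinement:
  assumes "cell_family R"
  obtains T where "simplicial_complex T" "\<Union>T = \<Union>R" "\<And>K. K \<in> T \<Longrightarrow> \<exists>C\<in>R. K \<subseteq> C"
  using simplicial_subdivision_of_cell_complex[of R] assms unfolding cell_family_def by metis

lemma cell_family_boundary_faces:
  assumes "k simplex D"
  shows "cell_family (boundary_faces D)"
  unfolding cell_family_def boundary_faces_def
proof (intro conjI ballI)
  have D: "polytope D" using assms by (rule simplex_imp_polytope)
  show "finite {P. P face_of D \<and> P \<noteq> D}" using finite_polytope_faces[OF D] by (rule rev_finite_subset) auto
  show "polytope P" if "P \<in> {P. P face_of D \<and> P \<noteq> D}" for P
    using that face_of_polytope_polytope[OF D] by blast
  show "P \<inter> Q face_of P" if "P \<in> {P. P face_of D \<and> P \<noteq> D}" "Q \<in> {P. P face_of D \<and> P \<noteq> D}" for P Q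
    using that by (metis (lifting) mem_Collect_eq face_of_Int face_of_imp_subset face_of_subset inf_le1)
qed

text \<open>To subdivide both complexes at once, refine the domain by the cells of \<open>C\<close>,
  then refine the image by the faces of the simplex, triangulate there and pull the
  triangulation back. The pullback is a simplicial subdivision of \<open>C\<close>, because
  on each of its cells the map is affine and injective.\<close>

proposition combinatorial_sphereI:
  fixes C :: "'v::euclidean_space set set"
  assumes C: "polytope_complex C" and D: "(m + 1) simplex D"
    and CD: "pl_homeomorphic (\<Union>C) (\<Union>(boundary_faces D))"
  shows "combinatorial_sphere m C"
proof -
  let ?X = "\<Union>C" and ?Y = "\<Union>(boundary_faces D)"
  obtain S\<^sub>0 f where S\<^sub>0: "cell_family S\<^sub>0" "\<Union>S\<^sub>0 = ?X" "\<forall>P\<in>S\<^sub>0. affine_on_cell f P"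
      and f: "inj_on f ?X" "f ` ?X = ?Y"
    using CD by (rule pl_homeomorphicE)
  let ?R = "common_refinement S\<^sub>0 C"
  have R: "cell_family ?R"
    using S\<^sub>0(1) polytope_complex_cell_family[OF C] by (rule cell_family_common_refinement)
  have UR: "\<Union>?R = ?X" using S\<^sub>0 by (simp add: Union_common_refinement)
  have fR: "affine_on_cell f P" if P: "P \<in> ?R" for P
    using P by (rule common_refinement_cases) (metis S\<^sub>0(3) affine_on_cell_subset)
  have fR': "cell_family ((`) f ` ?R)"
    using R fR f UR by (intro cell_family_image) auto
  let ?Q = "common_refinement ((`) f ` ?R) (boundary_faces D)"
  have Q: "cell_family ?Q"
    using fR' cell_family_boundary_faces[OF D] by (rule cell_family_common_refinement)
  have UQ: "\<Union>?Q = ?Y"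
    using UR f by (simp add: Union_common_refinement image_Union[symmetric])
  obtain T where T: "simplicial_complex T" "\<Union>T = ?Y" "\<And>K. K \<in> T \<Longrightarrow> \<exists>C\<in>?Q. K \<subseteq> C"
    using simplicial_refinement[OF Q] UQ by metis
  have TR: "\<exists>P\<in>?R. K \<subseteq> f ` P" and TD: "\<exists>P\<in>boundary_faces D. K \<subseteq> P" if K: "K \<in> T" for K
  proof -
    obtain Q where Q: "Q \<in> ?Q" "K \<subseteq> Q" using T(3)[OF K] by blast
    obtain A B where "A \<in> (`) f ` ?R" "B \<in> boundary_faces D" "Q \<subseteq> A" "Q \<subseteq> B"
      using Q(1) by (rule common_refinement_cases)
    then show "\<exists>P\<in>?R. K \<subseteq> f ` P" "\<exists>P\<in>boundary_faces D. K \<subseteq> P"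
      using Q(2) by blast+
  qed
  let ?g = "inv_into ?X f"
  let ?S = "(`) ?g ` T"
  have gT: "affine_on_cell ?g K" if K: "K \<in> T" for K
  proof -
    obtain P where P: "P \<in> ?R" "K \<subseteq> f ` P" using TR[OF K] by blast
    have "affine_on_cell ?g (f ` P)"
    proof (rule affine_on_cell_inv_into[OF fR[OF P(1)] _ f(1)])
      show "convex P" using R P(1) polytope_imp_convex unfolding cell_family_def by blast
      show "P \<subseteq> ?X" using P(1) UR by blast
    qed
    then show ?thesis using P(2) affine_on_cell_subset by blast
  qed
  have gY: "inj_on ?g ?Y" using f(2) by (simp add: inj_on_inv_into)
  have S: "simplicial_complex ?S"
    using T gT gY by (intro simplicial_complex_image) auto
  have US: "\<Union>?S = ?X"
    using T(2) f by (metis image_Union inv_into_image_cancel order_refl)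
  have SC: "\<exists>Q\<in>C. A \<subseteq> Q" if A: "A \<in> ?S" for A
  proof -
    obtain K where K: "K \<in> T" "A = ?g ` K" using A by blast
    obtain P where P: "P \<in> ?R" "K \<subseteq> f ` P" using TR[OF K(1)] by blast
    have "A \<subseteq> ?g ` f ` P" using K P by blast
    also have "\<dots> = P" using P(1) UR f(1) by (intro inv_into_image_cancel) auto
    finally have "A \<subseteq> P" .
    moreover obtain B E where "B \<in> S\<^sub>0" "E \<in> C" "P \<subseteq> B" "P \<subseteq> E"
      using P(1) by (rule common_refinement_cases)
    ultimately show ?thesis by blast
  qed
  have "poset_iso ?S (\<subseteq>) T (\<subseteq>)"
    unfolding poset_iso_def
  proof (intro exI conjI ballI)
    have fg: "f ` ?g ` K = K" if "K \<in> T" for K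
      using that T(2) f(2) by (intro image_inv_into_cancel) auto
    show "bij_betw ((`) f) ?S T"
      using fg by (intro bij_betw_byWitness[where f' = "(`) ?g"]) auto
    show "A \<subseteq> B \<longleftrightarrow> f ` A \<subseteq> f ` B" if "A \<in> ?S" "B \<in> ?S" for A B
      using that US f(1) by (intro inj_on_image_subset_iff[symmetric, of f ?X]) auto
  qed
  moreover have "simplicial_subdivision ?S C"
    using S US SC simplicial_complex_polytope_complex[OF S]
    by (simp only: simplicial_subdivision_def subdivision_def) blast
  moreover have "simplicial_subdivision T (boundary_faces D)"
    using T(1,2) TD simplicial_complex_polytope_complex[OF T(1)]
    by (simp only: simplicial_subdivision_def subdivision_def) blast
  ultimately show ?thesis
    unfolding combinatorial_sphere_def using C D by blast
qed

section \<open>Complexes on the standard basis and bistellar flips\<close>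

text \<open>The vertices of all complexes are vectors of the orthonormal basis. The simplex on
  \<open>A\<close> then consists of the points with nonnegative coordinates of sum 1 that
  vanish outside \<open>A\<close>, and the realization of a complex is described by the
  supports of its points.\<close>

definition realization :: "'v::euclidean_space set set \<Rightarrow> 'v set" where
  "realization \<Delta> = (\<Union>A\<in>\<Delta>. convex hull A)"

definition support :: "'v::euclidean_space \<Rightarrow> 'v set" where
  "support x = {b \<in> Basis. x \<bullet> b \<noteq> 0}"

definition basis_complex :: "'v::euclidean_space set set \<Rightarrow> bool" where
  "basis_complex \<Delta> \<longleftrightarrow> (\<forall>A\<in>\<Delta>. A \<subseteq> Basis \<and> Pow A \<subseteq> \<Delta>)"

lemma basis_affine_independent: "A \<subseteq> Basis \<Longrightarrow> \<not> affine_dependent A"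
  by (meson affine_dependent_imp_dependent dependent_mono independent_Basis)

lemma finite_basis_complex: "basis_complex \<Delta> \<Longrightarrow> finite \<Delta>"
  unfolding basis_complex_def by (rule finite_subset[of _ "Pow Basis"]) auto

lemma simplicial_complex_basis:
  assumes \<Delta>: "basis_complex \<Delta>"
  shows "simplicial_complex ((hull) convex ` \<Delta>)"
  unfolding simplicial_complex_def
proof (intro conjI ballI allI impI; (elim conjE imageE)?; (simp only:)?)
  show "finite ((hull) convex ` \<Delta>)" using finite_basis_complex[OF \<Delta>] by simp
  show "\<exists>n. n simplex convex hull A" if A: "A \<in> \<Delta>" for A
  proof -
    have "\<not> affine_dependent A" using that \<Delta> basis_affine_independent unfolding basis_complex_def by blast
    then show ?thesis by (intro exI[of _ "int (card A) - 1"] simplex_convex_hull) simp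
  qed
  show "F \<in> (hull) convex ` \<Delta>" if A: "A \<in> \<Delta>" and F: "F face_of convex hull A" for A F
  proof -
    have "\<not> affine_dependent A" using A \<Delta> basis_affine_independent unfolding basis_complex_def by blast
    then obtain B where "B \<subseteq> A" "F = convex hull B"
      using face_of_convex_hull_affine_independent F by blast
    then show ?thesis using A \<Delta> unfolding basis_complex_def by blast
  qed
  show "convex hull A \<inter> convex hull B face_of convex hull A" if "A \<in> \<Delta>" "B \<in> \<Delta>" for A B
  proof -
    have "\<not> affine_dependent (A \<union> B)" and A: "\<not> affine_dependent A"
      using that \<Delta> basis_affine_independent unfolding basis_complex_def by (metis Un_least)+
    then have "convex hull A \<inter> convex hull B = convex hull (A \<inter> B)"
      using convex_hull_Int[of A B] by simp
    then show ?thesis using face_of_convex_hull_affine_independent[OF A] by blast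
  qed
qed

lemma inner_sum_Basis:
  fixes f :: "'v::euclidean_space \<Rightarrow> real"
  assumes "A \<subseteq> Basis" "b \<in> Basis"
  shows "(\<Sum>a\<in>A. f a *\<^sub>R a) \<bullet> b = (if b \<in> A then f b else 0)"
proof -
  have "finite A" using assms(1) finite_Basis finite_subset by blast
  have "(\<Sum>a\<in>A. f a *\<^sub>R a) \<bullet> b = (\<Sum>a\<in>A. if a = b then f b else 0)"
    unfolding inner_sum_left using assms by (intro sum.cong) (auto simp: inner_Basis)
  then show ?thesis using \<open>finite A\<close> by (simp add: sum.delta)
qed

lemma mem_convex_hull_basis:
  assumes A: "A \<subseteq> Basis"
  shows "x \<in> convex hull A \<longleftrightarrow>
    (\<forall>b\<in>Basis. 0 \<le> x \<bullet> b) \<and> (\<Sum>b\<in>Basis. x \<bullet> b) = 1 \<and> support x \<subseteq> A"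
proof -
  have fin: "finite A" using A finite_Basis finite_subset by blast
  show ?thesis
  proof
    assume "x \<in> convex hull A"
    then obtain u where u: "\<forall>a\<in>A. 0 \<le> u a" "sum u A = 1" "x = (\<Sum>a\<in>A. u a *\<^sub>R a)"
      unfolding convex_hull_finite[OF fin] by auto
    have xb: "x \<bullet> b = (if b \<in> A then u b else 0)" if "b \<in> Basis" for b
      unfolding u(3) using that by (rule inner_sum_Basis[OF A])
    have "(\<Sum>b\<in>Basis. x \<bullet> b) = (\<Sum>b\<in>Basis. if b \<in> A then u b else 0)"
      using xb by (intro sum.cong) auto
    also have "\<dots> = sum u A"
      using A by (simp add: sum.If_cases Int_absorb1)
    finally show "(\<forall>b\<in>Basis. 0 \<le> x \<bullet> b) \<and> (\<Sum>b\<in>Basis. x \<bullet> b) = 1 \<and> support x \<subseteq> A"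
      using u xb by (auto simp: support_def split: if_splits)
  next
    assume x: "(\<forall>b\<in>Basis. 0 \<le> x \<bullet> b) \<and> (\<Sum>b\<in>Basis. x \<bullet> b) = 1 \<and> support x \<subseteq> A"
    have "(\<Sum>a\<in>A. x \<bullet> a) = (\<Sum>b\<in>Basis. x \<bullet> b)"
      using x A by (intro sum.mono_neutral_left) (auto simp: support_def)
    moreover have "(\<Sum>a\<in>A. (x \<bullet> a) *\<^sub>R a) = (\<Sum>b\<in>Basis. (x \<bullet> b) *\<^sub>R b)"
      using x A by (intro sum.mono_neutral_left) (auto simp: support_def)
    ultimately show "x \<in> convex hull A"
      unfolding convex_hull_finite[OF fin]
      using x A by (intro CollectI exI[of _ "\<lambda>a. x \<bullet> a"]) (auto simp: euclidean_representation)
  qed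
qed

lemma mem_realization:
  assumes \<Delta>: "basis_complex \<Delta>"
  shows "x \<in> realization \<Delta> \<longleftrightarrow>
    (\<forall>b\<in>Basis. 0 \<le> x \<bullet> b) \<and> (\<Sum>b\<in>Basis. x \<bullet> b) = 1 \<and> support x \<in> \<Delta>"
proof
  assume "x \<in> realization \<Delta>"
  then obtain A where "A \<in> \<Delta>" "x \<in> convex hull A" unfolding realization_def by blast
  moreover have "A \<subseteq> Basis" "Pow A \<subseteq> \<Delta>" using \<Delta> \<open>A \<in> \<Delta>\<close> by (auto simp: basis_complex_def)
  ultimately show "(\<forall>b\<in>Basis. 0 \<le> x \<bullet> b) \<and> (\<Sum>b\<in>Basis. x \<bullet> b) = 1 \<and> support x \<in> \<Delta>"
    using mem_convex_hull_basis[of A x] by auto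
next
  assume x: "(\<forall>b\<in>Basis. 0 \<le> x \<bullet> b) \<and> (\<Sum>b\<in>Basis. x \<bullet> b) = 1 \<and> support x \<in> \<Delta>"
  have "support x \<subseteq> Basis" by (auto simp: support_def)
  then have "x \<in> convex hull (support x)" using x by (simp add: mem_convex_hull_basis)
  then show "x \<in> realization \<Delta>" using x unfolding realization_def by blast
qed

text \<open>flip\<close>

definition min_coord :: "'v::euclidean_space set \<Rightarrow> 'v \<Rightarrow> real" where
  "min_coord A x = Min ((\<lambda>a. x \<bullet> a) ` A)"

text \<open>The flip replaces the join of \<open>A\<close> with the boundary of \<open>B\<close> by the
  join of the boundary of \<open>A\<close> with \<open>B\<close>. The map takes away the
  multiple of \<open>\<Sum>A\<close> that a point contains and puts the same total weight on
  \<open>B\<close>. Points whose support does not contain \<open>A\<close> stay fixed, so a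
  single formula serves on the whole complex.\<close>

definition flip_map :: "'v::euclidean_space set \<Rightarrow> 'v set \<Rightarrow> 'v \<Rightarrow> 'v" where
  "flip_map A B x = x + min_coord A x *\<^sub>R ((real (card A) / real (card B)) *\<^sub>R \<Sum>B - \<Sum>A)"

text \<open>The faces of \<open>K\<close> above \<open>A\<close> form the join of \<open>A\<close> with
  the boundary of \<open>B\<close>, those of \<open>K'\<close> above \<open>B\<close> the
  join of \<open>B\<close> with the boundary of \<open>A\<close>, and all other faces are
  common. Written in this symmetric form, the relation makes the flip map for \<open>(B,
  A)\<close> available as the inverse.\<close>

definition bistellar_flip :: "'v set \<Rightarrow> 'v set \<Rightarrow> 'v set set \<Rightarrow> 'v set set \<Rightarrow> bool" where
  "bistellar_flip A B K K' \<longleftrightarrow>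
     (\<forall>\<tau>\<in>K. \<not> B \<subseteq> \<tau>) \<and> (\<forall>\<tau>\<in>K'. \<not> A \<subseteq> \<tau>) \<and>
     (\<forall>\<tau>. \<not> A \<subseteq> \<tau> \<longrightarrow> \<not> B \<subseteq> \<tau> \<longrightarrow> (\<tau> \<in> K \<longleftrightarrow> \<tau> \<in> K')) \<and>
     (\<forall>\<tau>. A \<subseteq> \<tau> \<longrightarrow> (\<tau> \<in> K \<longleftrightarrow> \<tau> \<subseteq> A \<union> B \<and> \<not> B \<subseteq> \<tau>)) \<and>
     (\<forall>\<tau>. B \<subseteq> \<tau> \<longrightarrow> (\<tau> \<in> K' \<longleftrightarrow> \<tau> \<subseteq> A \<union> B \<and> \<not> A \<subseteq> \<tau>))"

lemma bistellar_flip_sym: "bistellar_flip A B K K' \<Longrightarrow> bistellar_flip B A K' K"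
  unfolding bistellar_flip_def by (simp add: Un_commute)

lemma flip_map_inner:
  assumes "A \<subseteq> Basis" "B \<subseteq> Basis" "A \<inter> B = {}" "b \<in> Basis"
  shows "flip_map A B x \<bullet> b = x \<bullet> b +
    (if b \<in> A then - min_coord A x
     else if b \<in> B then real (card A) / real (card B) * min_coord A x else 0)"
proof -
  have "\<Sum>A \<bullet> b = (if b \<in> A then 1 else 0)" "\<Sum>B \<bullet> b = (if b \<in> B then 1 else 0)"
    using inner_sum_Basis[of A b "\<lambda>_. 1"] inner_sum_Basis[of B b "\<lambda>_. 1"] assms by simp_all
  then show ?thesis
    using assms(3) unfolding flip_map_def by (auto simp: inner_add_left inner_diff_left)
qed

lemma min_coord_props:
  assumes "finite A" "A \<noteq> {}"
  shows "\<And>a. a \<in> A \<Longrightarrow> min_coord A x \<le> x \<bullet> a" "\<exists>a\<in>A. x \<bullet> a = min_coord A x"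
proof -
  show "\<And>a. a \<in> A \<Longrightarrow> min_coord A x \<le> x \<bullet> a" unfolding min_coord_def using assms by simp
  have "min_coord A x \<in> (\<lambda>a. x \<bullet> a) ` A"
    unfolding min_coord_def using assms by (intro Min_in) auto
  then show "\<exists>a\<in>A. x \<bullet> a = min_coord A x" by force
qed

lemma min_coord_eqI:
  assumes "finite A" "a \<in> A" "x \<bullet> a = m" "\<And>a. a \<in> A \<Longrightarrow> m \<le> x \<bullet> a"
  shows "min_coord A x = m"
  unfolding min_coord_def using assms by (intro Min_eqI) auto

text \<open>Before the flip some coordinate in \<open>B\<close> vanishes, since \<open>B\<close> is not
  a face of \<open>K\<close>. Afterwards the minimum over \<open>B\<close> is therefore
  exactly the weight put on \<open>B\<close>, and the opposite flip map removes it again.\<close>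

lemma flip_map_mem:
  assumes K: "basis_complex K" "basis_complex K'" and flip: "bistellar_flip A B K K'"
    and A: "A \<subseteq> Basis" "A \<noteq> {}" and B: "B \<subseteq> Basis" "B \<noteq> {}" and AB: "A \<inter> B = {}"
    and x: "x \<in> realization K"
  shows "flip_map A B x \<in> realization K'" "flip_map B A (flip_map A B x) = x"
proof -
  have fin: "finite A" "finite B" using A(1) B(1) finite_Basis finite_subset by blast+
  have cA: "card A > 0" and cB: "card B > 0" using fin A(2) B(2) by auto
  let ?m = "min_coord A x" and ?c = "real (card A) / real (card B)" and ?y = "flip_map A B x"
  have x0: "\<And>b. b \<in> Basis \<Longrightarrow> 0 \<le> x \<bullet> b" and x1: "(\<Sum>b\<in>Basis. x \<bullet> b) = 1" and xK: "support x \<in> K"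
    using x by (simp_all add: mem_realization[OF K(1)])
  obtain a where a: "a \<in> A" "x \<bullet> a = ?m" using min_coord_props(2)[OF fin(1) A(2)] by blast
  have m0: "0 \<le> ?m" using x0 a A(1) by (metis subsetD)
  have "\<not> B \<subseteq> support x" using flip xK by (simp add: bistellar_flip_def)
  then obtain b where b: "b \<in> B" "x \<bullet> b = 0" using B(1) by (auto simp: support_def)
  note y = flip_map_inner[OF A(1) B(1) AB, of _ x]
  have y0: "0 \<le> ?y \<bullet> v" if "v \<in> Basis" for v
    using y[OF that] x0[OF that] m0 min_coord_props(1)[OF fin(1) A(2), of v x] by (auto split: if_splits)
  have "(\<Sum>v\<in>Basis. ?y \<bullet> v) = (\<Sum>v\<in>Basis. x \<bullet> v) +
      (\<Sum>v\<in>Basis. (if v \<in> A then - ?m else 0) + (if v \<in> B then ?c * ?m else 0))"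
    unfolding sum.distrib[symmetric] using y AB by (intro sum.cong) auto
  also have "\<dots> = 1 + (- real (card A) * ?m + real (card B) * (?c * ?m))"
    using A(1) B(1) x1 by (simp add: sum.distrib sum.If_cases Int_absorb1)
  also have "\<dots> = 1" using cB by simp
  finally have y1: "(\<Sum>v\<in>Basis. ?y \<bullet> v) = 1" .
  have yK: "support ?y \<in> K'"
  proof (cases "?m = 0")
    case True
    then have "?y = x" by (simp add: flip_map_def)
    moreover have "\<not> A \<subseteq> support x" using a True by (auto simp: support_def)
    ultimately show ?thesis using flip xK \<open>\<not> B \<subseteq> support x\<close> unfolding bistellar_flip_def by metis
  next
    case False
    then have m: "?m > 0" using m0 by simp
    have "A \<subseteq> support x"
      using min_coord_props(1)[OF fin(1) A(2), of _ x] m A(1) by (force simp: support_def)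
    then have sx: "support x \<subseteq> A \<union> B" using flip xK unfolding bistellar_flip_def by metis
    have "B \<subseteq> support ?y"
    proof
      fix v assume v: "v \<in> B"
      then have "v \<in> Basis" "v \<notin> A" using B(1) AB by blast+
      then have "?y \<bullet> v = x \<bullet> v + ?c * ?m" using y[of v] v by simp
      moreover have "?c * ?m > 0" using cA cB m by simp
      ultimately show "v \<in> support ?y" using x0[of v] v B(1) by (auto simp: support_def)
    qed
    moreover have "support ?y \<subseteq> A \<union> B" using sx y by (auto simp: support_def)
    moreover have "\<not> A \<subseteq> support ?y" using a y[of a] A(1) by (auto simp: support_def)
    ultimately show ?thesis using flip unfolding bistellar_flip_def by metis
  qed
  show "?y \<in> realization K'"
    unfolding mem_realization[OF K(2)] using y0 y1 yK by blast
  have "min_coord B ?y = ?c * ?m"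
  proof (rule min_coord_eqI[OF fin(2) b(1)])
    have yB: "?y \<bullet> v = x \<bullet> v + ?c * ?m" if "v \<in> B" for v
    proof -
      have "v \<in> Basis" "v \<notin> A" using that B(1) AB by blast+
      then show ?thesis using y[of v] that by simp
    qed
    show "?y \<bullet> b = ?c * ?m" using yB b by simp
    show "?c * ?m \<le> ?y \<bullet> v" if "v \<in> B" for v
      using yB[OF that] x0[of v] that B(1) by auto
  qed
  then show "flip_map B A ?y = x"
    using cA cB unfolding flip_map_def by (simp add: algebra_simps)
qed

lemma finite_total_least:
  assumes "finite A" "A \<noteq> {}"
    and total: "\<And>a b. a \<in> A \<Longrightarrow> b \<in> A \<Longrightarrow> R a b \<or> R b a"
    and trans: "\<And>a b c. R a b \<Longrightarrow> R b c \<Longrightarrow> R a c"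
  shows "\<exists>a\<in>A. \<forall>b\<in>A. R a b"
  using assms(1,2) total
proof (induction rule: finite_ne_induct)
  case (singleton x) then show ?case by blast
next
  case (insert x F)
  then obtain a where "a \<in> F" "\<forall>b\<in>F. R a b" by blast
  then show ?case using insert.prems trans by (metis insert_iff)
qed

text \<open>The flip map is affine wherever one fixed coordinate is the smallest of those in
  \<open>A\<close>; cutting the complex by all hyperplanes \<open>x \<bullet> a = x
  \<bullet> b\<close> with \<open>a, b \<in> A\<close> produces such cells.\<close>

proposition pl_homeomorphic_bistellar_flip:
  assumes K: "basis_complex K" "basis_complex K'" and flip: "bistellar_flip A B K K'"
    and A: "A \<subseteq> Basis" "A \<noteq> {}" and B: "B \<subseteq> Basis" "B \<noteq> {}" and AB: "A \<inter> B = {}"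
  shows "pl_homeomorphic (realization K) (realization K')"
proof -
  let ?f = "flip_map A B"
  let ?I = "(\<lambda>(a, b). (a - b, 0)) ` (A \<times> A) :: ('a \<times> real) set"
  have fin: "finite A" using A(1) finite_Basis finite_subset by blast
  have C: "cell_family ((hull) convex ` K)"
    using simplicial_complex_basis[OF K(1)] by (rule simplicial_complex_cell_family)
  have "finite ?I" using fin by simp
  from cell_subdivision_lemma[of "(hull) convex ` K" "int DIM('a)", OF _ _ aff_dim_le_DIM _ this]
  obtain S where S: "\<Union>S = \<Union>((hull) convex ` K)" "cell_family S"
    and SI: "\<forall>X\<in>S. \<forall>x\<in>X. \<forall>y\<in>X. \<forall>a b. (a, b) \<in> ?I \<longrightarrow>
        a \<bullet> x \<le> b \<and> a \<bullet> y \<le> b \<or> a \<bullet> x \<ge> b \<and> a \<bullet> y \<ge> b"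
    using C unfolding cell_family_def by auto
  have US: "\<Union>S = realization K" using S(1) by (simp add: realization_def)
  have "affine_on_cell ?f P" if P: "P \<in> S" for P
  proof -
    have "\<exists>a\<in>A. \<forall>b\<in>A. \<forall>x\<in>P. x \<bullet> a \<le> x \<bullet> b"
    proof (rule finite_total_least[OF fin A(2)])
      fix a b assume ab: "a \<in> A" "b \<in> A"
      show "(\<forall>x\<in>P. x \<bullet> a \<le> x \<bullet> b) \<or> (\<forall>x\<in>P. x \<bullet> b \<le> x \<bullet> a)"
      proof (rule ccontr)
        assume "\<not> ?thesis"
        then obtain x y where xy: "x \<in> P" "y \<in> P" "x \<bullet> a > x \<bullet> b" "y \<bullet> b > y \<bullet> a"
          by (auto simp: not_le)
        have "(a - b, 0) \<in> ?I" using ab by auto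
        then have "(a - b) \<bullet> x \<le> 0 \<and> (a - b) \<bullet> y \<le> 0 \<or> (a - b) \<bullet> x \<ge> 0 \<and> (a - b) \<bullet> y \<ge> 0"
          using SI P xy(1,2) by blast
        then show False using xy(3,4) unfolding inner_diff_left by (auto simp: inner_commute)
      qed
    next
      fix a b c assume "\<forall>x\<in>P. x \<bullet> a \<le> x \<bullet> b" "\<forall>x\<in>P. x \<bullet> b \<le> x \<bullet> c"
      then show "\<forall>x\<in>P. x \<bullet> a \<le> x \<bullet> c" by (meson order_trans)
    qed
    then obtain a where a: "a \<in> A" "\<And>b x. b \<in> A \<Longrightarrow> x \<in> P \<Longrightarrow> x \<bullet> a \<le> x \<bullet> b" by blast
    have m: "min_coord A x = x \<bullet> a" if "x \<in> P" for x
      by (rule min_coord_eqI[OF fin a(1)]) (use a(2) that in auto)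
    have cP: "convex P" using S(2) P polytope_imp_convex unfolding cell_family_def by blast
    define w where "w = (real (card A) / real (card B)) *\<^sub>R \<Sum>B - \<Sum>A"
    have fP: "?f x = x + (x \<bullet> a) *\<^sub>R w" if "x \<in> P" for x
      using m[OF that] by (simp add: flip_map_def w_def)
    show ?thesis
      unfolding affine_on_cell_def
    proof clarify
      fix x y and u :: real assume xy: "x \<in> P" "y \<in> P" and u: "0 \<le> u" "u \<le> 1"
      then have "(1 - u) *\<^sub>R x + u *\<^sub>R y \<in> P" using cP by (simp add: convex_alt)
      then show "?f ((1 - u) *\<^sub>R x + u *\<^sub>R y) = (1 - u) *\<^sub>R ?f x + u *\<^sub>R ?f y"
        using xy by (simp add: fP inner_add_left inner_diff_left algebra_simps)
    qed
  qed
  moreover have "inj_on ?f (realization K)"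
    by (rule inj_on_inverseI[of _ "flip_map B A"]) (rule flip_map_mem(2)[OF assms])
  moreover have "?f ` realization K = realization K'"
  proof
    show "?f ` realization K \<subseteq> realization K'" using flip_map_mem(1)[OF assms] by blast
    show "realization K' \<subseteq> ?f ` realization K"
    proof
      fix y assume "y \<in> realization K'"
      moreover have "B \<inter> A = {}" using AB by blast
      ultimately have "flip_map B A y \<in> realization K" "?f (flip_map B A y) = y"
        using flip_map_mem[OF K(2,1) bistellar_flip_sym[OF flip] B A] by blast+
      then show "y \<in> ?f ` realization K" by (metis imageI)
    qed
  qed
  ultimately show ?thesis unfolding pl_homeomorphic_def using S(2) US by blast
qed

section \<open>Two-way shellings give spheres\<close>

lemma pl_homeomorphic_refl_basis:
  assumes "basis_complex \<Delta>"
  shows "pl_homeomorphic (realization \<Delta>) (realization \<Delta>)"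
  unfolding pl_homeomorphic_def
proof (intro exI conjI ballI)
  show "cell_family ((hull) convex ` \<Delta>)"
    using assms by (intro simplicial_complex_cell_family simplicial_complex_basis)
  show "\<Union> ((hull) convex ` \<Delta>) = realization \<Delta>" by (simp add: realization_def)
  show "affine_on_cell id P" for P :: "'a set" by (simp add: affine_on_cell_def)
qed auto

lemma convex_hull_basis_subset_iff:
  assumes "A \<subseteq> Basis" "B \<subseteq> Basis"
  shows "convex hull A \<subseteq> convex hull B \<longleftrightarrow> A \<subseteq> B"
proof
  assume AB: "convex hull A \<subseteq> convex hull B"
  show "A \<subseteq> B"
  proof
    fix a assume "a \<in> A"
    then have "a \<in> convex hull B" using AB by (simp add: hull_inc subset_iff)
    then have "support a \<subseteq> B" using mem_convex_hull_basis[OF assms(2)] by blast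
    moreover have "a \<in> support a" using \<open>a \<in> A\<close> assms(1) by (auto simp: support_def)
    ultimately show "a \<in> B" by blast
  qed
qed (rule hull_mono)

lemma Union_boundary_faces_basis:
  assumes A: "A \<subseteq> Basis"
  shows "\<Union>(boundary_faces (convex hull A)) = realization (Pow A - {A})"
proof -
  have "boundary_faces (convex hull A) = (hull) convex ` (Pow A - {A})"
    unfolding boundary_faces_def face_of_convex_hull_affine_independent[OF basis_affine_independent[OF A]]
    using convex_hull_basis_subset_iff[OF A] A by auto
  then show ?thesis by (simp add: realization_def)
qed

definition faces :: "'a set set \<Rightarrow> 'a set set" where
  "faces U = {\<tau>. \<exists>\<sigma>\<in>U. \<tau> \<subseteq> \<sigma>}"

text \<open>\<open>U\<close> holds the facets used so far and \<open>V\<close> those still to come;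
  \<open>p\<close> is the apex of the cone that closes up the part covered by
  \<open>U\<close>.\<close>

definition coned_boundary :: "'a \<Rightarrow> 'a set set \<Rightarrow> 'a set set \<Rightarrow> 'a set set" where
  "coned_boundary p U V = faces U \<union> insert p ` (faces U \<inter> faces V)"

lemma mem_coned_boundary:
  assumes p: "p \<notin> \<Union>U"
  shows "\<tau> \<in> coned_boundary p U V \<longleftrightarrow>
    (if p \<in> \<tau> then \<tau> - {p} \<in> faces U \<and> \<tau> - {p} \<in> faces V else \<tau> \<in> faces U)"
proof (cases "p \<in> \<tau>")
  case True
  have pU: "p \<notin> \<rho>" if "\<rho> \<in> faces U" for \<rho> using that p unfolding faces_def by blast
  have "\<tau> \<in> insert p ` (faces U \<inter> faces V) \<longleftrightarrow> \<tau> - {p} \<in> faces U \<inter> faces V"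
  proof
    assume "\<tau> \<in> insert p ` (faces U \<inter> faces V)"
    then obtain \<rho> where \<rho>: "\<rho> \<in> faces U \<inter> faces V" "\<tau> = insert p \<rho>" by blast
    then have "\<tau> - {p} = \<rho>" using pU by auto
    then show "\<tau> - {p} \<in> faces U \<inter> faces V" using \<rho>(1) by simp
  next
    assume "\<tau> - {p} \<in> faces U \<inter> faces V"
    moreover have "\<tau> = insert p (\<tau> - {p})" using True by blast
    ultimately show "\<tau> \<in> insert p ` (faces U \<inter> faces V)" by (metis imageI)
  qed
  moreover have "\<tau> \<notin> faces U" using True pU by blast
  ultimately show ?thesis using True by (simp add: coned_boundary_def)
next
  case False
  then show ?thesis by (auto simp: coned_boundary_def)
qed

text \<open>This is the pattern formed by the vertices of a simple polytope and a linear functional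
  \<open>h\<close>, read in the dual complex. The facet \<open>\<sigma>\<close> has a lower
  neighbour across its ridges opposite to the points of \<open>R \<sigma>\<close> and a
  higher one across the others. By the last two conditions local extrema are strict and
  global: if no lower neighbour contains a face of \<open>\<sigma>\<close>, then
  \<open>\<sigma>\<close> is the lowest of all facets containing it, and dually. Different
  facets may have equal values of \<open>h\<close>.\<close>

locale two_way_shelling =
  fixes \<Phi> :: "'v set set" and h :: "'v set \<Rightarrow> real" and R :: "'v set \<Rightarrow> 'v set"
  assumes R_subset: "\<sigma> \<in> \<Phi> \<Longrightarrow> R \<sigma> \<subseteq> \<sigma>"
    and lower_neighbour: "\<sigma> \<in> \<Phi> \<Longrightarrow> v \<in> R \<sigma> \<Longrightarrow> \<exists>\<sigma>'\<in>\<Phi>. \<sigma> - {v} \<subseteq> \<sigma>' \<and> h \<sigma>' < h \<sigma>"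
    and upper_neighbour: "\<sigma> \<in> \<Phi> \<Longrightarrow> v \<in> \<sigma> - R \<sigma> \<Longrightarrow> \<exists>\<sigma>'\<in>\<Phi>. \<sigma> - {v} \<subseteq> \<sigma>' \<and> h \<sigma> < h \<sigma>'"
    and min_unique: "\<sigma> \<in> \<Phi> \<Longrightarrow> \<sigma>' \<in> \<Phi> \<Longrightarrow> \<sigma> \<noteq> \<sigma>' \<Longrightarrow> R \<sigma> \<subseteq> \<sigma>' \<Longrightarrow> h \<sigma> < h \<sigma>'"
    and max_unique: "\<sigma> \<in> \<Phi> \<Longrightarrow> \<sigma>' \<in> \<Phi> \<Longrightarrow> \<sigma> \<noteq> \<sigma>' \<Longrightarrow> \<sigma> - R \<sigma> \<subseteq> \<sigma>' \<Longrightarrow> h \<sigma>' < h \<sigma>"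
begin

text \<open>The lowest facet has higher neighbours across all its ridges, so its entire boundary is
  shared with later facets and is coned off.\<close>

lemma coned_boundary_first:
  assumes \<sigma>: "\<sigma> \<in> \<Phi>" and least: "\<And>\<sigma>'. \<sigma>' \<in> \<Phi> \<Longrightarrow> h \<sigma> \<le> h \<sigma>'" and p: "p \<notin> \<Union>\<Phi>"
  shows "coned_boundary p {\<sigma>} (\<Phi> - {\<sigma>}) = Pow (insert p \<sigma>) - {insert p \<sigma>}"
proof -
  have R: "R \<sigma> = {}"
  proof (rule ccontr)
    assume "R \<sigma> \<noteq> {}"
    then obtain \<sigma>' where "\<sigma>' \<in> \<Phi>" "h \<sigma>' < h \<sigma>" using lower_neighbour[OF \<sigma>] by blast
    then show False using least[of \<sigma>'] by simp
  qed
  have "faces {\<sigma>} \<inter> faces (\<Phi> - {\<sigma>}) = Pow \<sigma> - {\<sigma>}"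
  proof
    have "\<not> \<sigma> \<subseteq> \<sigma>'" if "\<sigma>' \<in> \<Phi>" "\<sigma>' \<noteq> \<sigma>" for \<sigma>'
    proof
      assume "\<sigma> \<subseteq> \<sigma>'"
      then have "h \<sigma> < h \<sigma>'" "h \<sigma>' < h \<sigma>"
        using max_unique[OF \<sigma> that(1)] min_unique[OF \<sigma> that(1)] that(2) R by auto
      then show False by simp
    qed
    then show "faces {\<sigma>} \<inter> faces (\<Phi> - {\<sigma>}) \<subseteq> Pow \<sigma> - {\<sigma>}" unfolding faces_def by blast
    show "Pow \<sigma> - {\<sigma>} \<subseteq> faces {\<sigma>} \<inter> faces (\<Phi> - {\<sigma>})"
    proof
      fix \<tau> assume \<tau>: "\<tau> \<in> Pow \<sigma> - {\<sigma>}"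
      then obtain v where v: "v \<in> \<sigma>" "v \<notin> \<tau>" by blast
      then obtain \<sigma>' where "\<sigma>' \<in> \<Phi>" "\<sigma> - {v} \<subseteq> \<sigma>'" "h \<sigma> < h \<sigma>'"
        using upper_neighbour[OF \<sigma>] R by blast
      then have "\<sigma>' \<in> \<Phi> - {\<sigma>}" "\<tau> \<subseteq> \<sigma>'" using \<tau> v by auto
      then show "\<tau> \<in> faces {\<sigma>} \<inter> faces (\<Phi> - {\<sigma>})" using \<tau> unfolding faces_def by blast
    qed
  qed
  then have inter: "\<tau> \<in> faces {\<sigma>} \<and> \<tau> \<in> faces (\<Phi> - {\<sigma>}) \<longleftrightarrow> \<tau> \<subseteq> \<sigma> \<and> \<tau> \<noteq> \<sigma>" for \<tau> by blast
  have p\<sigma>: "p \<notin> \<sigma>" "p \<notin> \<Union>{\<sigma>}" using p \<sigma> by blast+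
  show ?thesis
  proof (rule set_eqI)
    fix \<tau>
    show "\<tau> \<in> coned_boundary p {\<sigma>} (\<Phi> - {\<sigma>}) \<longleftrightarrow> \<tau> \<in> Pow (insert p \<sigma>) - {insert p \<sigma>}"
    proof (cases "p \<in> \<tau>")
      case True
      then have "\<tau> - {p} \<subseteq> \<sigma> \<longleftrightarrow> \<tau> \<subseteq> insert p \<sigma>" "\<tau> - {p} = \<sigma> \<longleftrightarrow> \<tau> = insert p \<sigma>"
        using p\<sigma>(1) by blast+
      then show ?thesis using True unfolding mem_coned_boundary[OF p\<sigma>(2)] inter by simp
    next
      case False
      then have "\<tau> \<in> faces {\<sigma>} \<longleftrightarrow> \<tau> \<in> Pow (insert p \<sigma>) - {insert p \<sigma>}"
        unfolding faces_def by blast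
      then show ?thesis using False unfolding mem_coned_boundary[OF p\<sigma>(2)] by simp
    qed
  qed
qed

text \<open>The ball to be replaced is the join of \<open>insert p (\<sigma> - R \<sigma>)\<close> with
  the boundary of \<open>R \<sigma>\<close>. The minimum property says that no earlier facet
  contains \<open>R \<sigma>\<close>, and the maximum property that among the facets still
  to come only \<open>\<sigma>\<close> contains \<open>\<sigma> - R \<sigma>\<close>.
  Conversely, lower and higher neighbours show that the faces of \<open>\<sigma>\<close> not
  containing \<open>R \<sigma>\<close> lie in earlier facets and those not containing
  \<open>\<sigma> - R \<sigma>\<close> in later ones.\<close>

lemma coned_boundary_step:
  assumes UV: "U \<union> V = \<Phi>" "U \<inter> V = {}" and \<sigma>: "\<sigma> \<in> V"
    and U_le: "\<And>\<sigma>'. \<sigma>' \<in> U \<Longrightarrow> h \<sigma>' \<le> h \<sigma>" and V_ge: "\<And>\<sigma>'. \<sigma>' \<in> V \<Longrightarrow> h \<sigma> \<le> h \<sigma>'"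
    and p: "p \<notin> \<Union>\<Phi>"
  shows "bistellar_flip (insert p (\<sigma> - R \<sigma>)) (R \<sigma>)
    (coned_boundary p U V) (coned_boundary p (insert \<sigma> U) (V - {\<sigma>}))"
proof -
  let ?K = "coned_boundary p U V" and ?K' = "coned_boundary p (insert \<sigma> U) (V - {\<sigma>})"
  have \<sigma>\<Phi>: "\<sigma> \<in> \<Phi>" using UV \<sigma> by blast
  have R_sub: "R \<sigma> \<subseteq> \<sigma>" by (rule R_subset[OF \<sigma>\<Phi>])
  have p\<sigma>: "p \<notin> \<sigma>" using p \<sigma>\<Phi> by blast
  have no_R: "\<not> R \<sigma> \<subseteq> \<tau>" if "\<tau> \<in> faces U" for \<tau>
  proof
    assume "R \<sigma> \<subseteq> \<tau>"
    then obtain \<sigma>' where "\<sigma>' \<in> U" "R \<sigma> \<subseteq> \<sigma>'" using \<open>\<tau> \<in> faces U\<close> unfolding faces_def by blast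
    moreover have "\<sigma>' \<in> \<Phi>" "\<sigma> \<noteq> \<sigma>'" using \<open>\<sigma>' \<in> U\<close> UV \<sigma> by blast+
    ultimately show False using min_unique[OF \<sigma>\<Phi>, of \<sigma>'] U_le[of \<sigma>'] by simp
  qed
  have no_G: "\<not> \<sigma> - R \<sigma> \<subseteq> \<tau>" if "\<tau> \<in> faces (V - {\<sigma>})" for \<tau>
  proof
    assume "\<sigma> - R \<sigma> \<subseteq> \<tau>"
    then obtain \<sigma>' where "\<sigma>' \<in> V - {\<sigma>}" "\<sigma> - R \<sigma> \<subseteq> \<sigma>'"
      using \<open>\<tau> \<in> faces (V - {\<sigma>})\<close> unfolding faces_def by blast
    moreover have "\<sigma>' \<in> \<Phi>" "\<sigma> \<noteq> \<sigma>'" using \<open>\<sigma>' \<in> V - {\<sigma>}\<close> UV by blast+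
    ultimately show False using max_unique[OF \<sigma>\<Phi>, of \<sigma>'] V_ge[of \<sigma>'] by simp
  qed
  have in_U: "\<tau> \<in> faces U" if "\<tau> \<subseteq> \<sigma>" "\<not> R \<sigma> \<subseteq> \<tau>" for \<tau>
  proof -
    obtain v where v: "v \<in> R \<sigma>" "v \<notin> \<tau>" using \<open>\<not> R \<sigma> \<subseteq> \<tau>\<close> by blast
    obtain \<sigma>' where "\<sigma>' \<in> \<Phi>" "\<sigma> - {v} \<subseteq> \<sigma>'" "h \<sigma>' < h \<sigma>"
      using lower_neighbour[OF \<sigma>\<Phi> v(1)] by blast
    moreover have "\<sigma>' \<notin> V" using V_ge[of \<sigma>'] \<open>h \<sigma>' < h \<sigma>\<close> by auto
    ultimately have "\<sigma>' \<in> U" "\<tau> \<subseteq> \<sigma>'" using UV(1) \<open>\<tau> \<subseteq> \<sigma>\<close> v(2) by blast+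
    then show ?thesis unfolding faces_def by blast
  qed
  have in_V: "\<tau> \<in> faces (V - {\<sigma>})" if "\<tau> \<subseteq> \<sigma>" "\<not> \<sigma> - R \<sigma> \<subseteq> \<tau>" for \<tau>
  proof -
    obtain v where v: "v \<in> \<sigma> - R \<sigma>" "v \<notin> \<tau>" using \<open>\<not> \<sigma> - R \<sigma> \<subseteq> \<tau>\<close> by blast
    obtain \<sigma>' where "\<sigma>' \<in> \<Phi>" "\<sigma> - {v} \<subseteq> \<sigma>'" "h \<sigma> < h \<sigma>'"
      using upper_neighbour[OF \<sigma>\<Phi> v(1)] by blast
    moreover have "\<sigma>' \<notin> U" "\<sigma>' \<noteq> \<sigma>" using U_le[of \<sigma>'] \<open>h \<sigma> < h \<sigma>'\<close> by auto
    ultimately have "\<sigma>' \<in> V - {\<sigma>}" "\<tau> \<subseteq> \<sigma>'" using UV(1) \<open>\<tau> \<subseteq> \<sigma>\<close> v(2) by blast+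
    then show ?thesis unfolding faces_def by blast
  qed
  have faces_V: "faces V = Pow \<sigma> \<union> faces (V - {\<sigma>})" using \<sigma> unfolding faces_def by blast
  have faces_U: "faces (insert \<sigma> U) = Pow \<sigma> \<union> faces U" unfolding faces_def by blast
  have pU: "p \<notin> \<Union>U" "p \<notin> \<Union>(insert \<sigma> U)" using p UV \<sigma> by blast+
  note K = mem_coned_boundary[OF pU(1), of _ V]
  note K' = mem_coned_boundary[OF pU(2), of _ "V - {\<sigma>}"]
  have A_iff: "insert p (\<sigma> - R \<sigma>) \<subseteq> \<tau> \<longleftrightarrow> p \<in> \<tau> \<and> \<sigma> - R \<sigma> \<subseteq> \<tau> - {p}"
    and B_iff: "R \<sigma> \<subseteq> \<tau> \<longleftrightarrow> R \<sigma> \<subseteq> \<tau> - {p}"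
    and AB_iff: "\<tau> \<subseteq> insert p (\<sigma> - R \<sigma>) \<union> R \<sigma> \<longleftrightarrow> \<tau> - {p} \<subseteq> \<sigma>" for \<tau>
    using p\<sigma> R_sub by auto
  show ?thesis
    unfolding bistellar_flip_def
  proof (intro conjI ballI allI impI)
    show "\<not> R \<sigma> \<subseteq> \<tau>" if "\<tau> \<in> ?K" for \<tau>
    proof (cases "p \<in> \<tau>")
      case True
      then have "\<tau> - {p} \<in> faces U" using that K by simp
      then show ?thesis using no_R B_iff by blast
    next
      case False
      then have "\<tau> \<in> faces U" using that K by simp
      then show ?thesis by (rule no_R)
    qed
    show "\<not> insert p (\<sigma> - R \<sigma>) \<subseteq> \<tau>" if "\<tau> \<in> ?K'" for \<tau>
    proof
      assume "insert p (\<sigma> - R \<sigma>) \<subseteq> \<tau>"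
      then have "p \<in> \<tau>" "\<sigma> - R \<sigma> \<subseteq> \<tau> - {p}" using A_iff by blast+
      moreover have "\<tau> - {p} \<in> faces (V - {\<sigma>})" using that \<open>p \<in> \<tau>\<close> K' by simp
      ultimately show False using no_G by blast
    qed
    show "\<tau> \<in> ?K \<longleftrightarrow> \<tau> \<in> ?K'" if "\<not> insert p (\<sigma> - R \<sigma>) \<subseteq> \<tau>" "\<not> R \<sigma> \<subseteq> \<tau>" for \<tau>
    proof (cases "p \<in> \<tau>")
      case True
      then have nG: "\<not> \<sigma> - R \<sigma> \<subseteq> \<tau> - {p}" and nR: "\<not> R \<sigma> \<subseteq> \<tau> - {p}"
        using that A_iff B_iff by blast+
      have "\<tau> - {p} \<in> faces U" "\<tau> - {p} \<in> faces (V - {\<sigma>})" if "\<tau> - {p} \<subseteq> \<sigma>"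
        using in_U[OF that nR] in_V[OF that nG] .
      then show ?thesis
        using K[of \<tau>] K'[of \<tau>] True faces_U faces_V by auto
    next
      case False
      then show ?thesis using K[of \<tau>] K'[of \<tau>] faces_U in_U[OF _ that(2)] by auto
    qed
    show "\<tau> \<in> ?K \<longleftrightarrow> \<tau> \<subseteq> insert p (\<sigma> - R \<sigma>) \<union> R \<sigma> \<and> \<not> R \<sigma> \<subseteq> \<tau>"
      if "insert p (\<sigma> - R \<sigma>) \<subseteq> \<tau>" for \<tau>
    proof -
      have \<tau>: "p \<in> \<tau>" "\<sigma> - R \<sigma> \<subseteq> \<tau> - {p}" using that A_iff by blast+
      have "\<tau> \<in> ?K \<longleftrightarrow> \<tau> - {p} \<in> faces U \<and> \<tau> - {p} \<in> faces V" using K[of \<tau>] \<tau>(1) by simp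
      also have "\<dots> \<longleftrightarrow> \<tau> - {p} \<in> faces U \<and> \<tau> - {p} \<subseteq> \<sigma>"
        using no_G[of "\<tau> - {p}"] faces_V \<tau>(2) by auto
      also have "\<dots> \<longleftrightarrow> \<tau> - {p} \<subseteq> \<sigma> \<and> \<not> R \<sigma> \<subseteq> \<tau> - {p}"
        using in_U[of "\<tau> - {p}"] no_R[of "\<tau> - {p}"] by metis
      finally show ?thesis by (simp only: AB_iff[of \<tau>] B_iff[of \<tau>])
    qed
    show "\<tau> \<in> ?K' \<longleftrightarrow> \<tau> \<subseteq> insert p (\<sigma> - R \<sigma>) \<union> R \<sigma> \<and> \<not> insert p (\<sigma> - R \<sigma>) \<subseteq> \<tau>"
      if "R \<sigma> \<subseteq> \<tau>" for \<tau>
    proof -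
      have R\<tau>: "R \<sigma> \<subseteq> \<tau> - {p}" using that by (simp only: B_iff[of \<tau>])
      have U_iff: "\<tau> - {p} \<in> faces (insert \<sigma> U) \<longleftrightarrow> \<tau> - {p} \<subseteq> \<sigma>"
        using no_R[of "\<tau> - {p}"] R\<tau> faces_U by auto
      show ?thesis
      proof (cases "p \<in> \<tau>")
        case True
        have "\<tau> \<in> ?K' \<longleftrightarrow> \<tau> - {p} \<subseteq> \<sigma> \<and> \<tau> - {p} \<in> faces (V - {\<sigma>})"
          using K'[of \<tau>] True U_iff by simp
        also have "\<dots> \<longleftrightarrow> \<tau> - {p} \<subseteq> \<sigma> \<and> \<not> \<sigma> - R \<sigma> \<subseteq> \<tau> - {p}"
          using in_V[of "\<tau> - {p}"] no_G[of "\<tau> - {p}"] by metis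
        finally show ?thesis using True by (simp only: AB_iff[of \<tau>] A_iff[of \<tau>]) simp
      next
        case False
        then have "\<tau> \<in> ?K' \<longleftrightarrow> \<tau> - {p} \<subseteq> \<sigma>" using K'[of \<tau>] U_iff by simp
        then show ?thesis using False by (simp only: AB_iff[of \<tau>] A_iff[of \<tau>]) simp
      qed
    qed
  qed
qed

end

lemma basis_complex_coned_boundary:
  assumes "U \<subseteq> Pow Basis" "p \<in> Basis"
  shows "basis_complex (coned_boundary p U V)"
  unfolding basis_complex_def
proof (intro ballI conjI)
  fix A assume "A \<in> coned_boundary p U V"
  then have A: "A \<in> faces U \<or> (\<exists>C. C \<in> faces U \<and> C \<in> faces V \<and> A = insert p C)"
    unfolding coned_boundary_def by blast
  have "C \<subseteq> Basis" if "C \<in> faces U" for C using that assms(1) unfolding faces_def by blast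
  then show "A \<subseteq> Basis" using A assms(2) by blast
  have down: "D \<in> faces W" if "C \<in> faces W" "D \<subseteq> C" for C D :: "'a set" and W
    using that unfolding faces_def by blast
  show "Pow A \<subseteq> coned_boundary p U V"
  proof
    fix B assume "B \<in> Pow A"
    consider "A \<in> faces U" | C where "C \<in> faces U" "C \<in> faces V" "A = insert p C" using A by blast
    then show "B \<in> coned_boundary p U V"
    proof cases
      case 1
      then have "B \<in> faces U" using down \<open>B \<in> Pow A\<close> by blast
      then show ?thesis unfolding coned_boundary_def by blast
    next
      case 2
      then have "B - {p} \<subseteq> C" using \<open>B \<in> Pow A\<close> by blast
      then have "B - {p} \<in> faces U" "B - {p} \<in> faces V" using 2 down by blast+
      moreover have "B = B - {p} \<or> B = insert p (B - {p})" by blast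
      ultimately show ?thesis unfolding coned_boundary_def by (metis IntI UnCI imageI)
    qed
  qed
qed

text \<open>Induction over the initial segments \<open>U\<close> of the order given by \<open>h\<close>,
  with ties broken arbitrarily, undoing the flip of a highest facet of \<open>U\<close> in
  each step.\<close>

proposition two_way_shelling_sphere:
  fixes \<Phi> :: "'v::euclidean_space set set"
  assumes "two_way_shelling \<Phi> h R" and \<Phi>: "\<Phi> \<noteq> {}" "\<Phi> \<subseteq> Pow Basis" and p: "p \<in> Basis" "p \<notin> \<Union>\<Phi>"
  shows "\<exists>\<sigma>\<in>\<Phi>. pl_homeomorphic (realization (faces \<Phi>)) (\<Union>(boundary_faces (convex hull (insert p \<sigma>))))"
proof -
  interpret two_way_shelling \<Phi> h R by fact
  let ?goal = "\<lambda>U. \<exists>\<sigma>\<in>\<Phi>. pl_homeomorphic (realization (coned_boundary p U (\<Phi> - U)))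
      (\<Union>(boundary_faces (convex hull (insert p \<sigma>))))"
  have fin: "finite \<Phi>" using \<Phi>(2) by (rule finite_subset) simp
  have "?goal U" if "U \<subseteq> \<Phi>" "U \<noteq> {}" "\<And>a b. a \<in> U \<Longrightarrow> b \<in> \<Phi> - U \<Longrightarrow> h a \<le> h b" for U
    using finite_subset[OF that(1) fin] that
  proof (induction U rule: measure_induct_rule[where f = card])
    case (less U)
    have "Max (h ` U) \<in> h ` U" using less.prems by (intro Max_in) auto
    then obtain \<sigma> where \<sigma>: "\<sigma> \<in> U" "h \<sigma> = Max (h ` U)" by auto
    then have \<sigma>_max: "h \<sigma>' \<le> h \<sigma>" if "\<sigma>' \<in> U" for \<sigma>' using that less.prems(1) by simp
    have \<sigma>\<Phi>: "\<sigma> \<in> \<Phi>" using \<sigma> less.prems by blast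
    show ?case
    proof (cases "U = {\<sigma>}")
      case True
      have "coned_boundary p U (\<Phi> - U) = Pow (insert p \<sigma>) - {insert p \<sigma>}"
        unfolding True
      proof (rule coned_boundary_first[OF \<sigma>\<Phi> _ p(2)])
        show "h \<sigma> \<le> h \<sigma>'" if "\<sigma>' \<in> \<Phi>" for \<sigma>'
          using less.prems(4)[of \<sigma> \<sigma>'] that True by (cases "\<sigma>' = \<sigma>") auto
      qed
      moreover have "basis_complex (coned_boundary p U (\<Phi> - U))"
        using less.prems(2) \<Phi>(2) p(1) by (intro basis_complex_coned_boundary) auto
      moreover have "insert p \<sigma> \<subseteq> Basis" using \<sigma>\<Phi> \<Phi>(2) p(1) by blast
      ultimately have "pl_homeomorphic (realization (coned_boundary p U (\<Phi> - U)))
          (\<Union>(boundary_faces (convex hull (insert p \<sigma>))))"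
        using pl_homeomorphic_refl_basis[of "coned_boundary p U (\<Phi> - U)"]
        by (simp only: Union_boundary_faces_basis)
      then show ?thesis using \<sigma>\<Phi> by (rule bexI)
    next
      case False
      define W where "W = U - {\<sigma>}"
      have W: "W \<subseteq> \<Phi>" "W \<noteq> {}" "finite W" "card W < card U" "U = insert \<sigma> W" "\<sigma> \<notin> W"
        using less.prems(1-3) \<sigma>(1) False card_Diff1_less[of U \<sigma>] unfolding W_def by blast+
      have V: "\<Phi> - U = (\<Phi> - W) - {\<sigma>}" "\<sigma> \<in> \<Phi> - W" using W(5,6) \<sigma>\<Phi> by auto
      have Wle: "h a \<le> h b" if "a \<in> W" "b \<in> \<Phi> - W" for a b
        using that \<sigma>_max[of a] less.prems(4)[of a b] W(5) by (cases "b = \<sigma>") auto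
      then obtain \<sigma>\<^sub>0 where \<sigma>\<^sub>0: "\<sigma>\<^sub>0 \<in> \<Phi>" and IH: "pl_homeomorphic (realization (coned_boundary p W (\<Phi> - W)))
          (\<Union>(boundary_faces (convex hull (insert p \<sigma>\<^sub>0))))"
        using less.IH[OF W(4) W(3) W(1) W(2)] by blast
      have ge: "h \<sigma> \<le> h b" if "b \<in> \<Phi> - W" for b
        using that \<sigma>(1) less.prems(4)[of \<sigma> b] W(5) by (cases "b = \<sigma>") auto
      have flip: "bistellar_flip (insert p (\<sigma> - R \<sigma>)) (R \<sigma>)
          (coned_boundary p W (\<Phi> - W)) (coned_boundary p U (\<Phi> - U))"
        unfolding V(1) unfolding W(5)
      proof (rule coned_boundary_step)
        show "W \<union> (\<Phi> - W) = \<Phi>" using W(1) by blast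
        show "h \<sigma>' \<le> h \<sigma>" if "\<sigma>' \<in> W" for \<sigma>' using Wle that V(2) by blast
      qed (use V(2) ge p(2) in auto)
      have R_ne: "R \<sigma> \<noteq> {}"
      proof
        assume "R \<sigma> = {}"
        moreover obtain \<sigma>' where "\<sigma>' \<in> W" using W(2) by blast
        moreover have "\<sigma>' \<in> \<Phi>" "\<sigma> \<noteq> \<sigma>'" using \<open>\<sigma>' \<in> W\<close> W(1,6) by blast+
        ultimately show False
          using min_unique[OF \<sigma>\<Phi>, of \<sigma>'] \<sigma>_max[of \<sigma>'] W(5) by simp
      qed
      have "R \<sigma> \<subseteq> Basis" "insert p (\<sigma> - R \<sigma>) \<subseteq> Basis" "R \<sigma> \<inter> insert p (\<sigma> - R \<sigma>) = {}"
        using R_subset[OF \<sigma>\<Phi>] \<sigma>\<Phi> \<Phi>(2) p by auto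
      moreover have "basis_complex (coned_boundary p U (\<Phi> - U))" "basis_complex (coned_boundary p W (\<Phi> - W))"
        using W(1) less.prems(2) \<Phi>(2) p(1) by (simp_all add: basis_complex_coned_boundary)
      ultimately have "pl_homeomorphic (realization (coned_boundary p U (\<Phi> - U)))
          (realization (coned_boundary p W (\<Phi> - W)))"
        using R_ne by (intro pl_homeomorphic_bistellar_flip[OF _ _ bistellar_flip_sym[OF flip]]) simp_all
      then show ?thesis using IH \<sigma>\<^sub>0 pl_homeomorphic_trans by blast
    qed
  qed
  from this[of \<Phi>] have "?goal \<Phi>" using \<Phi>(1) by simp
  moreover have "coned_boundary p \<Phi> (\<Phi> - \<Phi>) = faces \<Phi>"
    by (simp add: coned_boundary_def faces_def)
  ultimately show ?thesis by simp
qed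

section \<open>Comparing power sums through sign changes\<close>

definition psum :: "nat \<Rightarrow> nat \<Rightarrow> (nat \<Rightarrow> real) \<Rightarrow> real" where
  "psum n k x = (\<Sum>j<n. x j ^ k)"

lemma poly_antiderivative:
  fixes q :: "real poly"
  obtains p where "pderiv p = q" "degree p \<le> Suc (degree q)"
    "coeff p (Suc (degree q)) = lead_coeff q / (degree q + 1)"
proof
  define p where "p = pCons 0 (Abs_poly (\<lambda>i. coeff q i / (real i + 1)))"
  have c: "coeff (Abs_poly (\<lambda>i. coeff q i / (real i + 1))) = (\<lambda>i. coeff q i / (real i + 1))"
    by (rule Abs_poly_inverse) (auto simp: eventually_cofinite MOST_coeff_eq_0[unfolded eventually_cofinite] 
         intro: finite_subset[OF _ MOST_coeff_eq_0[of q, unfolded eventually_cofinite]])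
  then have coeff_p: "coeff p (Suc i) = coeff q i / (real i + 1)" for i by (simp add: p_def)
  show "pderiv p = q" by (rule poly_eqI) (simp add: coeff_pderiv coeff_p field_simps)
  show "degree p \<le> Suc (degree q)"
  proof (rule degree_le, intro allI impI)
    fix i assume "i > Suc (degree q)"
    then obtain j where "i = Suc j" "j > degree q" by (metis Suc_lessE)
    then show "coeff p i = 0" by (simp add: coeff_p coeff_eq_0)
  qed
  show "coeff p (Suc (degree q)) = lead_coeff q / (degree q + 1)" by (simp add: coeff_p)
qed

lemma poly_strict_increase:
  fixes p :: "real poly"
  assumes "a < b" and pos: "\<And>t. a \<le> t \<Longrightarrow> t \<le> b \<Longrightarrow> 0 \<le> poly (pderiv p) t" and "pderiv p \<noteq> 0"
  shows "poly p a < poly p b"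
proof (rule ccontr)
  have mono: "poly p c \<le> poly p d" if "a \<le> c" "c \<le> d" "d \<le> b" for c d
  proof (rule DERIV_nonneg_imp_nondecreasing[OF that(2)])
    fix t assume "c \<le> t" "t \<le> d"
    then have "0 \<le> poly (pderiv p) t" using that pos[of t] by simp
    then show "\<exists>y. DERIV (poly p) t :> y \<and> 0 \<le> y" using poly_DERIV by blast
  qed
  assume "\<not> poly p a < poly p b"
  then have "poly p b \<le> poly p a" by simp
  then have "poly p t = poly p a" if "a \<le> t" "t \<le> b" for t
    using mono[OF order_refl that] mono[OF that order_refl] by linarith
  then obtain c where c: "\<And>t. a \<le> t \<Longrightarrow> t \<le> b \<Longrightarrow> poly p t = c" by blast
  then have "{a..b} \<subseteq> {t. poly (p - [:c:]) t = 0}" by auto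
  then have "infinite {t. poly (p - [:c:]) t = 0}"
    using infinite_Icc[OF \<open>a < b\<close>] finite_subset by blast
  then have "p - [:c:] = 0" using poly_roots_finite by blast
  then have "pderiv (p - [:c:]) = 0" by (simp only: pderiv_0)
  then show False using assms(3) by (simp add: pderiv_diff pderiv_pCons)
qed

lemma sum_poly_eq_psum:
  assumes "degree p \<le> d"
  shows "(\<Sum>j<n. poly p (x j)) = (\<Sum>i\<le>d. coeff p i * psum n i x)"
proof -
  have "(\<Sum>j<n. poly p (x j)) = (\<Sum>j<n. \<Sum>i\<le>d. coeff p i * x j ^ i)"
  proof (rule sum.cong[OF refl])
    fix j
    show "poly p (x j) = (\<Sum>i\<le>d. coeff p i * x j ^ i)"
      unfolding poly_altdef using assms by (intro sum.mono_neutral_left) (auto simp: coeff_eq_0)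
  qed
  also have "\<dots> = (\<Sum>i\<le>d. \<Sum>j<n. coeff p i * x j ^ i)" by (rule sum.swap)
  finally show ?thesis by (simp add: psum_def sum_distrib_left)
qed

abbreviation sgn_of :: "bool \<Rightarrow> real" where "sgn_of e \<equiv> (if e then 1 else - 1)"

abbreviation root_prod :: "real list \<Rightarrow> real \<Rightarrow> real" where
  "root_prod Z t \<equiv> (\<Prod>z\<leftarrow>Z. t - z)"

lemma root_prod_nonneg: "(\<And>z. z \<in> set Z \<Longrightarrow> z \<le> t) \<Longrightarrow> 0 \<le> root_prod Z t"
  by (induction Z) auto

text \<open>Let the entries of \<open>x\<close> form blocks of equal values, numbered from 1, such that
  an upward sign change of \<open>x' - x\<close> inside block \<open>b\<close> is possible
  only if \<open>even b = par\<close>. The value bounds the number of sign changes up to the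
  end of block \<open>b\<close> when the last sign is positive (\<open>e\<close>) or
  negative (\<open>\<not> e\<close>). At \<open>b = 0\<close> one of the two values is
  \<open>- 1\<close>, which marks the sign that one must not start with; hence integers are
  used.\<close>

definition change_bound :: "bool \<Rightarrow> nat \<Rightarrow> bool \<Rightarrow> int" where
  "change_bound par b e = int b - (if e = (even b = par) then 0 else 1)"

lemma card_image_lessThan_Suc:
  fixes x :: "nat \<Rightarrow> real"
  assumes mono: "\<And>i j. i \<le> j \<Longrightarrow> j < n \<Longrightarrow> x i \<le> x j" and "m < n"
  shows "card (x ` {..<Suc m}) = (if 0 < m \<and> x (m - 1) = x m then card (x ` {..<m}) else Suc (card (x ` {..<m})))"
proof -
  have "x m \<in> x ` {..<m} \<longleftrightarrow> 0 < m \<and> x (m - 1) = x m"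
  proof
    assume "x m \<in> x ` {..<m}"
    then obtain i where i: "i < m" "x i = x m" by auto
    then have "x i \<le> x (m - 1)" "x (m - 1) \<le> x m" using mono[of i "m - 1"] mono[of "m - 1" m] \<open>m < n\<close> by auto
    then show "0 < m \<and> x (m - 1) = x m" using i by auto
  next
    assume "0 < m \<and> x (m - 1) = x m"
    then show "x m \<in> x ` {..<m}" by (intro image_eqI[of _ _ "m - 1"]) auto
  qed
  then show ?thesis by (auto simp: lessThan_Suc card_insert_if)
qed

text \<open>At each sign change of \<open>x' - x\<close> there is a point \<open>z\<close> to the right
  of all earlier and to the left of all later intervals between \<open>x j\<close> and
  \<open>x' j\<close>. The product of the factors \<open>t - z\<close> has on every one of
  these intervals the sign of the difference, up to the sign of the last one. Within a block
  \<open>x\<close> is constant and \<open>x'\<close> increases, so only upward changes can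
  occur there; this makes the count of \<open>change_bound\<close> work.\<close>

lemma sign_changes_bounded:
  fixes x x' :: "nat \<Rightarrow> real"
  assumes mono: "\<And>i j. i \<le> j \<Longrightarrow> j < n \<Longrightarrow> x i \<le> x j"
    and mono': "\<And>i j. i \<le> j \<Longrightarrow> j < n \<Longrightarrow> x' i \<le> x' j"
    and rigid: "\<And>i. 0 < i \<Longrightarrow> i < n \<Longrightarrow> x (i - 1) = x i \<Longrightarrow> even (card (x ` {..<i})) \<noteq> par
        \<Longrightarrow> x i < x' i \<Longrightarrow> x (i - 1) < x' (i - 1)"
  obtains Z e where "int (length Z) \<le> change_bound par (card (x ` {..<n})) e"
    "\<And>j t. j < n \<Longrightarrow> min (x j) (x' j) \<le> t \<Longrightarrow> t \<le> max (x j) (x' j)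
        \<Longrightarrow> 0 \<le> sgn_of e * (x' j - x j) * root_prod Z t"
proof -
  let ?b = "\<lambda>m. card (x ` {..<m})"
  let ?seg = "\<lambda>j t. min (x j) (x' j) \<le> t \<and> t \<le> max (x j) (x' j)"
  have "\<exists>Z e. int (length Z) \<le> change_bound par (?b m) e
     \<and> (\<forall>j<m. \<forall>t. ?seg j t \<longrightarrow> 0 \<le> sgn_of e * (x' j - x j) * root_prod Z t)
     \<and> (\<forall>j. m \<le> j \<and> j < n \<longrightarrow> (\<forall>z\<in>set Z. z \<le> x j \<and> z \<le> x' j))
     \<and> (\<forall>i j. i < m \<and> m \<le> j \<and> j < n \<longrightarrow> max (x i) (x' i) \<le> (if e then x' j else x j))
     \<and> (0 < m \<longrightarrow> (if e then x (m - 1) \<le> x' (m - 1) else x' (m - 1) \<le> x (m - 1)))"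
    if "m \<le> n" for m
    using that
  proof (induction m)
    case 0
    show ?case by (rule exI[of _ "[]"], rule exI[of _ "even 0 = par"]) (simp add: change_bound_def)
  next
    case (Suc m)
    then have mn: "m < n" by simp
    from Suc obtain Z e where len: "int (length Z) \<le> change_bound par (?b m) e"
      and sgn: "\<And>j t. j < m \<Longrightarrow> ?seg j t \<Longrightarrow> 0 \<le> sgn_of e * (x' j - x j) * root_prod Z t"
      and Z: "\<And>j z. m \<le> j \<Longrightarrow> j < n \<Longrightarrow> z \<in> set Z \<Longrightarrow> z \<le> x j \<and> z \<le> x' j"
      and sep: "\<And>i j. i < m \<Longrightarrow> m \<le> j \<Longrightarrow> j < n \<Longrightarrow> max (x i) (x' i) \<le> (if e then x' j else x j)"
      and last: "0 < m \<Longrightarrow> (if e then x (m - 1) \<le> x' (m - 1) else x' (m - 1) \<le> x (m - 1))"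
      by auto
    note b = card_image_lessThan_Suc[of n x m, OF mono mn]
    have b': "?b (Suc m) = ?b m \<or> ?b (Suc m) = Suc (?b m)" using b by auto
    have pos: "0 \<le> root_prod Z t" if "?seg m t" for t
      by (rule root_prod_nonneg) (use Z[OF order_refl mn] that in \<open>fastforce simp: min_def split: if_splits\<close>)
    show ?case
    proof (cases "if e then x m \<le> x' m else x' m \<le> x m")
      case True
      show ?thesis
      proof (rule exI[of _ Z], rule exI[of _ e], intro conjI allI impI)
        show "int (length Z) \<le> change_bound par (?b (Suc m)) e"
          using len b' by (auto simp: change_bound_def split: if_splits)
        show "0 \<le> sgn_of e * (x' j - x j) * root_prod Z t" if "j < Suc m" "?seg j t" for j t
          using that sgn[of j t] pos[of t] True by (cases "j = m") auto
        show "\<forall>z\<in>set Z. z \<le> x j \<and> z \<le> x' j" if "Suc m \<le> j \<and> j < n" for j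
          using Z[of j] that by auto
        show "max (x i) (x' i) \<le> (if e then x' j else x j)" if "i < Suc m \<and> Suc m \<le> j \<and> j < n" for i j
          using that sep[of i j] True mono[of m j] mono'[of m j] by (cases "i = m") (auto split: if_splits)
        show "if e then x (Suc m - 1) \<le> x' (Suc m - 1) else x' (Suc m - 1) \<le> x (Suc m - 1)"
          using True by simp
      qed
    next
      case False
      \<comment> \<open>A sign change occurs at position \<open>m\<close>; the left end of
        its interval separates it from the earlier ones.\<close>
      define z where "z = min (x m) (x' m)"
      have z: "z = (if e then x' m else x m)" using False by (auto simp: z_def)
      show ?thesis
      proof (rule exI[of _ "z # Z"], rule exI[of _ "\<not> e"], intro conjI allI impI)
        have "change_bound par (?b m) e + 1 \<le> change_bound par (?b (Suc m)) (\<not> e)"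
        proof (cases "0 < m \<and> x (m - 1) = x m")
          case True
          have "m - 1 < n" "x' (m - 1) \<le> x' m" using mn mono'[of "m - 1" m] by auto
          then have "\<not> e" using False True last by auto
          moreover have "even (?b m) = par"
          proof (rule ccontr)
            assume "even (?b m) \<noteq> par"
            moreover have "x m < x' m" "x' (m - 1) \<le> x (m - 1)" using False last True \<open>\<not> e\<close> by auto
            ultimately show False using rigid[of m] True mn by auto
          qed
          moreover have "?b (Suc m) = ?b m" using True b by simp
          ultimately show ?thesis by (simp add: change_bound_def)
        next
          case False
          then have "?b (Suc m) = Suc (?b m)" using b by auto
          then show ?thesis by (auto simp: change_bound_def)
        qed
        then show "int (length (z # Z)) \<le> change_bound par (?b (Suc m)) (\<not> e)" using len by simp
        show "0 \<le> sgn_of (\<not> e) * (x' j - x j) * root_prod (z # Z) t" if "j < Suc m" "?seg j t" for j t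
        proof (cases "j = m")
          case True
          then show ?thesis using pos[of t] that(2) False by (auto simp: z_def split: if_splits)
        next
          case jm: False
          then have "max (x j) (x' j) \<le> z" using sep[of j m] that(1) mn z by auto
          then have "t \<le> z" using that(2) by linarith
          moreover have "0 \<le> sgn_of e * (x' j - x j) * root_prod Z t" using sgn[of j t] jm that by auto
          ultimately have "0 \<le> (sgn_of e * (x' j - x j) * root_prod Z t) * (z - t)" by simp
          also have "\<dots> = sgn_of (\<not> e) * (x' j - x j) * root_prod (z # Z) t"
            by (simp add: algebra_simps)
          finally show ?thesis .
        qed
        show "\<forall>w\<in>set (z # Z). w \<le> x j \<and> w \<le> x' j" if "Suc m \<le> j \<and> j < n" for j
          using Z[of j] that mono[of m j] mono'[of m j] by (auto simp: z_def)
        show "max (x i) (x' i) \<le> (if \<not> e then x' j else x j)" if "i < Suc m \<and> Suc m \<le> j \<and> j < n" for i j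
        proof (cases "i = m")
          case True
          then show ?thesis using that False mono[of m j] mono'[of m j] by (auto split: if_splits)
        next
          case im: False
          then have "max (x i) (x' i) \<le> z" using sep[of i m] that mn z by auto
          then show ?thesis using that mono[of m j] mono'[of m j] by (auto simp: z_def)
        qed
        show "if \<not> e then x (Suc m - 1) \<le> x' (Suc m - 1) else x' (Suc m - 1) \<le> x (Suc m - 1)"
          using False by auto
      qed
    qed
  qed
  from this[of n] show ?thesis using that by (metis order_refl)
qed

text \<open>Let \<open>p\<close> be an antiderivative of the product of the factors \<open>t -
  z\<close>. All differences \<open>p (x' j) - p (x j)\<close> have the same sign, so their
  sum is not zero. If there were fewer than \<open>s\<close> factors, the sum would be a
  combination of the power sums up to \<open>s\<close> and vanish. So there are exactly
  \<open>s\<close> factors, which determines the last sign, and the sum is a positive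
  multiple of the difference of the power sums with exponent \<open>s + 1\<close>.\<close>

proposition psum_compare_vertex:
  fixes x x' :: "nat \<Rightarrow> real"
  assumes mono: "\<And>i j. i \<le> j \<Longrightarrow> j < n \<Longrightarrow> x i \<le> x j"
    and mono': "\<And>i j. i \<le> j \<Longrightarrow> j < n \<Longrightarrow> x' i \<le> x' j"
    and rigid: "\<And>i. 0 < i \<Longrightarrow> i < n \<Longrightarrow> x (i - 1) = x i \<Longrightarrow> even (card (x ` {..<i})) \<noteq> par
        \<Longrightarrow> x i < x' i \<Longrightarrow> x (i - 1) < x' (i - 1)"
    and s: "s = card (x ` {..<n})"
    and eq: "\<And>k. 1 \<le> k \<Longrightarrow> k \<le> s \<Longrightarrow> psum n k x = psum n k x'"
    and neq: "j\<^sub>0 < n" "x j\<^sub>0 \<noteq> x' j\<^sub>0"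
  shows "if even s = par then psum n (Suc s) x < psum n (Suc s) x' else psum n (Suc s) x' < psum n (Suc s) x"
proof -
  obtain Z e where len: "int (length Z) \<le> change_bound par s e"
    and sgn: "\<And>j t. j < n \<Longrightarrow> min (x j) (x' j) \<le> t \<Longrightarrow> t \<le> max (x j) (x' j)
        \<Longrightarrow> 0 \<le> sgn_of e * (x' j - x j) * root_prod Z t"
    using sign_changes_bounded[of n x x' par] mono mono' rigid s by blast
  define q where "q = (\<Prod>z\<leftarrow>Z. [:- z, 1:])"
  have q: "poly q t = root_prod Z t" for t
    unfolding q_def by (induction Z) (auto simp: algebra_simps)
  have q0: "q \<noteq> 0" and dq: "degree q = length Z" and lq: "lead_coeff q = 1"
  proof -
    show lq: "lead_coeff q = 1" unfolding q_def by (induction Z) (auto simp: lead_coeff_mult simp del: mult_pCons_left)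
    then show "q \<noteq> 0" by auto
    show "degree q = length Z" unfolding q_def
    proof (induction Z)
      case (Cons z Z)
      moreover have "lead_coeff (\<Prod>z\<leftarrow>Z. [:- z, 1:]) = 1"
        by (induction Z) (auto simp: lead_coeff_mult simp del: mult_pCons_left)
      then have "(\<Prod>z\<leftarrow>Z. [:- z, 1:]) \<noteq> 0" by auto
      ultimately show ?case by (simp add: degree_mult_eq del: mult_pCons_left)
    qed simp
  qed
  obtain p where p: "pderiv p = q" "degree p \<le> Suc (length Z)" "coeff p (Suc (length Z)) = 1 / (length Z + 1)"
    using poly_antiderivative[of q] dq lq by metis
  define c where "c = sgn_of e"
  have sgn': "0 \<le> (x' j - x j) * (c * root_prod Z t)"
    if "j < n" "min (x j) (x' j) \<le> t" "t \<le> max (x j) (x' j)" for j t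
    using sgn[OF that] unfolding c_def by (simp only: mult_ac)
  have "c \<noteq> 0" by (simp add: c_def)
  have dp: "poly (pderiv (smult a p)) t = a * root_prod Z t" for a t
    by (simp add: pderiv_smult p(1) q)
  have diff: "0 \<le> c * (poly p (x' j) - poly p (x j)) \<and>
      (x j \<noteq> x' j \<longrightarrow> 0 < c * (poly p (x' j) - poly p (x j)))" if j: "j < n" for j
  proof -
    consider "x j = x' j" | "x j < x' j" | "x' j < x j" by linarith
    then show ?thesis
    proof cases
      case 2
      have "poly (smult c p) (x j) < poly (smult c p) (x' j)"
      proof (rule poly_strict_increase[OF 2])
        fix t assume "x j \<le> t" "t \<le> x' j"
        then show "0 \<le> poly (pderiv (smult c p)) t"
          unfolding dp using sgn'[OF j, of t] 2 by (simp add: zero_le_mult_iff[of "x' j - x j"])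
      qed (use q0 p(1) \<open>c \<noteq> 0\<close> in \<open>simp add: pderiv_smult\<close>)
      then show ?thesis by (simp add: algebra_simps)
    next
      case 3
      have "poly (smult (- c) p) (x' j) < poly (smult (- c) p) (x j)"
      proof (rule poly_strict_increase[OF 3])
        fix t assume "x' j \<le> t" "t \<le> x j"
        then show "0 \<le> poly (pderiv (smult (- c) p)) t"
          unfolding dp using sgn'[OF j, of t] 3 by (simp add: zero_le_mult_iff[of "x' j - x j"])
      qed (use q0 p(1) \<open>c \<noteq> 0\<close> in \<open>simp add: pderiv_smult pderiv_minus\<close>)
      then show ?thesis by (simp add: algebra_simps)
    qed simp
  qed
  have "0 < (\<Sum>j<n. c * (poly p (x' j) - poly p (x j)))"
    by (rule sum_pos2[of _ j\<^sub>0]) (use diff neq in auto)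
  also have "\<dots> = c * ((\<Sum>j<n. poly p (x' j)) - (\<Sum>j<n. poly p (x j)))"
    by (simp only: sum_distrib_left[symmetric] sum_subtractf)
  also have "\<dots> = c * (\<Sum>i\<le>Suc (length Z). coeff p i * (psum n i x' - psum n i x))"
    unfolding sum_poly_eq_psum[OF p(2)] by (simp add: sum_subtractf algebra_simps)
  finally have pos: "0 < c * (\<Sum>i\<le>Suc (length Z). coeff p i * (psum n i x' - psum n i x))" .
  have eq0: "psum n i x' - psum n i x = 0" if "i \<le> s" for i
    using eq[of i] that by (cases "i = 0") (auto simp: psum_def)
  have "length Z = s" "e = (even s = par)"
  proof -
    have "\<not> Suc (length Z) \<le> s"
    proof
      assume "Suc (length Z) \<le> s"
      then have "(\<Sum>i\<le>Suc (length Z). coeff p i * (psum n i x' - psum n i x)) = 0"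
        by (intro sum.neutral) (auto simp: eq0)
      then show False using pos by simp
    qed
    then show "length Z = s" "e = (even s = par)"
      using len by (auto simp: change_bound_def split: if_splits)
  qed
  then have "(\<Sum>i\<le>Suc (length Z). coeff p i * (psum n i x' - psum n i x)) =
      1 / (s + 1) * (psum n (Suc s) x' - psum n (Suc s) x)"
    using p(3) by (simp add: eq0)
  then have "0 < c * (psum n (Suc s) x' - psum n (Suc s) x)"
    using pos by (simp add: zero_less_mult_iff zero_less_divide_iff)
  then show ?thesis using \<open>e = (even s = par)\<close> unfolding c_def by (auto split: if_splits)
qed

section \<open>Power sums are locally onto\<close>

text \<open>A Vandermonde argument: test the moments against the polynomial that vanishes on
  \<open>Y\<close> except at \<open>z\<close>.\<close>

lemma power_moments_zero:
  fixes w :: "real \<Rightarrow> real"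
  assumes Y: "finite Y" and mom: "\<And>i. i < card Y \<Longrightarrow> (\<Sum>y\<in>Y. w y * y ^ i) = 0" and "z \<in> Y"
  shows "w z = 0"
proof -
  define q where "q = (\<Prod>y\<in>Y - {z}. [:- y, 1:])"
  have "degree q \<le> (\<Sum>y\<in>Y - {z}. degree [:- y, 1:])" 
    unfolding q_def using degree_prod_sum_le[of "Y - {z}" "\<lambda>y. [:- y, 1:]"] Y by (simp add: o_def)
  also have "\<dots> = card Y - 1" using Y \<open>z \<in> Y\<close> by simp
  finally have d: "degree q < card Y" using Y \<open>z \<in> Y\<close> card_gt_0_iff[of Y] by fastforce
  have "(\<Sum>y\<in>Y. w y * poly q y) = (\<Sum>y\<in>Y. \<Sum>i\<le>degree q. coeff q i * (w y * y ^ i))"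
    by (simp add: poly_altdef sum_distrib_left mult_ac)
  also have "\<dots> = (\<Sum>i\<le>degree q. coeff q i * (\<Sum>y\<in>Y. w y * y ^ i))"
    unfolding sum_distrib_left by (rule sum.swap)
  also have "\<dots> = 0" using mom d by (intro sum.neutral) auto
  finally have "(\<Sum>y\<in>Y. w y * poly q y) = 0" .
  moreover have "(\<Sum>y\<in>Y. w y * poly q y) = w z * poly q z + (\<Sum>y\<in>Y - {z}. w y * poly q y)"
    using Y \<open>z \<in> Y\<close> by (rule sum.remove)
  moreover have "(\<Sum>y\<in>Y - {z}. w y * poly q y) = 0"
    by (rule sum.neutral) (use Y in \<open>auto simp: q_def poly_prod\<close>)
  moreover have "poly q z \<noteq> 0" using Y by (simp add: q_def poly_prod)
  ultimately show ?thesis by simp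
qed

text \<open>The Jacobian of the weighted power sums is a Vandermonde matrix with columns scaled by
  nonzero factors, hence invertible, and a map with surjective derivative is locally onto.\<close>

proposition power_sums_locally_onto:
  fixes m :: "real \<Rightarrow> real"
  assumes Y: "finite Y" "card Y \<le> DIM('v::euclidean_space)" and m: "\<And>y. y \<in> Y \<Longrightarrow> m y \<noteq> 0" and "0 < \<delta>"
  shows "\<exists>\<eta>>0. \<forall>c. (\<forall>i. 1 \<le> i \<and> i \<le> card Y \<longrightarrow> \<bar>c i\<bar> < \<eta>) \<longrightarrow>
      (\<exists>\<phi>. (\<forall>y\<in>Y. \<bar>\<phi> y - y\<bar> < \<delta>) \<and>
        (\<forall>i. 1 \<le> i \<and> i \<le> card Y \<longrightarrow> (\<Sum>y\<in>Y. m y * \<phi> y ^ i) = (\<Sum>y\<in>Y. m y * y ^ i) + c i))"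
proof -
  let ?k = "card Y"
  obtain B where B: "B \<subseteq> (Basis :: 'v set)" "card B = ?k" "finite B"
    using obtain_subset_with_card_n[OF Y(2)] by metis
  obtain e where e: "bij_betw e Y B" using finite_same_card_bij[of Y B] Y(1) B by auto
  obtain \<iota> where \<iota>: "bij_betw \<iota> B {1..?k}" using finite_same_card_bij[of B "{1..?k}"] B by auto
  have eB: "e y \<in> Basis" "e y \<in> B" if "y \<in> Y" for y using e that B(1) by (auto dest: bij_betwE)
  \<comment> \<open>The variables sit in the coordinates of \<open>B\<close>. The remaining
    coordinates are mapped identically, so that source and target are the same space.\<close>
  define f :: "'v \<Rightarrow> 'v" where
    "f v = (\<Sum>b\<in>Basis. (if b \<in> B then (\<Sum>y\<in>Y. m y * (v \<bullet> e y) ^ \<iota> b) else v \<bullet> b) *\<^sub>R b)" for v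
  define x\<^sub>0 :: 'v where "x\<^sub>0 = (\<Sum>b\<in>Basis. (if b \<in> B then inv_into Y e b else 0) *\<^sub>R b)"
  define f' :: "'v \<Rightarrow> 'v" where
    "f' v = (\<Sum>b\<in>Basis. (if b \<in> B then (\<Sum>y\<in>Y. m y * (real (\<iota> b) * (v \<bullet> e y) * y ^ (\<iota> b - 1))) else v \<bullet> b) *\<^sub>R b)" for v
  have f: "f v \<bullet> b = (if b \<in> B then (\<Sum>y\<in>Y. m y * (v \<bullet> e y) ^ \<iota> b) else v \<bullet> b)" if "b \<in> Basis" for v b
    unfolding f_def using that by simp
  have f': "f' v \<bullet> b = (if b \<in> B then (\<Sum>y\<in>Y. m y * (real (\<iota> b) * (v \<bullet> e y) * y ^ (\<iota> b - 1))) else v \<bullet> b)"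
    if "b \<in> Basis" for v b
    unfolding f'_def using that by simp
  have x\<^sub>0: "x\<^sub>0 \<bullet> e y = y" if "y \<in> Y" for y
    unfolding x\<^sub>0_def using eB[OF that] that e by (simp add: bij_betw_inv_into_left)
  have der: "(f has_derivative f') (at x\<^sub>0)"
    unfolding has_derivative_componentwise_within[of f f' x\<^sub>0 UNIV]
  proof
    fix b :: 'v assume b: "b \<in> Basis"
    show "((\<lambda>v. f v \<bullet> b) has_derivative (\<lambda>v. f' v \<bullet> b)) (at x\<^sub>0)"
    proof (cases "b \<in> B")
      case True
      have "((\<lambda>v. \<Sum>y\<in>Y. m y * (v \<bullet> e y) ^ \<iota> b) has_derivative
          (\<lambda>v. \<Sum>y\<in>Y. m y * (real (\<iota> b) * (v \<bullet> e y) * (x\<^sub>0 \<bullet> e y) ^ (\<iota> b - 1)))) (at x\<^sub>0)"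
        by (auto intro!: derivative_eq_intros)
      then show ?thesis using True b by (simp add: f f' x\<^sub>0)
    next
      case False
      have "((\<lambda>v. v \<bullet> b) has_derivative (\<lambda>v. v \<bullet> b)) (at x\<^sub>0)" by (auto intro!: derivative_eq_intros)
      then show ?thesis using False b by (simp add: f f')
    qed
  qed
  have lin: "linear f'" using der by (rule has_derivative_linear)
  have inj: "inj f'"
    unfolding linear_injective_0[OF lin]
  proof (intro allI impI)
    fix v assume v: "f' v = 0"
    have "m y * (v \<bullet> e y) = 0" if "y \<in> Y" for y
    proof (rule power_moments_zero[OF Y(1) _ that, of "\<lambda>y. m y * (v \<bullet> e y)"])
      fix i assume i: "i < ?k"
      have "Suc i \<in> \<iota> ` B" using \<iota> i by (simp add: bij_betw_def)
      then obtain b where b: "b \<in> B" "\<iota> b = Suc i" by auto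
      then have "b \<in> Basis" using B(1) by blast
      then have "(\<Sum>y\<in>Y. m y * (real (Suc i) * (v \<bullet> e y) * y ^ i)) = 0"
        using f'[of b v] v b by simp
      then have "real (Suc i) * (\<Sum>y\<in>Y. m y * (v \<bullet> e y) * y ^ i) = 0"
        by (simp add: sum_distrib_left mult_ac)
      then show "(\<Sum>y\<in>Y. m y * (v \<bullet> e y) * y ^ i) = 0" by (simp del: of_nat_Suc)
    qed
    then have Y0: "v \<bullet> e y = 0" if "y \<in> Y" for y using m that by auto
    show "v = 0"
    proof (rule euclidean_eqI)
      fix b :: 'v assume b: "b \<in> Basis"
      show "v \<bullet> b = 0 \<bullet> b"
      proof (cases "b \<in> B")
        case True
        then obtain y where "y \<in> Y" "b = e y" using e by (auto simp: bij_betw_def)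
        then show ?thesis using Y0 by simp
      next
        case False
        then show ?thesis using f'[OF b, of v] v by simp
      qed
    qed
  qed
  obtain g where g: "linear g" "\<And>v. f' (g v) = v"
    using linear_injective_isomorphism[OF lin inj] by blast
  define T where "T = (\<Inter>y\<in>Y. {v. \<bar>v \<bullet> e y - y\<bar> < \<delta>})"
  have T: "open T" unfolding T_def using Y(1)
    by (intro open_INT ballI open_Collect_less continuous_intros)
  have "x\<^sub>0 \<in> T" unfolding T_def using x\<^sub>0 \<open>0 < \<delta>\<close> by simp
  then have "x\<^sub>0 \<in> interior T" by (simp add: interior_open[OF T])
  moreover have "continuous_on UNIV (\<lambda>v. if b \<in> B then (\<Sum>y\<in>Y. m y * (v \<bullet> e y) ^ \<iota> b) else v \<bullet> b)" for b
    by (cases "b \<in> B") (auto intro!: continuous_intros)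
  then have "continuous_on UNIV f" unfolding f_def
    by (intro continuous_on_sum continuous_on_scaleR continuous_on_const)
  moreover have "f' \<circ> g = id" using g(2) by auto
  ultimately have "f x\<^sub>0 \<in> interior (f ` T)"
    using sussmann_open_mapping[OF open_UNIV _ _ der, of g T] g(1) by (simp add: linear_conv_bounded_linear)
  then obtain r where r: "0 < r" "ball (f x\<^sub>0) r \<subseteq> f ` T" unfolding mem_interior by blast
  show ?thesis
  proof (rule exI[of _ "r / (real ?k + 1)"], intro conjI allI impI)
    show "0 < r / (real ?k + 1)" using r(1) by simp
    fix c :: "nat \<Rightarrow> real" assume c: "\<forall>i. 1 \<le> i \<and> i \<le> ?k \<longrightarrow> \<bar>c i\<bar> < r / (real ?k + 1)"
    define d where "d = (\<Sum>b\<in>B. c (\<iota> b) *\<^sub>R b)"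
    have "norm d \<le> (\<Sum>b\<in>B. norm (c (\<iota> b) *\<^sub>R b))" unfolding d_def by (rule norm_sum)
    also have "\<dots> = (\<Sum>b\<in>B. \<bar>c (\<iota> b)\<bar>)" using B(1) by (intro sum.cong) auto
    also have "\<dots> \<le> (\<Sum>b\<in>B. r / (real ?k + 1))"
    proof (rule sum_mono)
      fix b assume "b \<in> B"
      then have "\<iota> b \<in> {1..?k}" using \<iota> by (auto dest: bij_betwE)
      then show "\<bar>c (\<iota> b)\<bar> \<le> r / (real ?k + 1)" using c[rule_format, of "\<iota> b"] by simp
    qed
    also have "\<dots> = real ?k * r / (real ?k + 1)" using B(2) by simp
    also have "\<dots> < r" using r(1) by (simp add: divide_simps algebra_simps)
    finally have "f x\<^sub>0 + d \<in> ball (f x\<^sub>0) r" by (simp add: dist_norm)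
    then obtain v where v: "v \<in> T" "f v = f x\<^sub>0 + d" using r(2) by (metis imageE subsetD)
    show "\<exists>\<phi>. (\<forall>y\<in>Y. \<bar>\<phi> y - y\<bar> < \<delta>) \<and>
        (\<forall>i. 1 \<le> i \<and> i \<le> card Y \<longrightarrow> (\<Sum>y\<in>Y. m y * \<phi> y ^ i) = (\<Sum>y\<in>Y. m y * y ^ i) + c i)"
    proof (rule exI[of _ "\<lambda>y. v \<bullet> e y"], intro conjI ballI allI impI)
      show "\<bar>v \<bullet> e y - y\<bar> < \<delta>" if "y \<in> Y" for y using v(1) that by (auto simp: T_def)
      fix i assume i: "1 \<le> i \<and> i \<le> ?k"
      then have "i \<in> \<iota> ` B" using \<iota> by (simp add: bij_betw_def)
      then obtain b where b: "b \<in> B" "\<iota> b = i" by auto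
      then have bB: "b \<in> Basis" using B(1) by blast
      have "d \<bullet> b = (\<Sum>a\<in>B. if a = b then c (\<iota> a) else 0)"
        unfolding d_def inner_sum_left using B(1) bB by (intro sum.cong) (auto simp: inner_Basis)
      then have "d \<bullet> b = c i" using b B(3) by (simp add: sum.delta)
      then show "(\<Sum>y\<in>Y. m y * (v \<bullet> e y) ^ i) = (\<Sum>y\<in>Y. m y * y ^ i) + c i"
        using arg_cong[OF v(2), of "\<lambda>w. w \<bullet> b"] b bB by (simp add: inner_add_left f x\<^sub>0)
    qed
  qed
qed

section \<open>Slices in root coordinates\<close>

definition sorted_on :: "nat \<Rightarrow> (nat \<Rightarrow> real) \<Rightarrow> bool" where
  "sorted_on n x \<longleftrightarrow> (\<forall>i j. i \<le> j \<longrightarrow> j < n \<longrightarrow> x i \<le> x j)"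

text \<open>Entries from \<open>n\<close> on are set to 0, so that equality of vectors is equality of
  root lists.\<close>

definition vslice :: "nat \<Rightarrow> nat \<Rightarrow> (nat \<Rightarrow> real) \<Rightarrow> (nat \<Rightarrow> real) set" where
  "vslice n s c = {x. sorted_on n x \<and> (\<forall>i\<ge>n. x i = 0) \<and> (\<forall>k. 1 \<le> k \<longrightarrow> k \<le> s \<longrightarrow> psum n k x = c k)}"

definition walls :: "nat \<Rightarrow> (nat \<Rightarrow> real) \<Rightarrow> nat set" where
  "walls n x = {i. 0 < i \<and> i < n \<and> x (i - 1) = x i}"

lemma sorted_onD: "sorted_on n x \<Longrightarrow> i \<le> j \<Longrightarrow> j < n \<Longrightarrow> x i \<le> x j"
  unfolding sorted_on_def by blast

lemma finite_walls [simp]: "finite (walls n x)"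
  unfolding walls_def by (rule finite_subset[of _ "{..<n}"]) auto

lemma card_values_add_walls:
  assumes "sorted_on n x" "0 < n"
  shows "card (x ` {..<n}) + card (walls n x) = n"
proof -
  have "card (x ` {..<m}) + card {i. 0 < i \<and> i < m \<and> x (i - 1) = x i} = m" if "m \<le> n" for m
    using that
  proof (induction m)
    case (Suc m)
    let ?w = "\<lambda>m. {i. 0 < i \<and> i < m \<and> x (i - 1) = x i}"
    have "?w (Suc m) = (if 0 < m \<and> x (m - 1) = x m then insert m (?w m) else ?w m)"
      by (auto simp: less_Suc_eq)
    moreover have "finite (?w m)" "m \<notin> ?w m" by auto
    ultimately show ?case
      using Suc card_image_lessThan_Suc[of n x m, OF sorted_onD[OF assms(1)]] by simp
  qed simp
  from this[of n] show ?thesis by (simp add: walls_def)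
qed

lemma initial_segment:
  fixes A :: "nat set"
  assumes "finite A" and down: "\<And>i j. i \<in> A \<Longrightarrow> j \<le> i \<Longrightarrow> j \<in> A"
  shows "A = {..<card A}"
proof (cases "A = {}")
  case True
  then show ?thesis by simp
next
  case False
  have "A = {..<Suc (Max A)}"
  proof (rule set_eqI)
    fix j
    show "j \<in> A \<longleftrightarrow> j \<in> {..<Suc (Max A)}"
      using Max_ge[OF \<open>finite A\<close>, of j] down[OF Max_in[OF \<open>finite A\<close> False], of j]
      by (meson lessThan_iff less_Suc_eq_le)
  qed
  then obtain M where M: "A = {..<M}" ..
  show ?thesis unfolding M by simp
qed

lemma values_gap:
  fixes V :: "real set"
  assumes "finite V"
  obtains \<delta> where "0 < \<delta>" "\<And>y z. y \<in> V \<Longrightarrow> z \<in> V \<Longrightarrow> y < z \<Longrightarrow> y + \<delta> \<le> z - \<delta>"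
proof -
  let ?D = "(\<lambda>(y, z). (z - y) / 2) ` {(y, z). y \<in> V \<and> z \<in> V \<and> y < z}"
  have "finite {(y, z). y \<in> V \<and> z \<in> V \<and> y < z}"
    by (rule finite_subset[of _ "V \<times> V"]) (use assms in auto)
  then have fin: "finite ?D" by (rule finite_imageI)
  show ?thesis
  proof (rule that[of "Min (insert 1 ?D)"])
    show "0 < Min (insert 1 ?D)" using fin by (subst Min_gr_iff) auto
    fix y z assume "y \<in> V" "z \<in> V" "y < z"
    then have "Min (insert 1 ?D) \<le> (z - y) / 2" using fin by (intro Min_le) auto
    then show "y + Min (insert 1 ?D) \<le> z - Min (insert 1 ?D)" by (simp add: field_simps)
  qed
qed

lemma psum_fibres:
  "psum n k y = (\<Sum>t\<in>x ` {..<n}. \<Sum>j\<in>{j. j < n \<and> x j = t}. y j ^ k)"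
  unfolding psum_def by (subst sum.image_gen[of "{..<n}" _ x]) (auto intro!: sum.cong)

text \<open>Moving \<open>k\<close> of the distinct values of \<open>x\<close> by less than half the
  smallest gap keeps the order and the walls and realises all small changes of the first
  \<open>k\<close> power sums.\<close>

lemma perturb_values:
  fixes x :: "nat \<Rightarrow> real"
  assumes x: "sorted_on n x" and k: "k \<le> card (x ` {..<n})" "k \<le> DIM('v::euclidean_space)"
  obtains \<eta> where "0 < \<eta>"
    "\<And>c. (\<And>i. 1 \<le> i \<Longrightarrow> i \<le> k \<Longrightarrow> \<bar>c i\<bar> < \<eta>) \<Longrightarrow>
      \<exists>y. sorted_on n y \<and> (\<forall>i\<ge>n. y i = 0) \<and> walls n x \<subseteq> walls n y \<and>
        (\<forall>i. 1 \<le> i \<longrightarrow> i \<le> k \<longrightarrow> psum n i y = psum n i x + c i)"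
proof -
  let ?V = "x ` {..<n}"
  obtain Y where Y: "Y \<subseteq> ?V" "card Y = k" "finite Y" using obtain_subset_with_card_n[OF k(1)] by metis
  define m where "m t = real (card {j. j < n \<and> x j = t})" for t
  have "m t \<noteq> 0" if "t \<in> Y" for t using that Y(1) by (auto simp: m_def)
  moreover obtain \<delta> where \<delta>: "0 < \<delta>" "\<And>y z. y \<in> ?V \<Longrightarrow> z \<in> ?V \<Longrightarrow> y < z \<Longrightarrow> y + \<delta> \<le> z - \<delta>"
    using values_gap[of ?V] by blast
  moreover have "card Y \<le> DIM('v)" using Y k by simp
  ultimately obtain \<eta> where \<eta>: "0 < \<eta>"
    "\<forall>c. (\<forall>i. 1 \<le> i \<and> i \<le> k \<longrightarrow> \<bar>c i\<bar> < \<eta>) \<longrightarrow>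
      (\<exists>\<phi>. (\<forall>y\<in>Y. \<bar>\<phi> y - y\<bar> < \<delta>) \<and>
        (\<forall>i. 1 \<le> i \<and> i \<le> k \<longrightarrow> (\<Sum>y\<in>Y. m y * \<phi> y ^ i) = (\<Sum>y\<in>Y. m y * y ^ i) + c i))"
    using power_sums_locally_onto[where Y = Y and m = m and \<delta> = \<delta> and 'v = 'v, OF Y(3)]
    unfolding Y(2) by blast
  show ?thesis
  proof (rule that[OF \<eta>(1)])
    fix c :: "nat \<Rightarrow> real" assume "\<And>i. 1 \<le> i \<Longrightarrow> i \<le> k \<Longrightarrow> \<bar>c i\<bar> < \<eta>"
    then obtain \<phi> where \<phi>: "\<forall>y\<in>Y. \<bar>\<phi> y - y\<bar> < \<delta>"
      "\<forall>i. 1 \<le> i \<and> i \<le> k \<longrightarrow> (\<Sum>y\<in>Y. m y * \<phi> y ^ i) = (\<Sum>y\<in>Y. m y * y ^ i) + c i"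
      using \<eta>(2)[rule_format, of c] by blast
    define \<psi> where "\<psi> t = (if t \<in> Y then \<phi> t else t)" for t
    define y where "y j = (if j < n then \<psi> (x j) else 0)" for j
    have \<psi>: "\<bar>\<psi> t - t\<bar> < \<delta>" for t using \<phi>(1) \<delta>(1) by (simp add: \<psi>_def)
    have "sorted_on n y"
      unfolding sorted_on_def
    proof (intro allI impI)
      fix i j assume ij: "i \<le> j" "j < n"
      then have "x i \<le> x j" using x sorted_onD by blast
      then consider "x i = x j" | "x i + \<delta> \<le> x j - \<delta>" using \<delta>(2)[of "x i" "x j"] ij by fastforce
      then show "y i \<le> y j"
      proof cases
        case 2
        then show ?thesis using \<psi>[of "x i"] \<psi>[of "x j"] ij by (simp add: y_def)
      qed (use ij in \<open>simp add: y_def\<close>)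
    qed
    moreover have "walls n x \<subseteq> walls n y" by (auto simp: walls_def y_def)
    moreover have "psum n i y = psum n i x + c i" if i: "1 \<le> i" "i \<le> k" for i
    proof -
      have "psum n i y = (\<Sum>t\<in>?V. m t * \<psi> t ^ i)"
        unfolding psum_fibres[of n i y x] m_def by (intro sum.cong) (auto simp: y_def)
      moreover have "psum n i x = (\<Sum>t\<in>?V. m t * t ^ i)"
        unfolding psum_fibres[of n i x x] m_def by (intro sum.cong) auto
      moreover have "(\<Sum>t\<in>?V. f t) = (\<Sum>t\<in>Y. f t) + (\<Sum>t\<in>?V - Y. f t)" for f :: "real \<Rightarrow> real"
        using sum.subset_diff[OF Y(1), of f] by (simp add: add.commute)
      moreover have "(\<Sum>t\<in>Y. m t * \<psi> t ^ i) = (\<Sum>t\<in>Y. m t * \<phi> t ^ i)" by (simp add: \<psi>_def)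
      moreover have "(\<Sum>t\<in>?V - Y. m t * \<psi> t ^ i) = (\<Sum>t\<in>?V - Y. m t * t ^ i)"
        by (intro sum.cong) (auto simp: \<psi>_def)
      ultimately show ?thesis using \<phi>(2) i by simp
    qed
    ultimately show "\<exists>y. sorted_on n y \<and> (\<forall>i\<ge>n. y i = 0) \<and> walls n x \<subseteq> walls n y \<and>
        (\<forall>i. 1 \<le> i \<longrightarrow> i \<le> k \<longrightarrow> psum n i y = psum n i x + c i)"
      by (intro exI[of _ y]) (auto simp: y_def)
  qed
qed

text \<open>With more than \<open>s\<close> distinct values the power sum with exponent \<open>s +
  1\<close> can be changed in both directions while the first \<open>s\<close> of them stay
  fixed.\<close>

lemma not_extremal:
  assumes x: "x \<in> vslice n s c" and s: "s < card (x ` {..<n})" and n: "n \<le> DIM('v::euclidean_space)"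
  shows "\<exists>y\<in>vslice n s c. walls n x \<subseteq> walls n y \<and> psum n (Suc s) y < psum n (Suc s) x"
    and "\<exists>y\<in>vslice n s c. walls n x \<subseteq> walls n y \<and> psum n (Suc s) x < psum n (Suc s) y"
proof -
  have sx: "sorted_on n x" using x by (simp add: vslice_def)
  have "card (x ` {..<n}) \<le> n" using card_image_le[of "{..<n}" x] by simp
  then have "Suc s \<le> card (x ` {..<n})" "Suc s \<le> DIM('v)" using s n by linarith+
  from perturb_values[where 'v = 'v, OF sx this] obtain \<eta> where \<eta>: "0 < \<eta>"
    "\<And>c. (\<And>i. 1 \<le> i \<Longrightarrow> i \<le> Suc s \<Longrightarrow> \<bar>c i\<bar> < \<eta>) \<Longrightarrow>
      \<exists>y. sorted_on n y \<and> (\<forall>i\<ge>n. y i = 0) \<and> walls n x \<subseteq> walls n y \<and>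
        (\<forall>i. 1 \<le> i \<longrightarrow> i \<le> Suc s \<longrightarrow> psum n i y = psum n i x + c i)" by blast
  have "\<exists>y\<in>vslice n s c. walls n x \<subseteq> walls n y \<and> psum n (Suc s) y = psum n (Suc s) x + d"
    if "\<bar>d\<bar> < \<eta>" for d
  proof -
    have small: "\<bar>if i = Suc s then d else 0\<bar> < \<eta>" for i using that \<eta>(1) by simp
    obtain y where "sorted_on n y" "\<forall>i\<ge>n. y i = 0" "walls n x \<subseteq> walls n y"
      and ps: "\<forall>i. 1 \<le> i \<longrightarrow> i \<le> Suc s \<longrightarrow> psum n i y = psum n i x + (if i = Suc s then d else 0)"
      using \<eta>(2)[of "\<lambda>i. if i = Suc s then d else 0", OF small] by blast
    moreover have "psum n i y = c i" if "1 \<le> i" "i \<le> s" for i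
      using ps[rule_format, of i] that x by (simp add: vslice_def)
    ultimately show ?thesis by (intro bexI[of _ y]) (auto simp: vslice_def)
  qed
  from this[of "- \<eta> / 2"] this[of "\<eta> / 2"]
  show "\<exists>y\<in>vslice n s c. walls n x \<subseteq> walls n y \<and> psum n (Suc s) y < psum n (Suc s) x"
    and "\<exists>y\<in>vslice n s c. walls n x \<subseteq> walls n y \<and> psum n (Suc s) x < psum n (Suc s) y"
    using \<eta>(1) by (metis add.commute less_add_same_cancel1 add_less_same_cancel1 abs_of_pos abs_minus_cancel half_gt_zero minus_divide_left field_sum_of_halves neg_less_0_iff_less)+
qed

text \<open>The second power sum, which is prescribed because of \<open>2 \<le> s\<close>, bounds all
  entries.\<close>

lemma compact_vslice_walls:
  assumes "2 \<le> s"
  shows "compact {x \<in> vslice n s c. I \<subseteq> walls n x}"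
proof -
  let ?S = "\<lambda>i. if i < n then {- sqrt (c 2)..sqrt (c 2)} else {0::real}"
  have "compactin (product_topology (\<lambda>i. euclidean) UNIV) (PiE UNIV ?S)"
    unfolding compactin_PiE by (auto simp: compactin_euclidean_iff)
  then have K: "compact (PiE UNIV ?S)"
    by (simp add: euclidean_product_topology compactin_euclidean_iff)
  have cont: "continuous_on UNIV (\<lambda>x::nat \<Rightarrow> real. x i)" for i by (rule continuous_on_product_coordinates)
  have "closed {x::nat \<Rightarrow> real. (\<forall>i j. i \<le> j \<longrightarrow> j < n \<longrightarrow> x i \<le> x j) \<and> (\<forall>i. n \<le> i \<longrightarrow> x i = 0) \<and>
      (\<forall>k. 1 \<le> k \<longrightarrow> k \<le> s \<longrightarrow> (\<Sum>j<n. x j ^ k) = c k) \<and>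
      (\<forall>i. i \<in> I \<longrightarrow> 0 < i \<and> i < n \<and> x (i - 1) = x i)}"
    by (intro closed_Collect_conj closed_Collect_all closed_Collect_imp open_Collect_const closed_Collect_const
        closed_Collect_le closed_Collect_eq continuous_intros cont)
  moreover have "{x \<in> vslice n s c. I \<subseteq> walls n x} = {x. (\<forall>i j. i \<le> j \<longrightarrow> j < n \<longrightarrow> x i \<le> x j) \<and> (\<forall>i. n \<le> i \<longrightarrow> x i = 0) \<and>
      (\<forall>k. 1 \<le> k \<longrightarrow> k \<le> s \<longrightarrow> (\<Sum>j<n. x j ^ k) = c k) \<and>
      (\<forall>i. i \<in> I \<longrightarrow> 0 < i \<and> i < n \<and> x (i - 1) = x i)}"
    unfolding vslice_def sorted_on_def psum_def walls_def by auto
  ultimately have closed: "closed {x \<in> vslice n s c. I \<subseteq> walls n x}" by simp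
  have "{x \<in> vslice n s c. I \<subseteq> walls n x} \<subseteq> PiE UNIV ?S"
  proof
    fix x assume "x \<in> {x \<in> vslice n s c. I \<subseteq> walls n x}"
    then have x: "x \<in> vslice n s c" by blast
    have "x i \<in> ?S i" for i
    proof (cases "i < n")
      case True
      have "x i ^ 2 \<le> psum n 2 x"
        unfolding psum_def by (rule member_le_sum) (use True in auto)
      also have "\<dots> = c 2" using x assms by (simp add: vslice_def)
      finally have "\<bar>x i\<bar> \<le> sqrt (c 2)" by (simp add: real_le_rsqrt)
      then show ?thesis using True by (simp add: abs_le_iff)
    qed (use x in \<open>simp add: vslice_def\<close>)
    then show "x \<in> PiE UNIV ?S" by (simp add: PiE_iff)
  qed
  then show ?thesis using compact_Int_closed[OF K closed] by (simp add: Int_absorb1)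
qed

locale generic_vslice =
  fixes n s :: nat and c :: "nat \<Rightarrow> real"
  assumes s2: "2 \<le> s" and sn: "s \<le> n"
    and generic: "x \<in> vslice n s c \<Longrightarrow> s \<le> card (x ` {..<n})"
begin

abbreviation "X \<equiv> vslice n s c"
abbreviation height :: "(nat \<Rightarrow> real) \<Rightarrow> real" where "height \<equiv> psum n (Suc s)"

definition vertices :: "(nat \<Rightarrow> real) set" where
  "vertices = {x \<in> X. card (x ` {..<n}) = s}"

text \<open>The walls inside blocks whose distance from the last block is odd. Leaving one of them
  decreases \<open>height\<close>.\<close>

definition descents :: "(nat \<Rightarrow> real) \<Rightarrow> nat set" where
  "descents x = {i \<in> walls n x. even (card (x ` {..<i})) \<noteq> even s}"

text \<open>The comparison of power sums applies to a vertex because its number of blocks is exactly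
  \<open>s\<close>.\<close>

lemma vertex_compare:
  assumes x: "x \<in> vertices" and y: "y \<in> X" and neq: "x \<noteq> y"
    and rigid: "\<And>i. i \<in> walls n x \<Longrightarrow> even (card (x ` {..<i})) \<noteq> par \<Longrightarrow> x i < y i \<Longrightarrow> x (i - 1) < y (i - 1)"
  shows "if even s = par then height x < height y else height y < height x"
proof -
  have xX: "x \<in> X" and s: "s = card (x ` {..<n})" using x by (auto simp: vertices_def)
  obtain j where j: "x j \<noteq> y j" using neq by blast
  have "j < n" using j xX y by (cases "j < n") (auto simp: vslice_def)
  show ?thesis
  proof (rule psum_compare_vertex[where n = n and x = x and x' = y and j\<^sub>0 = j and s = s])
    show "\<And>i j. i \<le> j \<Longrightarrow> j < n \<Longrightarrow> x i \<le> x j" "\<And>i j. i \<le> j \<Longrightarrow> j < n \<Longrightarrow> y i \<le> y j"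
      using xX y by (auto simp: vslice_def sorted_on_def)
    show "s = card (x ` {..<n})" "j < n" "x j \<noteq> y j" by fact+
    show "psum n k x = psum n k y" if "1 \<le> k" "k \<le> s" for k using xX y that by (simp add: vslice_def)
    show "x (i - 1) < y (i - 1)"
      if "0 < i" "i < n" "x (i - 1) = x i" "even (card (x ` {..<i})) \<noteq> par" "x i < y i" for i
      using rigid[of i] that by (simp add: walls_def)
  qed
qed

lemma vertex_min:
  assumes x: "x \<in> vertices" and y: "y \<in> X" "x \<noteq> y" and D: "descents x \<subseteq> walls n y"
  shows "height x < height y"
proof -
  have "if even s = even s then height x < height y else height y < height x"
  proof (rule vertex_compare[OF x y])
    fix i assume "i \<in> walls n x" "even (card (x ` {..<i})) \<noteq> even s" "x i < y i"
    moreover from this have "i \<in> walls n y" using D by (auto simp: descents_def)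
    ultimately show "x (i - 1) < y (i - 1)" by (simp add: walls_def)
  qed
  then show ?thesis by simp
qed

lemma vertex_max:
  assumes x: "x \<in> vertices" and y: "y \<in> X" "x \<noteq> y" and D: "walls n x - descents x \<subseteq> walls n y"
  shows "height y < height x"
proof -
  have "if even s = odd s then height x < height y else height y < height x"
  proof (rule vertex_compare[OF x y])
    fix i assume "i \<in> walls n x" "even (card (x ` {..<i})) \<noteq> odd s" "x i < y i"
    moreover from this have "i \<in> walls n y" using D by (auto simp: descents_def)
    ultimately show "x (i - 1) < y (i - 1)" by (simp add: walls_def)
  qed
  then show ?thesis by simp
qed

text \<open>A point of a stratum where \<open>height\<close> attains its minimum or maximum has at most
  \<open>s\<close> distinct entries, since otherwise it could be moved within the stratum to
  change \<open>height\<close>.\<close>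

lemma extremal_vertices:
  assumes n: "n \<le> DIM('v::euclidean_space)" and x: "x \<in> X" "I \<subseteq> walls n x"
  shows "\<exists>y\<in>vertices. I \<subseteq> walls n y \<and> height y \<le> height x"
    and "\<exists>y\<in>vertices. I \<subseteq> walls n y \<and> height x \<le> height y"
proof -
  let ?M = "{x \<in> X. I \<subseteq> walls n x}"
  have M: "compact ?M" "?M \<noteq> {}" using compact_vslice_walls[OF s2] x by auto
  have cont: "continuous_on ?M height"
    unfolding psum_def
    by (intro continuous_intros continuous_on_subset[OF continuous_on_product_coordinates]) auto
  obtain y where y: "y \<in> ?M" "\<forall>z\<in>?M. height y \<le> height z" using continuous_attains_inf[OF M cont] by blast
  obtain z where z: "z \<in> ?M" "\<forall>y\<in>?M. height y \<le> height z" using continuous_attains_sup[OF M cont] by blast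
  have "\<not> s < card (y ` {..<n})"
  proof
    assume "s < card (y ` {..<n})"
    then obtain w where "w \<in> X" "walls n y \<subseteq> walls n w" "height w < height y"
      using not_extremal(1)[OF _ _ n] y(1) by blast
    then show False using y by force
  qed
  then have "y \<in> vertices" using y(1) generic[of y] by (simp add: vertices_def)
  then show "\<exists>y\<in>vertices. I \<subseteq> walls n y \<and> height y \<le> height x" using y x by blast
  have "\<not> s < card (z ` {..<n})"
  proof
    assume "s < card (z ` {..<n})"
    then obtain w where "w \<in> X" "walls n z \<subseteq> walls n w" "height z < height w"
      using not_extremal(2)[OF _ _ n] z(1) by blast
    then show False using z by force
  qed
  then have "z \<in> vertices" using z(1) generic[of z] by (simp add: vertices_def)
  then show "\<exists>y\<in>vertices. I \<subseteq> walls n y \<and> height x \<le> height y" using z x by blast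
qed

end

context generic_vslice
begin

text \<open>Move the part of the block to the left of the wall down by a small \<open>\<epsilon>\<close>
  and restore the first \<open>s\<close> power sums by moving the rest of that block and all
  other blocks. If the rest of the block ends up below the part moved by hand, then after
  exchanging the two parts every block moves in one direction only. Such a vector satisfies
  the hypotheses of \<open>vertex_compare\<close> for both parities, which is absurd.\<close>

lemma split_wall:
  assumes x: "x \<in> vertices" and v: "v \<in> walls n x" and n: "n \<le> DIM('v::euclidean_space)"
  shows "\<exists>y\<in>X. y \<noteq> x \<and> walls n x - {v} \<subseteq> walls n y"
proof -
  define b where "b = x v"
  let ?V = "x ` {..<n}"
  have xX: "x \<in> X" and cV: "card ?V = s" and sx: "sorted_on n x"
    using x by (auto simp: vertices_def vslice_def)
  have v': "0 < v" "v < n" "x (v - 1) = b" using v by (auto simp: walls_def b_def)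
  have bV: "b \<in> ?V" using v'(2) by (simp add: b_def)
  define a N where "a = card {j. j < n \<and> x j < b}" and "N = card {j. j < n \<and> x j \<le> b}"
  have below: "{j. j < n \<and> x j < b} = {..<a}"
    unfolding a_def
  proof (rule initial_segment)
    fix i j assume "i \<in> {j. j < n \<and> x j < b}" "j \<le> i"
    then show "j \<in> {j. j < n \<and> x j < b}" using sorted_onD[OF sx, of j i] by simp
  qed simp
  have upto: "{j. j < n \<and> x j \<le> b} = {..<N}"
    unfolding N_def
  proof (rule initial_segment)
    fix i j assume "i \<in> {j. j < n \<and> x j \<le> b}" "j \<le> i"
    then show "j \<in> {j. j < n \<and> x j \<le> b}" using sorted_onD[OF sx, of j i] by simp
  qed simp
  have block: "{j. j < n \<and> x j = b} = {a..<N}"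
  proof (rule set_eqI)
    fix j
    have "j < a \<longleftrightarrow> j < n \<and> x j < b" "j < N \<longleftrightarrow> j < n \<and> x j \<le> b" using below upto by blast+
    then show "j \<in> {j. j < n \<and> x j = b} \<longleftrightarrow> j \<in> {a..<N}" by auto
  qed
  have blockD: "j < n \<and> x j = b" if "a \<le> j" "j < N" for j
  proof -
    have "j \<in> {j. j < n \<and> x j = b}" unfolding block using that by simp
    then show ?thesis by blast
  qed
  have "v \<in> {j. j < n \<and> x j = b}" "v - 1 \<in> {j. j < n \<and> x j = b}" using v' by (auto simp: b_def)
  then have vb: "a < v" "v < N" unfolding block using v'(1) by auto
  \<comment> \<open>The block is \<open>{a..<N}\<close>. Only its \<open>N - v\<close>
    entries to the right of the wall take part in the correction, which gives the value
    \<open>b\<close> this weight.\<close>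
  define m where "m t = (if t = b then real (N - v) else real (card {j. j < n \<and> x j = t}))" for t
  have m0: "m t \<noteq> 0" if "t \<in> ?V" for t using that vb(2) by (auto simp: m_def)
  obtain \<delta> where \<delta>: "0 < \<delta>" "\<And>y z. y \<in> ?V \<Longrightarrow> z \<in> ?V \<Longrightarrow> y < z \<Longrightarrow> y + \<delta> \<le> z - \<delta>"
    using values_gap[of ?V] by blast
  have "card ?V \<le> DIM('v)" using cV sn n by simp
  then obtain \<eta> where \<eta>: "0 < \<eta>"
    "\<forall>c. (\<forall>i. 1 \<le> i \<and> i \<le> s \<longrightarrow> \<bar>c i\<bar> < \<eta>) \<longrightarrow>
      (\<exists>\<phi>. (\<forall>t\<in>?V. \<bar>\<phi> t - t\<bar> < \<delta>) \<and>
        (\<forall>i. 1 \<le> i \<and> i \<le> s \<longrightarrow> (\<Sum>t\<in>?V. m t * \<phi> t ^ i) = (\<Sum>t\<in>?V. m t * t ^ i) + c i))"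
    using power_sums_locally_onto[where Y = ?V and m = m and \<delta> = \<delta> and 'v = 'v] m0 \<delta>(1)
    unfolding cV by blast
  let ?c = "\<lambda>\<epsilon> i. real (v - a) * (b ^ i - (b - \<epsilon>) ^ i)"
  have "\<forall>\<^sub>F \<epsilon> in at_right 0. \<bar>?c \<epsilon> i\<bar> < \<eta>" for i
  proof -
    have "((\<lambda>\<epsilon>. ?c \<epsilon> i) \<longlongrightarrow> real (v - a) * (b ^ i - (b - 0) ^ i)) (at_right 0)"
      by (intro tendsto_intros)
    then have "((\<lambda>\<epsilon>. ?c \<epsilon> i) \<longlongrightarrow> 0) (at_right 0)" by simp
    then show ?thesis using \<eta>(1) by (auto dest: tendstoD simp: dist_real_def)
  qed
  then have "\<forall>\<^sub>F \<epsilon> in at_right 0. \<forall>i\<in>{1..s}. \<bar>?c \<epsilon> i\<bar> < \<eta>" by (simp add: eventually_ball_finite)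
  moreover have "\<forall>\<^sub>F \<epsilon> in at_right (0::real). \<epsilon> < \<delta> \<and> 0 < \<epsilon>"
    using \<delta>(1) unfolding eventually_at_right_field by blast
  ultimately have "\<forall>\<^sub>F \<epsilon> in at_right 0. (\<forall>i\<in>{1..s}. \<bar>?c \<epsilon> i\<bar> < \<eta>) \<and> (\<epsilon> < \<delta> \<and> 0 < \<epsilon>)"
    by (rule eventually_conj)
  from eventually_happens'[OF trivial_limit_at_right_real this]
  obtain \<epsilon> where \<epsilon>: "\<forall>i\<in>{1..s}. \<bar>?c \<epsilon> i\<bar> < \<eta>" "\<epsilon> < \<delta>" "0 < \<epsilon>" by blast
  define u where "u = b - \<epsilon>"
  obtain \<phi> where \<phi>: "\<And>t. t \<in> ?V \<Longrightarrow> \<bar>\<phi> t - t\<bar> < \<delta>"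
    "\<And>i. 1 \<le> i \<Longrightarrow> i \<le> s \<Longrightarrow> (\<Sum>t\<in>?V. m t * \<phi> t ^ i) = (\<Sum>t\<in>?V. m t * t ^ i) + real (v - a) * (b ^ i - u ^ i)"
    using \<eta>(2)[rule_format, of "?c \<epsilon>"] \<epsilon>(1) unfolding u_def by auto
  define Y where "Y w p q j = (if n \<le> j then 0 else if x j = b then (if j < w then p else q) else \<phi> (x j))"
    for w :: nat and p q :: real and j
  have sorted_Y: "sorted_on n (Y w p q)" if pq: "p \<le> q" "\<bar>p - b\<bar> < \<delta>" "\<bar>q - b\<bar> < \<delta>" for w p q
    unfolding sorted_on_def
  proof (intro allI impI)
    fix i j assume ij: "i \<le> j" "j < n"
    have near: "\<bar>Y w p q i - x i\<bar> < \<delta>" if "i < n" for i using that pq \<phi>(1) by (auto simp: Y_def)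
    have "x i \<le> x j" using sx ij sorted_onD by blast
    then consider "x i = x j" | "x i + \<delta> \<le> x j - \<delta>" using \<delta>(2)[of "x i" "x j"] ij by fastforce
    then show "Y w p q i \<le> Y w p q j"
    proof cases
      case 1
      then show ?thesis using ij pq(1) by (auto simp: Y_def)
    next
      case 2
      then show ?thesis using near[of i] near[of j] ij by linarith
    qed
  qed
  have psum_Y: "psum n i (Y w p q) = psum n i x"
    if w: "a \<le> w" "w \<le> N" and i: "1 \<le> i" "i \<le> s"
      and pq: "real (w - a) * p ^ i + real (N - w) * q ^ i = real (v - a) * u ^ i + real (N - v) * \<phi> b ^ i" for w p q i
  proof -
    have fib: "(\<Sum>j\<in>{j. j < n \<and> x j = b}. Y w p q j ^ i) = real (w - a) * p ^ i + real (N - w) * q ^ i"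
    proof -
      have "(\<Sum>j\<in>{j. j < n \<and> x j = b}. Y w p q j ^ i)
          = (\<Sum>j\<in>{a..<w}. Y w p q j ^ i) + (\<Sum>j\<in>{w..<N}. Y w p q j ^ i)"
        unfolding block using w by (rule sum.atLeastLessThan_concat[symmetric])
      moreover have "(\<Sum>j\<in>{a..<w}. Y w p q j ^ i) = (\<Sum>j\<in>{a..<w}. p ^ i)"
      proof (rule sum.cong[OF refl])
        fix j assume "j \<in> {a..<w}"
        then have "j < n \<and> x j = b" "j < w" using blockD[of j] w(2) by simp_all
        then show "Y w p q j ^ i = p ^ i" by (simp add: Y_def)
      qed
      moreover have "(\<Sum>j\<in>{w..<N}. Y w p q j ^ i) = (\<Sum>j\<in>{w..<N}. q ^ i)"
      proof (rule sum.cong[OF refl])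
        fix j assume "j \<in> {w..<N}"
        then have "j < n \<and> x j = b" "\<not> j < w" using blockD[of j] w(1) by simp_all
        then show "Y w p q j ^ i = q ^ i" by (simp add: Y_def)
      qed
      ultimately show ?thesis by simp
    qed
    have other: "(\<Sum>j\<in>{j. j < n \<and> x j = t}. Y w p q j ^ i) = m t * \<phi> t ^ i" if "t \<noteq> b" for t
      using that by (simp add: Y_def m_def)
    have split: "(\<Sum>t\<in>?V. f t) = f b + (\<Sum>t\<in>?V - {b}. f t)" for f :: "real \<Rightarrow> real"
      using bV by (simp add: sum.remove)
    have "psum n i (Y w p q) = real (v - a) * u ^ i + real (N - v) * \<phi> b ^ i + (\<Sum>t\<in>?V - {b}. m t * \<phi> t ^ i)"
      unfolding psum_fibres[of n i _ x] split[of "\<lambda>t. \<Sum>j\<in>{j. j < n \<and> x j = t}. Y w p q j ^ i"] fib pq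
      by (simp add: other)
    also have "\<dots> = real (v - a) * u ^ i + (\<Sum>t\<in>?V. m t * \<phi> t ^ i)"
      unfolding split[of "\<lambda>t. m t * \<phi> t ^ i"] by (simp add: m_def)
    also have "\<dots> = real (v - a) * b ^ i + (\<Sum>t\<in>?V. m t * t ^ i)"
      unfolding \<phi>(2)[OF i] by (simp add: algebra_simps)
    also have "\<dots> = real (v - a) * b ^ i + real (N - v) * b ^ i + (\<Sum>t\<in>?V - {b}. m t * t ^ i)"
      unfolding split[of "\<lambda>t. m t * t ^ i"] by (simp add: m_def)
    also have "\<dots> = real (N - a) * b ^ i + (\<Sum>t\<in>?V - {b}. m t * t ^ i)"
      using vb by (simp add: of_nat_diff algebra_simps)
    also have "\<dots> = (\<Sum>t\<in>?V. \<Sum>j\<in>{j. j < n \<and> x j = t}. x j ^ i)"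
    proof -
      have "(\<Sum>j\<in>{j. j < n \<and> x j = b}. x j ^ i) = (\<Sum>j\<in>{j. j < n \<and> x j = b}. b ^ i)" by simp
      then have "(\<Sum>j\<in>{j. j < n \<and> x j = b}. x j ^ i) = real (N - a) * b ^ i" by (simp add: block)
      moreover have "(\<Sum>t\<in>?V - {b}. \<Sum>j\<in>{j. j < n \<and> x j = t}. x j ^ i) = (\<Sum>t\<in>?V - {b}. m t * t ^ i)"
        by (intro sum.cong) (auto simp: m_def)
      ultimately show ?thesis
        by (simp only: split[of "\<lambda>t. \<Sum>j\<in>{j. j < n \<and> x j = t}. x j ^ i"])
    qed
    also have "\<dots> = psum n i x" by (rule psum_fibres[symmetric])
    finally show ?thesis .
  qed
  have Y_in: "Y w p q \<in> X" if "sorted_on n (Y w p q)"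
      "\<And>i. 1 \<le> i \<Longrightarrow> i \<le> s \<Longrightarrow> psum n i (Y w p q) = psum n i x" for w p q
    using that xX by (auto simp: vslice_def Y_def)
  have "\<bar>u - b\<bar> < \<delta>" "u < b" using \<epsilon> by (auto simp: u_def)
  have \<phi>b: "\<bar>\<phi> b - b\<bar> < \<delta>" using \<phi>(1) bV by blast
  show ?thesis
  proof (cases "u \<le> \<phi> b")
    case True
    let ?y = "Y v u (\<phi> b)"
    have "?y \<in> X"
      using sorted_Y[OF True \<open>\<bar>u - b\<bar> < \<delta>\<close> \<phi>b] psum_Y[of v _ u "\<phi> b"] vb by (intro Y_in) auto
    moreover have "?y (v - 1) = u" using v' by (simp add: Y_def)
    then have "?y \<noteq> x" using v'(3) \<open>u < b\<close> by auto
    moreover have "walls n x - {v} \<subseteq> walls n ?y"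
    proof
      fix i assume i: "i \<in> walls n x - {v}"
      then have "i - 1 < v \<longleftrightarrow> i < v" by (auto simp: walls_def)
      then show "i \<in> walls n ?y" using i by (auto simp: walls_def Y_def)
    qed
    ultimately show ?thesis by blast
  next
    case False
    \<comment> \<open>The two parts in increasing order: the \<open>N - v\<close> entries at
      \<open>\<phi> b\<close> now come first.\<close>
    let ?w = "a + (N - v)"
    let ?y = "Y ?w (\<phi> b) u"
    have w: "a \<le> ?w" "?w \<le> N" "N - ?w = v - a" using vb by auto
    have "?y \<in> X"
      using sorted_Y[of "\<phi> b" u ?w] False \<open>\<bar>u - b\<bar> < \<delta>\<close> \<phi>b psum_Y[of ?w _ "\<phi> b" u] w by (intro Y_in) auto
    have below_b: "?y j < b" if "j < n" "x j = b" for j using that False \<open>u < b\<close> by (auto simp: Y_def)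
    then have "x \<noteq> ?y" using v' by (metis b_def less_irrefl)
    have "if even s = par then height x < height ?y else height ?y < height x" for par
    proof (rule vertex_compare[OF x \<open>?y \<in> X\<close> \<open>x \<noteq> ?y\<close>])
      fix i assume i: "i \<in> walls n x" "x i < ?y i"
      then have "x i \<noteq> b" using below_b[of i] by (auto simp: walls_def)
      then show "x (i - 1) < ?y (i - 1)" using i by (auto simp: walls_def Y_def)
    qed
    from this[of True] this[of False] show ?thesis by (auto split: if_splits)
  qed
qed

text \<open>The edge obtained by leaving a descent contains a further point of the slice. The vertex is
  the highest point of that edge, so the lowest point, which is again a vertex, lies
  strictly below it.\<close>

lemma lower_vertex:
  assumes x: "x \<in> vertices" and v: "v \<in> descents x" and n: "n \<le> DIM('v::euclidean_space)"
  shows "\<exists>y\<in>vertices. walls n x - {v} \<subseteq> walls n y \<and> height y < height x"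
proof -
  have "v \<in> walls n x" using v by (simp add: descents_def)
  then obtain y where y: "y \<in> X" "y \<noteq> x" "walls n x - {v} \<subseteq> walls n y" using split_wall[OF x _ n] by blast
  then have "height y < height x" using vertex_max[OF x y(1)] v by blast
  moreover obtain z where "z \<in> vertices" "walls n x - {v} \<subseteq> walls n z" "height z \<le> height y"
    using extremal_vertices(1)[OF n y(1,3)] by blast
  ultimately show ?thesis by (meson le_less_trans)
qed

lemma upper_vertex:
  assumes x: "x \<in> vertices" and v: "v \<in> walls n x - descents x" and n: "n \<le> DIM('v::euclidean_space)"
  shows "\<exists>y\<in>vertices. walls n x - {v} \<subseteq> walls n y \<and> height x < height y"
proof -
  obtain y where y: "y \<in> X" "y \<noteq> x" "walls n x - {v} \<subseteq> walls n y" using split_wall[OF x _ n] v by blast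
  moreover have "descents x \<subseteq> walls n x - {v}" using v by (auto simp: descents_def)
  ultimately have "height x < height y" using vertex_min[OF x y(1)] by blast
  moreover obtain z where "z \<in> vertices" "walls n x - {v} \<subseteq> walls n z" "height y \<le> height z"
    using extremal_vertices(2)[OF n y(1,3)] by blast
  ultimately show ?thesis by (meson less_le_trans)
qed

lemma walls_inj: "inj_on (walls n) vertices"
proof (rule inj_onI)
  fix x y assume xy: "x \<in> vertices" "y \<in> vertices" "walls n x = walls n y"
  show "x = y"
  proof (rule ccontr)
    assume "x \<noteq> y"
    have "y \<in> X" using xy by (simp add: vertices_def)
    have "height x < height y" "height y < height x"
      using vertex_min[OF xy(1) \<open>y \<in> X\<close> \<open>x \<noteq> y\<close>] vertex_max[OF xy(1) \<open>y \<in> X\<close> \<open>x \<noteq> y\<close>] xy(3)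
      by (auto simp: descents_def)
    then show False by simp
  qed
qed

text \<open>Distinct faces of the complex have distinct strata: from a vertex on the wall
  \<open>i\<close>, an edge leaves that wall and keeps all others.\<close>

lemma face_walls_exact:
  assumes n: "n \<le> DIM('v::euclidean_space)" and x: "x \<in> X" "I \<subseteq> walls n x" and i: "i \<notin> I"
  shows "\<exists>y\<in>X. I \<subseteq> walls n y \<and> i \<notin> walls n y"
proof -
  obtain z where z: "z \<in> vertices" "I \<subseteq> walls n z" using extremal_vertices(1)[OF n x] by blast
  have zX: "z \<in> X" using z(1) by (simp add: vertices_def)
  show ?thesis
  proof (cases "i \<in> walls n z")
    case True
    obtain y where y: "y \<in> vertices" "walls n z - {i} \<subseteq> walls n y" "height y \<noteq> height z"
      using lower_vertex[OF z(1) _ n, of i] upper_vertex[OF z(1) _ n, of i] True by force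
    have "y \<in> X" using y(1) by (simp add: vertices_def)
    have "i \<notin> walls n y"
    proof
      assume "i \<in> walls n y"
      then have "walls n z \<subseteq> walls n y" using y(2) by blast
      then have "height z < height y" "height y < height z"
        using vertex_min[OF z(1) \<open>y \<in> X\<close>] vertex_max[OF z(1) \<open>y \<in> X\<close>] y(3) by (auto simp: descents_def)
      then show False by simp
    qed
    then show ?thesis using y(2) \<open>y \<in> X\<close> z(2) i by blast
  qed (use z zX in blast)
qed

end

section \<open>Compositions and walls\<close>

text \<open>Only the proper partial sums are recorded; 0 and the total are common to all compositions.\<close>

definition breaks :: "nat list \<Rightarrow> nat set" where
  "breaks \<mu> = {sum_list (take i \<mu>) | i. 0 < i \<and> i < length \<mu>}"

lemma breaksI: "0 < i \<Longrightarrow> i < length \<mu> \<Longrightarrow> sum_list (take i \<mu>) \<in> breaks \<mu>"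
  unfolding breaks_def by blast

lemma breaksE:
  assumes "b \<in> breaks \<mu>"
  obtains i where "0 < i" "i < length \<mu>" "b = sum_list (take i \<mu>)"
  using assms unfolding breaks_def by blast

lemma sum_list_concat_eq: "sum_list (concat bs) = sum_list (map sum_list (bs :: nat list list))"
  by (induction bs) auto

lemma breaks_comp_le:
  assumes "comp_le \<mu> \<nu>"
  shows "breaks \<mu> \<subseteq> breaks \<nu>"
proof
  fix b assume "b \<in> breaks \<mu>"
  then obtain i where i: "0 < i" "i < length \<mu>" "b = sum_list (take i \<mu>)" by (rule breaksE)
  obtain bs where bs: "[] \<notin> set bs" "concat bs = \<nu>" "\<mu> = map sum_list bs"
    using assms unfolding comp_le_def by blast
  let ?m = "length (concat (take i bs))"
  have split: "\<nu> = concat (take i bs) @ concat (drop i bs)"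
    unfolding bs(2)[symmetric] concat_append[symmetric] by simp
  have ne: "concat l \<noteq> []" if "l \<noteq> []" "set l \<subseteq> set bs" for l
    using that bs(1) by (cases l) auto
  have "concat (take i bs) \<noteq> []" "concat (drop i bs) \<noteq> []"
    using i bs(3) by (intro ne; auto dest: in_set_takeD in_set_dropD)+
  then have "0 < ?m" "?m < length \<nu>" unfolding split by auto
  moreover have "b = sum_list (take ?m \<nu>)"
    unfolding split i(3) bs(3) by (simp add: take_map sum_list_concat_eq)
  ultimately show "b \<in> breaks \<nu>" using breaksI by blast
qed

lemma sum_list_take_mono:
  fixes xs :: "nat list"
  assumes "i \<le> j"
  shows "sum_list (take i xs) \<le> sum_list (take j xs)"
proof -
  have "take j xs = take i xs @ take (j - i) (drop i xs)"
    using assms by (metis le_add_diff_inverse take_add)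
  then show ?thesis by simp
qed

text \<open>The first entry of \<open>\<mu>\<close> is a partial sum of \<open>\<nu>\<close> and cuts
  off the first block; the remaining breaks are shifted by it.\<close>

lemma comp_le_breaks:
  assumes "composition n \<mu>" "composition n \<nu>" "breaks \<mu> \<subseteq> breaks \<nu>"
  shows "comp_le \<mu> \<nu>"
  using assms
proof (induction \<mu> arbitrary: n \<nu>)
  case Nil
  then have "\<nu> = []" by (cases \<nu>) (auto simp: composition_def)
  then show ?case unfolding comp_le_def by (intro exI[of _ "[]"]) simp
next
  case (Cons a \<mu>)
  show ?case
  proof (cases "\<mu> = []")
    case True
    then have "sum_list \<nu> = a" "\<nu> \<noteq> []" using Cons.prems by (auto simp: composition_def)
    then show ?thesis unfolding comp_le_def using True by (intro exI[of _ "[\<nu>]"]) simp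
  next
    case False
    then have "a \<in> breaks (a # \<mu>)" using breaksI[of 1 "a # \<mu>"] by simp
    then have "a \<in> breaks \<nu>" using Cons.prems(3) by blast
    then obtain m where m: "0 < m" "m < length \<nu>" "a = sum_list (take m \<nu>)" by (rule breaksE)
    have tot: "sum_list \<nu> = a + sum_list (drop m \<nu>)"
      using m(3) by (metis append_take_drop_id sum_list_append)
    have "composition (n - a) \<mu>" "composition (n - a) (drop m \<nu>)"
      using Cons.prems(1,2) tot by (auto simp: composition_def dest: in_set_dropD)
    moreover have "breaks \<mu> \<subseteq> breaks (drop m \<nu>)"
    proof
      fix b assume "b \<in> breaks \<mu>"
      then obtain i where i: "0 < i" "i < length \<mu>" "b = sum_list (take i \<mu>)" by (rule breaksE)
      have "a + b = sum_list (take (Suc i) (a # \<mu>))" using i(3) by simp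
      then have "a + b \<in> breaks (a # \<mu>)" using breaksI[of "Suc i" "a # \<mu>"] i by simp
      then have "a + b \<in> breaks \<nu>" using Cons.prems(3) by blast
      then obtain k where k: "0 < k" "k < length \<nu>" "a + b = sum_list (take k \<nu>)" by (rule breaksE)
      obtain h t where ht: "take i \<mu> = h # t" using i by (cases "take i \<mu>") auto
      then have "h \<in> set \<mu>" by (metis in_set_takeD list.set_intros(1))
      then have "0 < h" using Cons.prems(1) by (simp add: composition_def)
      then have "0 < b" using i(3) ht by simp
      have "m < k"
      proof (rule ccontr)
        assume "\<not> m < k"
        then have "a + b \<le> a" using sum_list_take_mono[of k m \<nu>] k(3) m(3) by simp
        then show False using \<open>0 < b\<close> by simp
      qed
      then have "take k \<nu> = take m \<nu> @ take (k - m) (drop m \<nu>)"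
        by (metis le_add_diff_inverse less_imp_le take_add)
      then have "b = sum_list (take (k - m) (drop m \<nu>))" using k(3) m(3) by simp
      then show "b \<in> breaks (drop m \<nu>)" using breaksI[of "k - m" "drop m \<nu>"] \<open>m < k\<close> k(2) by simp
    qed
    ultimately have "comp_le \<mu> (drop m \<nu>)" by (rule Cons.IH)
    then obtain bs where bs: "[] \<notin> set bs" "concat bs = drop m \<nu>" "\<mu> = map sum_list bs"
      unfolding comp_le_def by blast
    have "take m \<nu> \<noteq> []" using m by auto
    then show ?thesis
      unfolding comp_le_def using bs m(3) by (intro exI[of _ "take m \<nu> # bs"]) simp
  qed
qed

lemma comp_le_iff_breaks:
  "composition n \<mu> \<Longrightarrow> composition n \<nu> \<Longrightarrow> comp_le \<mu> \<nu> \<longleftrightarrow> breaks \<mu> \<subseteq> breaks \<nu>"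
  using breaks_comp_le comp_le_breaks by blast

definition multiplicities :: "nat \<Rightarrow> (nat \<Rightarrow> real) \<Rightarrow> nat list" where
  "multiplicities n x = map (\<lambda>t. card {j. j < n \<and> x j = t}) (sorted_list_of_set (x ` {..<n}))"

lemma sum_fibres:
  assumes "T \<subseteq> x ` {..<n::nat}"
  shows "(\<Sum>t\<in>T. card {j. j < n \<and> x j = t}) = card {j. j < n \<and> x j \<in> T}"
proof -
  have fin: "finite T" using assms finite_subset by blast
  have "{j. j < n \<and> x j \<in> T} = (\<Union>t\<in>T. {j. j < n \<and> x j = t})" by blast
  then show ?thesis using fin by (simp only:) (subst card_UN_disjoint; auto)
qed

lemma composition_multiplicities: "composition n (multiplicities n x)"
  unfolding composition_def
proof
  let ?L = "sorted_list_of_set (x ` {..<n})"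
  show "\<forall>k\<in>set (multiplicities n x). 0 < k"
    by (auto simp: multiplicities_def card_gt_0_iff)
  have "sum_list (multiplicities n x) = (\<Sum>t\<in>x ` {..<n}. card {j. j < n \<and> x j = t})"
    unfolding multiplicities_def by (subst sum_list_distinct_conv_sum_set) auto
  also have "\<dots> = card {j. j < n \<and> x j \<in> x ` {..<n}}" by (rule sum_fibres) simp
  also have "{j. j < n \<and> x j \<in> x ` {..<n}} = {..<n}" by auto
  finally show "sum_list (multiplicities n x) = n" by simp
qed

lemma below_value_eq:
  assumes x: "sorted_on n x" and m: "0 < m" "m < n" "x (m - 1) \<noteq> x m"
  shows "{j. j < n \<and> x j < x m} = {..<m}"
proof (rule set_eqI)
  fix j
  have lt: "x (m - 1) < x m" using sorted_onD[OF x, of "m - 1" m] m by simp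
  show "j \<in> {j. j < n \<and> x j < x m} \<longleftrightarrow> j \<in> {..<m}"
  proof (cases "j < m")
    case True
    then have "x j \<le> x (m - 1)" using sorted_onD[OF x, of j "m - 1"] m by simp
    then have "x j < x m" using lt by simp
    then show ?thesis using True m(2) by simp
  next
    case False
    then show ?thesis using sorted_onD[OF x, of m j] by auto
  qed
qed

text \<open>The partial sums of the multiplicities count the roots below some distinct root, and these
  counts are the positions at which the sorted roots jump.\<close>

lemma breaks_multiplicities:
  assumes x: "sorted_on n x"
  shows "breaks (multiplicities n x) = {0<..<n} - walls n x"
proof -
  let ?V = "x ` {..<n}"
  define L where "L = sorted_list_of_set ?V"
  have L: "set L = ?V" "distinct L" "sorted L" "length L = card ?V" by (simp_all add: L_def)
  have strict: "L ! i < L ! j" if "i < j" "j < length L" for i j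
    using sorted_nth_mono[OF L(3), of i j] nth_eq_iff_index_eq[OF L(2), of i j] that by simp
  have take: "set (take i L) = {t \<in> ?V. t < L ! i}" if "i < length L" for i
  proof (rule set_eqI)
    fix t
    have "t \<in> set (take i L) \<longleftrightarrow> (\<exists>k<i. t = L ! k)"
      using that by (auto simp: in_set_conv_nth)
    also have "\<dots> \<longleftrightarrow> (\<exists>k<length L. t = L ! k \<and> L ! k < L ! i)"
      using strict that by (metis less_asym less_irrefl less_trans linorder_neqE_nat)
    also have "\<dots> \<longleftrightarrow> t \<in> {t \<in> ?V. t < L ! i}" unfolding L(1)[symmetric] by (auto simp: in_set_conv_nth)
    finally show "t \<in> set (take i L) \<longleftrightarrow> t \<in> {t \<in> ?V. t < L ! i}" .
  qed
  have partial: "sum_list (take i (multiplicities n x)) = card {j. j < n \<and> x j < L ! i}"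
    if i: "i < length L" for i
  proof -
    have "sum_list (take i (multiplicities n x)) = sum_list (map (\<lambda>t. card {j. j < n \<and> x j = t}) (take i L))"
      by (simp add: multiplicities_def L_def take_map)
    also have "\<dots> = (\<Sum>t\<in>set (take i L). card {j. j < n \<and> x j = t})"
      using L(2) by (subst sum_list_distinct_conv_sum_set) auto
    also have "\<dots> = card {j. j < n \<and> x j \<in> set (take i L)}" by (rule sum_fibres) (auto simp: take[OF i])
    also have "{j. j < n \<and> x j \<in> set (take i L)} = {j. j < n \<and> x j < L ! i}" by (auto simp: take[OF i])
    finally show ?thesis .
  qed
  have len: "length (multiplicities n x) = length L" by (simp add: multiplicities_def L_def)
  show ?thesis
  proof (rule set_eqI, rule iffI)
    fix m assume "m \<in> breaks (multiplicities n x)"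
    then obtain i where i: "0 < i" "i < length L" "m = card {j. j < n \<and> x j < L ! i}"
      using partial len by (metis breaksE)
    have seg: "{j. j < n \<and> x j < L ! i} = {..<m}"
      unfolding i(3)
    proof (rule initial_segment)
      fix k j assume "k \<in> {j. j < n \<and> x j < L ! i}" "j \<le> k"
      then show "j \<in> {j. j < n \<and> x j < L ! i}" using sorted_onD[OF x, of j k] by simp
    qed simp
    have iff: "j < m \<longleftrightarrow> j < n \<and> x j < L ! i" for j
    proof -
      have "j \<in> {..<m} \<longleftrightarrow> j \<in> {j. j < n \<and> x j < L ! i}" by (simp only: seg)
      then show ?thesis by simp
    qed
    have "L ! 0 \<in> ?V" "L ! i \<in> ?V" using i(2) L(1) nth_mem[of _ L] by (metis gr_implies_not0 gr0I)+
    then obtain j\<^sub>0 j\<^sub>1 where j: "j\<^sub>0 < n" "x j\<^sub>0 = L ! 0" "j\<^sub>1 < n" "x j\<^sub>1 = L ! i" by (metis imageE lessThan_iff)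
    have "j\<^sub>0 < m" "\<not> j\<^sub>1 < m" using iff[of j\<^sub>0] iff[of j\<^sub>1] j strict[OF i(1,2)] by simp_all
    then have m: "0 < m" "m < n" using j(3) by simp_all
    have "x (m - 1) < L ! i" "\<not> x m < L ! i" using iff[of "m - 1"] iff[of m] m by simp_all
    then show "m \<in> {0<..<n} - walls n x" using m by (auto simp: walls_def)
  next
    fix m assume "m \<in> {0<..<n} - walls n x"
    then have m: "0 < m" "m < n" "x (m - 1) \<noteq> x m" by (auto simp: walls_def)
    have "x m \<in> set L" using L(1) m(2) by simp
    then obtain i where i: "i < length L" "L ! i = x m" by (metis in_set_conv_nth)
    have "0 < i"
    proof (rule ccontr)
      assume "\<not> 0 < i"
      have "x (m - 1) \<in> set L" using L(1) m(2) by simp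
      then obtain k where k: "k < length L" "L ! k = x (m - 1)" by (metis in_set_conv_nth)
      have "x (m - 1) < x m" using sorted_onD[OF x, of "m - 1" m] m by simp
      then show False using strict[of i k] \<open>\<not> 0 < i\<close> i k by (cases "k = 0") auto
    qed
    then show "m \<in> breaks (multiplicities n x)"
      using breaksI[of i "multiplicities n x"] partial[OF i(1)] below_value_eq[OF x m] i len by simp
  qed
qed

text \<open>Jump by 1 at every position that is not in \<open>I\<close>.\<close>

lemma exists_walls:
  assumes "I \<subseteq> {0<..<n}"
  shows "\<exists>x. sorted_on n x \<and> walls n x = I"
proof (intro exI conjI)
  let ?x = "\<lambda>j. real (card ({0<..j} - I))"
  show "sorted_on n ?x"
    unfolding sorted_on_def by (intro allI impI) (simp, rule card_mono, auto)
  have "?x (i - 1) = ?x i \<longleftrightarrow> i \<in> I" if "0 < i" for i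
  proof -
    have "{0<..i} = insert i {0<..i - 1}" using that by auto
    then have "{0<..i} - I = (if i \<in> I then {0<..i - 1} - I else insert i ({0<..i - 1} - I))" by auto
    moreover have "card (insert i ({0<..i - 1} - I)) = Suc (card ({0<..i - 1} - I))"
      by (rule card_insert_disjoint) (use that in auto)
    ultimately show ?thesis by simp
  qed
  then show "walls n ?x = I" using assms unfolding walls_def by (auto simp: subset_iff)
qed

section \<open>Polynomials with real roots\<close>

definition poly_of :: "nat \<Rightarrow> (nat \<Rightarrow> real) \<Rightarrow> real poly" where
  "poly_of n x = (\<Prod>j<n. [:- x j, 1:])"

lemma map_poly_of_real_mult:
  "map_poly complex_of_real (p * q) = map_poly complex_of_real p * map_poly complex_of_real q"
  by (rule poly_eqI) (simp add: coeff_map_poly coeff_mult)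

lemma poly_map_poly_of_real:
  "poly (map_poly complex_of_real p) (complex_of_real t) = complex_of_real (poly p t)"
  by (induction p) (simp_all add: map_poly_pCons)

lemma poly_poly_of: "poly (poly_of n x) t = 0 \<longleftrightarrow> t \<in> x ` {..<n}"
  unfolding poly_of_def poly_prod by auto

lemma poly_of_monic: "degree (poly_of n x) = n" "lead_coeff (poly_of n x) = 1" "poly_of n x \<noteq> 0"
proof -
  show lc: "lead_coeff (poly_of n x) = 1"
    unfolding poly_of_def by (simp add: lead_coeff_prod)
  then show "poly_of n x \<noteq> 0" by auto
  have "degree (poly_of n x) = (\<Sum>j<n. degree [:- x j, 1:])"
    unfolding poly_of_def by (rule degree_prod_eq_sum_degree) auto
  then show "degree (poly_of n x) = n" by simp
qed

lemma poly_of_Suc: "poly_of (Suc n) x = poly_of n x * [:- x n, 1:]"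
  by (simp add: poly_of_def)

lemma order_poly_of: "order t (poly_of n x) = card {j. j < n \<and> x j = t}"
proof (induction n)
  case 0
  then show ?case by (simp add: poly_of_def order_0I)
next
  case (Suc n)
  have "{j. j < Suc n \<and> x j = t} = (if x n = t then insert n {j. j < n \<and> x j = t} else {j. j < n \<and> x j = t})"
    by (auto simp: less_Suc_eq)
  moreover have "order t [:- x n, 1:] = (if x n = t then 1 else 0)"
    using order_power_n_n[of t 1] by (cases "x n = t") (simp_all add: order_0I)
  moreover have "poly_of (Suc n) x \<noteq> 0" by (rule poly_of_monic)
  ultimately show ?case using Suc order_mult[of "poly_of n x" "[:- x n, 1:]" t] poly_of_Suc[of n x] by simp
qed

lemma root_composition_poly_of: "root_composition (poly_of n x) = multiplicities n x"
proof -
  have "{t. poly (poly_of n x) t = 0} = x ` {..<n}" using poly_poly_of by blast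
  then show ?thesis by (simp add: root_composition_def multiplicities_def order_poly_of)
qed

lemma poly_of_monic_hyperbolic: "poly_of n x \<in> monic_hyperbolic n"
proof -
  have "poly (map_poly complex_of_real (poly_of n x)) z = (\<Prod>j<n. z - complex_of_real (x j))" for z
  proof (induction n)
    case (Suc n)
    have "map_poly complex_of_real (poly_of (Suc n) x)
        = map_poly complex_of_real (poly_of n x) * map_poly complex_of_real [:- x n, 1:]"
      unfolding poly_of_Suc by (rule map_poly_of_real_mult)
    then show ?case by (simp only: poly_mult Suc) (simp add: map_poly_pCons)
  qed (simp add: poly_of_def)
  then have "hyperbolic (poly_of n x)" unfolding hyperbolic_def by auto
  then show ?thesis using poly_of_monic[of n x] by (simp add: monic_hyperbolic_def)
qed

lemma monic_hyperbolic_linear_factors: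
  assumes "H \<in> monic_hyperbolic n"
  shows "\<exists>xs. length xs = n \<and> H = (\<Prod>t\<leftarrow>xs. [:- t, 1:])"
  using assms
proof (induction n arbitrary: H)
  case 0
  then have H: "degree H = 0" "lead_coeff H = 1" unfolding monic_hyperbolic_def by blast+
  obtain a where "H = [:a:]" using H(1) by (rule degree_eq_zeroE)
  then have "H = 1" using H(2) by (simp add: one_pCons)
  then show ?case by simp
next
  case (Suc n)
  then have H: "degree H = Suc n" "lead_coeff H = 1" "hyperbolic H" by (auto simp: monic_hyperbolic_def)
  have "degree (map_poly complex_of_real H) = Suc n" using H(1) by (simp add: degree_map_poly)
  then have "\<not> constant (poly (map_poly complex_of_real H))" by (simp add: constant_degree)
  then obtain z where z: "poly (map_poly complex_of_real H) z = 0"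
    using fundamental_theorem_of_algebra by blast
  then obtain t where "z = complex_of_real t" using H(3) by (metis Reals_cases hyperbolic_def)
  then have "poly H t = 0" using z by (simp add: poly_map_poly_of_real)
  then obtain G where G: "H = [:- t, 1:] * G" by (metis poly_eq_0_iff_dvd dvdE)
  have "G \<noteq> 0" using G H(1) by auto
  then have "degree G = n" using G H(1) by (simp add: degree_mult_eq del: mult_pCons_left)
  moreover have "lead_coeff G = 1" using G H(2) by (simp add: lead_coeff_mult del: mult_pCons_left)
  moreover have "hyperbolic G"
    unfolding hyperbolic_def
  proof (intro allI impI)
    fix z assume "poly (map_poly complex_of_real G) z = 0"
    then have "poly (map_poly complex_of_real H) z = 0" unfolding G map_poly_of_real_mult by simp
    then show "z \<in> \<real>" using H(3) by (simp add: hyperbolic_def)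
  qed
  ultimately obtain xs where "length xs = n" "G = (\<Prod>t\<leftarrow>xs. [:- t, 1:])"
    using Suc.IH[of G] by (auto simp: monic_hyperbolic_def)
  then show ?case using G by (intro exI[of _ "t # xs"]) simp
qed

lemma monic_hyperbolic_poly_of:
  assumes "H \<in> monic_hyperbolic n"
  shows "\<exists>x. sorted_on n x \<and> (\<forall>i\<ge>n. x i = 0) \<and> H = poly_of n x"
proof -
  obtain xs where xs: "length xs = n" "H = (\<Prod>t\<leftarrow>xs. [:- t, 1:])"
    using monic_hyperbolic_linear_factors[OF assms] by blast
  let ?x = "\<lambda>i. if i < n then sort xs ! i else 0"
  have "sorted_on n ?x" using xs(1) sorted_nth_mono[of "sort xs"] by (auto simp: sorted_on_def)
  moreover have "H = poly_of n ?x"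
  proof -
    have "H = (\<Prod>t\<leftarrow>sort xs. [:- t, 1:])"
      unfolding xs(2) by (simp only: prod_mset_prod_list[symmetric] mset_map mset_sort)
    also have "\<dots> = (\<Prod>i<n. [:- (sort xs ! i), 1:])"
      using xs(1) by (simp add: prod.list_conv_set_nth atLeast0LessThan)
    finally show ?thesis by (simp add: poly_of_def)
  qed
  ultimately show ?thesis by (intro exI[of _ ?x]) auto
qed

lemma poly_of_inj:
  assumes "sorted_on n x" "sorted_on n y" "\<forall>i\<ge>n. x i = 0" "\<forall>i\<ge>n. y i = 0" "poly_of n x = poly_of n y"
  shows "x = y"
proof -
  have card: "card {j. j < n \<and> x j = t} = card {j. j < n \<and> y j = t}" for t
    using assms(5) by (metis order_poly_of)
  have "mset (map x [0..<n]) = mset (map y [0..<n])"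
  proof (rule multiset_eqI)
    have c: "count (mset (map z [0..<n])) t = card {j. j < n \<and> z j = t}" for z :: "nat \<Rightarrow> real" and t
    proof (induction n)
      case (Suc n)
      have "{j. j < Suc n \<and> z j = t} =
          (if z n = t then insert n {j. j < n \<and> z j = t} else {j. j < n \<and> z j = t})"
        by (auto simp: less_Suc_eq)
      then show ?case using Suc by simp
    qed simp
    show "count (mset (map x [0..<n])) t = count (mset (map y [0..<n])) t" for t
      by (simp only: c card)
  qed
  moreover have "sorted (map z [0..<n])" if "sorted_on n z" for z
    using that by (auto simp: sorted_iff_nth_mono sorted_on_def)
  ultimately have "map x [0..<n] = map y [0..<n]"
    using assms(1,2) by (metis properties_for_sort)
  then have "x i = y i" if "i < n" for i using that by simp
  then show ?thesis using assms(3,4) by (metis ext not_le_imp_less)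
qed

text \<open>The coefficient of degree \<open>k\<close> is that of \<open>T ^ (n - k)\<close> in the
  polynomial with roots \<open>x j\<close>. The logarithmic derivative of the reversed
  polynomial generates the power sums.\<close>

definition reversed_fps :: "nat \<Rightarrow> (nat \<Rightarrow> real) \<Rightarrow> real fps" where
  "reversed_fps n x = (\<Prod>j<n. 1 - fps_const (x j) * fps_X)"

lemma reversed_fps_nth:
  "fps_nth (reversed_fps n x) k = (if k \<le> n then coeff (poly_of n x) (n - k) else 0)"
proof (induction n arbitrary: k)
  case 0
  then show ?case by (simp add: reversed_fps_def poly_of_def)
next
  case (Suc n)
  have F: "fps_nth (reversed_fps (Suc n) x) k
      = fps_nth (reversed_fps n x) k - (if k = 0 then 0 else x n * fps_nth (reversed_fps n x) (k - 1))"
  proof -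
    have "reversed_fps (Suc n) x = reversed_fps n x - fps_const (x n) * (fps_X * reversed_fps n x)"
      by (simp add: reversed_fps_def algebra_simps)
    then show ?thesis by (simp add: fps_X_mult_nth)
  qed
  have P: "coeff (poly_of (Suc n) x) m = (if m = 0 then 0 else coeff (poly_of n x) (m - 1)) - x n * coeff (poly_of n x) m" for m
    unfolding poly_of_Suc by (simp add: coeff_pCons split: nat.split)
  have d: "coeff (poly_of n x) (Suc n) = 0" by (simp add: coeff_eq_0 poly_of_monic(1))
  show ?case
    unfolding F P Suc using d by (auto simp: Suc_diff_le)
qed

lemma reversed_fps_deriv:
  "fps_deriv (reversed_fps n x) = reversed_fps n x * Abs_fps (\<lambda>i. - psum n (Suc i) x)"
proof (induction n)
  case 0
  have "Abs_fps (\<lambda>i. - psum 0 (Suc i) x) = 0" by (rule fps_ext) (simp add: psum_def)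
  then show ?case by (simp add: reversed_fps_def)
next
  case (Suc n)
  let ?R = "reversed_fps n x" and ?l = "1 - fps_const (x n) * fps_X"
  let ?P = "\<lambda>n. Abs_fps (\<lambda>i. - psum n (Suc i) x)"
  let ?Q = "Abs_fps (\<lambda>i. - (x n ^ Suc i))"
  have "?P (Suc n) = ?P n + ?Q" by (rule fps_ext) (simp add: psum_def)
  moreover have "?l * ?Q = - fps_const (x n)"
  proof -
    have "?l * ?Q = ?Q - fps_const (x n) * (fps_X * ?Q)" by (simp add: algebra_simps)
    moreover have "fps_nth (?Q - fps_const (x n) * (fps_X * ?Q)) k = fps_nth (- fps_const (x n)) k" for k
      by (cases k) (simp_all add: fps_X_mult_nth)
    ultimately show ?thesis by (simp add: fps_eq_iff)
  qed
  moreover have "reversed_fps (Suc n) x = ?R * ?l" by (simp add: reversed_fps_def)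
  moreover have "fps_deriv ?l = - fps_const (x n)" by simp
  ultimately have "fps_deriv (reversed_fps (Suc n) x) = ?R * ?P n * ?l + ?R * (?l * ?Q)"
    and "?R * ?P n * ?l + ?R * (?l * ?Q) = reversed_fps (Suc n) x * ?P (Suc n)"
    using Suc by (simp_all add: distrib_left mult_ac)
  then show ?case by simp
qed

lemma newton_identity:
  "real (Suc k) * fps_nth (reversed_fps n x) (Suc k) = - (\<Sum>i\<le>k. fps_nth (reversed_fps n x) i * psum n (Suc (k - i)) x)"
proof -
  have "fps_nth (fps_deriv (reversed_fps n x)) k = (\<Sum>i=0..k. fps_nth (reversed_fps n x) i * (- psum n (Suc (k - i)) x))"
    unfolding reversed_fps_deriv by (simp add: fps_mult_nth)
  then show ?thesis by (simp add: sum_negf atLeast0AtMost)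
qed

text \<open>Newton's identities determine the \<open>k\<close>-th coefficient from the first
  \<open>k\<close> power sums and, since the constant coefficient is 1, also the
  \<open>k\<close>-th power sum from the first \<open>k\<close> coefficients.\<close>

lemma psum_eq_iff_coeff_eq:
  assumes "s \<le> n"
  shows "(\<forall>k. 1 \<le> k \<and> k \<le> s \<longrightarrow> psum n k x = psum n k y) \<longleftrightarrow>
    (\<forall>k. 1 \<le> k \<and> k \<le> s \<longrightarrow> coeff (poly_of n x) (n - k) = coeff (poly_of n y) (n - k))"
proof -
  let ?r = "\<lambda>x k. fps_nth (reversed_fps n x) k"
  have r0: "?r x 0 = 1" for x using poly_of_monic(1,2)[of n x] by (simp add: reversed_fps_nth)
  have "(\<forall>k. 1 \<le> k \<and> k \<le> s \<longrightarrow> psum n k x = psum n k y) \<longleftrightarrow> (\<forall>k. 1 \<le> k \<and> k \<le> s \<longrightarrow> ?r x k = ?r y k)"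
  proof
    assume p: "\<forall>k. 1 \<le> k \<and> k \<le> s \<longrightarrow> psum n k x = psum n k y"
    have "k \<le> s \<longrightarrow> ?r x k = ?r y k" for k
    proof (induction k rule: less_induct)
      case (less k)
      show ?case
      proof (cases k)
        case (Suc m)
        show ?thesis
        proof
          assume "k \<le> s"
          have "(\<Sum>i\<le>m. ?r x i * psum n (Suc (m - i)) x) = (\<Sum>i\<le>m. ?r y i * psum n (Suc (m - i)) y)"
            using less Suc \<open>k \<le> s\<close> p by (intro sum.cong) auto
          then have "real (Suc m) * ?r x (Suc m) = real (Suc m) * ?r y (Suc m)"
            unfolding newton_identity by simp
          then show "?r x k = ?r y k" using Suc by (simp del: of_nat_Suc)
        qed
      qed (simp add: r0)
    qed
    then show "\<forall>k. 1 \<le> k \<and> k \<le> s \<longrightarrow> ?r x k = ?r y k" by blast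
  next
    assume r: "\<forall>k. 1 \<le> k \<and> k \<le> s \<longrightarrow> ?r x k = ?r y k"
    have "1 \<le> k \<and> k \<le> s \<longrightarrow> psum n k x = psum n k y" for k
    proof (induction k rule: less_induct)
      case (less k)
      show ?case
      proof
        assume k: "1 \<le> k \<and> k \<le> s"
        then obtain m where m: "k = Suc m" by (cases k) auto
        have split: "(\<Sum>i\<le>m. f i) = f 0 + (\<Sum>i\<in>{1..m}. f i)" for f :: "nat \<Rightarrow> real"
          by (simp only: atMost_atLeast0 sum.atLeast_Suc_atMost[of 0 m] One_nat_def le0)
        have "(\<Sum>i\<in>{1..m}. ?r x i * psum n (Suc (m - i)) x) = (\<Sum>i\<in>{1..m}. ?r y i * psum n (Suc (m - i)) y)"
          using less k m r by (intro sum.cong) auto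
        moreover have "(\<Sum>i\<le>m. ?r x i * psum n (Suc (m - i)) x) = (\<Sum>i\<le>m. ?r y i * psum n (Suc (m - i)) y)"
          using newton_identity[of m n x] newton_identity[of m n y] r k m by (metis neg_equal_iff_equal)
        ultimately show "psum n k x = psum n k y" using m unfolding split by (simp add: r0)
      qed
    qed
    then show "\<forall>k. 1 \<le> k \<and> k \<le> s \<longrightarrow> psum n k x = psum n k y" by blast
  qed
  also have "\<dots> \<longleftrightarrow> (\<forall>k. 1 \<le> k \<and> k \<le> s \<longrightarrow> coeff (poly_of n x) (n - k) = coeff (poly_of n y) (n - k))"
    using assms by (auto simp: reversed_fps_nth)
  finally show ?thesis .
qed

section \<open>The boundary complex is a sphere\<close>

lemma hyperbolic_slice_eq_image:
  assumes s: "s \<le> n" and z: "F = poly_of n z"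
  shows "hyperbolic_slice n s F = poly_of n ` vslice n s (\<lambda>k. psum n k z)"
proof (rule set_eqI, rule iffI)
  fix H assume H: "H \<in> hyperbolic_slice n s F"
  then have "H \<in> monic_hyperbolic n" by (simp add: hyperbolic_slice_def)
  then obtain x where x: "sorted_on n x" "\<forall>i\<ge>n. x i = 0" "H = poly_of n x"
    using monic_hyperbolic_poly_of by blast
  have "\<forall>k. 1 \<le> k \<and> k \<le> s \<longrightarrow> psum n k x = psum n k z"
    unfolding psum_eq_iff_coeff_eq[OF s] using H x(3) z by (simp add: hyperbolic_slice_def)
  then have "x \<in> vslice n s (\<lambda>k. psum n k z)" using x by (simp add: vslice_def)
  then show "H \<in> poly_of n ` vslice n s (\<lambda>k. psum n k z)" using x(3) by blast
next
  fix H assume "H \<in> poly_of n ` vslice n s (\<lambda>k. psum n k z)"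
  then obtain x where x: "x \<in> vslice n s (\<lambda>k. psum n k z)" "H = poly_of n x" by blast
  then have "\<forall>k. 1 \<le> k \<and> k \<le> s \<longrightarrow> psum n k x = psum n k z" by (simp add: vslice_def)
  then have "\<forall>k. 1 \<le> k \<and> k \<le> s \<longrightarrow> coeff H (n - k) = coeff F (n - k)"
    unfolding psum_eq_iff_coeff_eq[OF s] x(2) z .
  then show "H \<in> hyperbolic_slice n s F"
    using poly_of_monic_hyperbolic x(2) by (simp add: hyperbolic_slice_def)
qed

text \<open>Refinement of compositions is inclusion of breaks, and the breaks of the root composition
  are the positions that are not walls. So membership in a stratum says that the complement
  of the breaks of \<open>\<mu>\<close> consists of walls.\<close>

lemma stratum_eq_image:
  assumes "s \<le> n" "F = poly_of n z" and \<mu>: "composition n \<mu>"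
  shows "stratum n s F \<mu> =
    poly_of n ` {x \<in> vslice n s (\<lambda>k. psum n k z). {0<..<n} - breaks \<mu> \<subseteq> walls n x}"
proof -
  have "comp_le (root_composition (poly_of n x)) \<mu> \<longleftrightarrow> {0<..<n} - breaks \<mu> \<subseteq> walls n x"
    if "x \<in> vslice n s (\<lambda>k. psum n k z)" for x
  proof -
    have sx: "sorted_on n x" using that by (simp add: vslice_def)
    show ?thesis
      unfolding root_composition_poly_of comp_le_iff_breaks[OF composition_multiplicities \<mu>]
        breaks_multiplicities[OF sx] by blast
  qed
  then show ?thesis
    unfolding stratum_def hyperbolic_slice_eq_image[OF assms(1,2)] by blast
qed

lemma exists_composition:
  assumes "I \<subseteq> {0<..<n}"
  obtains \<mu> where "composition n \<mu>" "{0<..<n} - breaks \<mu> = I"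
proof -
  obtain x where "sorted_on n x" "walls n x = I" using exists_walls[OF assms] by blast
  then have "{0<..<n} - breaks (multiplicities n x) = I"
    using breaks_multiplicities[of n x] assms by auto
  then show ?thesis using that composition_multiplicities by blast
qed

lemma strata_eq_image:
  assumes "s \<le> n" "F = poly_of n z"
  shows "strata n s F =
    (\<lambda>I. poly_of n ` {x \<in> vslice n s (\<lambda>k. psum n k z). I \<subseteq> walls n x}) ` Pow {0<..<n}"
    (is "_ = ?A ` _")
proof (rule set_eqI, rule iffI)
  fix S assume "S \<in> strata n s F"
  then obtain \<mu> where "composition n \<mu>" "S = stratum n s F \<mu>" unfolding strata_def by blast
  then have "S = ?A ({0<..<n} - breaks \<mu>)" using stratum_eq_image[OF assms] by simp
  then show "S \<in> ?A ` Pow {0<..<n}" by blast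
next
  fix S assume "S \<in> ?A ` Pow {0<..<n}"
  then obtain I where I: "I \<subseteq> {0<..<n}" "S = ?A I" by blast
  obtain \<mu> where "composition n \<mu>" "{0<..<n} - breaks \<mu> = I" using exists_composition[OF I(1)] by blast
  then have "S = stratum n s F \<mu>" using I(2) stratum_eq_image[OF assms, of \<mu>] by simp
  then show "S \<in> strata n s F" using \<open>composition n \<mu>\<close> unfolding strata_def by blast
qed

lemma poset_iso_via_index:
  assumes a: "\<And>i j. i \<in> D \<Longrightarrow> j \<in> D \<Longrightarrow> leA (a i) (a j) \<longleftrightarrow> R i j"
    and b: "\<And>i j. i \<in> D \<Longrightarrow> j \<in> D \<Longrightarrow> leB (b i) (b j) \<longleftrightarrow> R i j"
    and a_inj: "inj_on a D" and b_inj: "inj_on b D"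
  shows "poset_iso (a ` D) leA (b ` D) leB"
  unfolding poset_iso_def
proof (intro exI conjI ballI)
  let ?f = "b \<circ> inv_into D a"
  show "bij_betw ?f (a ` D) (b ` D)"
    using a_inj b_inj by (intro bij_betw_trans[OF bij_betw_inv_into]) (auto simp: bij_betw_def)
  fix x y assume "x \<in> a ` D" "y \<in> a ` D"
  then obtain i j where "i \<in> D" "x = a i" "j \<in> D" "y = a j" by blast
  then show "leA x y \<longleftrightarrow> leB (?f x) (?f y)" using a b a_inj by simp
qed

context generic_vslice
begin

definition wall_complex :: "nat set set" where
  "wall_complex = {I. \<exists>x\<in>X. I \<subseteq> walls n x}"

lemma walls_less: "walls n x \<subseteq> {0<..<n}"
  by (auto simp: walls_def)

lemma wall_complex_pure:
  assumes "n \<le> DIM('v::euclidean_space)"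
  shows "wall_complex = faces (walls n ` vertices)"
proof (rule set_eqI, rule iffI)
  fix I assume "I \<in> wall_complex"
  then obtain x where "x \<in> X" "I \<subseteq> walls n x" unfolding wall_complex_def by blast
  then obtain y where "y \<in> vertices" "I \<subseteq> walls n y" using extremal_vertices(1)[OF assms] by blast
  then show "I \<in> faces (walls n ` vertices)" unfolding faces_def by blast
next
  fix I assume "I \<in> faces (walls n ` vertices)"
  then obtain y where "y \<in> vertices" "I \<subseteq> walls n y" unfolding faces_def by blast
  moreover from this have "y \<in> X" by (simp add: vertices_def)
  ultimately show "I \<in> wall_complex" unfolding wall_complex_def by blast
qed

lemma two_way_shelling_facets:
  fixes e :: "nat \<Rightarrow> 'v::euclidean_space"
  assumes n: "n \<le> DIM('v)" and e: "inj_on e {..<n}"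
  obtains h R where "two_way_shelling ((`) e ` walls n ` vertices) h R"
proof -
  define f where "f x = e ` walls n x" for x
  have e_sub: "e ` A \<subseteq> e ` B \<longleftrightarrow> A \<subseteq> B" if "A \<subseteq> {..<n}" "B \<subseteq> {..<n}" for A B
    using inj_on_image_subset_iff[OF e that] .
  have w: "walls n x \<subseteq> {..<n}" "descents x \<subseteq> {..<n}" for x
    by (auto simp: walls_def descents_def)
  have f_inj: "inj_on f vertices"
  proof (rule inj_onI)
    fix x y assume xy: "x \<in> vertices" "y \<in> vertices" "f x = f y"
    then have "walls n x = walls n y" unfolding f_def using inj_on_image_eq_iff[OF e w(1) w(1)] by blast
    then show "x = y" using xy walls_inj by (meson inj_onD)
  qed
  define g where "g = inv_into vertices f"
  have g: "g (f x) = x" if "x \<in> vertices" for x using that f_inj by (simp add: g_def)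
  have diff: "f x - e ` descents x = e ` (walls n x - descents x)" for x
    unfolding f_def using inj_on_image_set_diff[OF e _ w(2), of "walls n x" x] w(1)[of x] by blast
  have remove: "f x - {e i} = e ` (walls n x - {i})" if "i \<in> walls n x" for x i
    unfolding f_def using inj_on_image_set_diff[OF e, of "walls n x" "{i}"] w(1)[of x] that by auto
  have X: "x \<in> X" if "x \<in> vertices" for x using that by (simp add: vertices_def)
  have "two_way_shelling (f ` vertices) (\<lambda>\<sigma>. height (g \<sigma>)) (\<lambda>\<sigma>. e ` descents (g \<sigma>))"
  proof
    fix \<sigma> assume "\<sigma> \<in> f ` vertices"
    then obtain x where x: "x \<in> vertices" "\<sigma> = f x" by blast
    note gx = g[OF x(1)]
    show "e ` descents (g \<sigma>) \<subseteq> \<sigma>"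
      unfolding x(2) gx unfolding f_def by (rule image_mono) (auto simp: descents_def)
    fix v
    show "\<exists>\<sigma>'\<in>f ` vertices. \<sigma> - {v} \<subseteq> \<sigma>' \<and> height (g \<sigma>') < height (g \<sigma>)"
      if v: "v \<in> e ` descents (g \<sigma>)"
    proof -
      obtain i where i: "v = e i" "i \<in> descents x" using v unfolding x(2) gx by blast
      then have iw: "i \<in> walls n x" by (simp add: descents_def)
      obtain y where y: "y \<in> vertices" "walls n x - {i} \<subseteq> walls n y" "height y < height x"
        using lower_vertex[OF x(1) i(2) n] by blast
      show ?thesis
      proof (intro bexI[of _ "f y"] conjI)
        show "\<sigma> - {v} \<subseteq> f y" unfolding x(2) i(1) remove[OF iw] unfolding f_def using y(2) by (rule image_mono)
        show "height (g (f y)) < height (g \<sigma>)" unfolding x(2) gx g[OF y(1)] by (rule y(3))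
      qed (use y(1) in blast)
    qed
    show "\<exists>\<sigma>'\<in>f ` vertices. \<sigma> - {v} \<subseteq> \<sigma>' \<and> height (g \<sigma>) < height (g \<sigma>')"
      if v: "v \<in> \<sigma> - e ` descents (g \<sigma>)"
    proof -
      obtain i where i: "v = e i" "i \<in> walls n x - descents x" using v unfolding x(2) gx diff by blast
      then have iw: "i \<in> walls n x" by blast
      obtain y where y: "y \<in> vertices" "walls n x - {i} \<subseteq> walls n y" "height x < height y"
        using upper_vertex[OF x(1) i(2) n] by blast
      show ?thesis
      proof (intro bexI[of _ "f y"] conjI)
        show "\<sigma> - {v} \<subseteq> f y" unfolding x(2) i(1) remove[OF iw] unfolding f_def using y(2) by (rule image_mono)
        show "height (g \<sigma>) < height (g (f y))" unfolding x(2) gx g[OF y(1)] by (rule y(3))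
      qed (use y(1) in blast)
    qed
    fix \<sigma>' assume "\<sigma>' \<in> f ` vertices" and ne: "\<sigma> \<noteq> \<sigma>'"
    then obtain y where y: "y \<in> vertices" "\<sigma>' = f y" by blast
    note gy = g[OF y(1)]
    have "x \<noteq> y" using ne x(2) y(2) by blast
    show "height (g \<sigma>) < height (g \<sigma>')" if sub: "e ` descents (g \<sigma>) \<subseteq> \<sigma>'"
    proof -
      have "e ` descents x \<subseteq> e ` walls n y" using sub unfolding x(2) y(2) gx unfolding f_def .
      then have "descents x \<subseteq> walls n y" by (simp only: e_sub[OF w(2) w(1)])
      then show ?thesis
        unfolding x(2) y(2) gx gy by (rule vertex_min[OF x(1) X[OF y(1)] \<open>x \<noteq> y\<close>])
    qed
    show "height (g \<sigma>') < height (g \<sigma>)" if sub: "\<sigma> - e ` descents (g \<sigma>) \<subseteq> \<sigma>'"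
    proof -
      have "walls n x - descents x \<subseteq> {..<n}" using w(1)[of x] by blast
      moreover have "e ` (walls n x - descents x) \<subseteq> e ` walls n y"
        using sub unfolding x(2) y(2) gx diff unfolding f_def .
      ultimately have "walls n x - descents x \<subseteq> walls n y" by (simp only: e_sub[OF _ w(1)])
      then show ?thesis
        unfolding x(2) y(2) gx gy by (rule vertex_max[OF x(1) X[OF y(1)] \<open>x \<noteq> y\<close>])
    qed
  qed
  moreover have "f ` vertices = (`) e ` walls n ` vertices" by (simp add: image_image f_def)
  ultimately show ?thesis using that by simp
qed

end

theorem corollary3p7:
  fixes F :: "real poly" and n s :: nat
  assumes "2 \<le> s" and "s \<le> n"
    and "F \<in> monic_hyperbolic n"
    and "generic_slice n s F"
    and "n \<le> DIM('v::euclidean_space)"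
  shows "\<exists>K :: 'v set set. realizes_boundary_complex n s F K \<and>
           combinatorial_sphere (int n - int s - 1) K"
proof -
  obtain z where z: "sorted_on n z" "\<forall>i\<ge>n. z i = 0" "F = poly_of n z"
    using monic_hyperbolic_poly_of[OF assms(3)] by blast
  define c where "c = (\<lambda>k. psum n k z)"
  have slice: "hyperbolic_slice n s F = poly_of n ` vslice n s c"
    using hyperbolic_slice_eq_image[OF assms(2) z(3)] by (simp add: c_def)
  interpret generic_vslice n s c
  proof
    fix x assume "x \<in> vslice n s c"
    then have "\<not> card {t. poly (poly_of n x) t = 0} \<le> s - 1"
      using assms(4) unfolding generic_slice_def slice by blast
    moreover have "{t. poly (poly_of n x) t = 0} = x ` {..<n}" using poly_poly_of by blast
    ultimately show "s \<le> card (x ` {..<n})" by simp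
  qed (use assms in auto)
  note n = assms(5)
  define A where "A I = poly_of n ` {x \<in> X. I \<subseteq> walls n x}" for I
  obtain e :: "nat \<Rightarrow> 'v" where e: "inj_on e {..<n}" "e ` {..<n} \<subseteq> Basis"
    using card_le_inj[of "{..<n}" "Basis :: 'v set"] n by auto
  let ?\<Phi> = "(`) e ` walls n ` vertices"
  let ?K = "(hull) convex ` faces ?\<Phi>"
  obtain h R where shell: "two_way_shelling ?\<Phi> h R" by (rule two_way_shelling_facets[OF n e(1)])
  have less_n: "I \<subseteq> {0<..<n}" if "I \<in> wall_complex" for I
    using that walls_less unfolding wall_complex_def by blast
  have facesK: "faces ?\<Phi> = (`) e ` wall_complex"
    unfolding wall_complex_pure[OF n] faces_def by (auto simp: subset_image_iff)
  have \<Phi>_Basis: "?\<Phi> \<subseteq> Pow Basis" using e(2) walls_less by (auto simp: walls_def)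
  have basis: "basis_complex (faces ?\<Phi>)"
    using \<Phi>_Basis unfolding basis_complex_def faces_def by blast
  have simplicial: "simplicial_complex ?K" by (rule simplicial_complex_basis[OF basis])
  have "z \<in> X" using z by (simp add: vslice_def c_def)
  then have "vertices \<noteq> {}" using extremal_vertices(1)[OF n, of z "{}"] by blast
  then have \<Phi>_ne: "?\<Phi> \<noteq> {}" by blast
  have lt_n: "I \<subseteq> {..<n}" if "I \<in> wall_complex" for I
    using less_n[OF that] by (auto simp: subset_iff)
  have eB: "e ` I \<subseteq> Basis" if "I \<in> wall_complex" for I using e(2) lt_n[OF that] by blast
  have le_K: "convex hull (e ` I) \<subseteq> convex hull (e ` J) \<longleftrightarrow> I \<subseteq> J"
    if "I \<in> wall_complex" "J \<in> wall_complex" for I J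
  proof -
    show ?thesis
      unfolding convex_hull_basis_subset_iff[OF eB[OF that(1)] eB[OF that(2)]]
      by (rule inj_on_image_subset_iff[OF e(1) lt_n[OF that(1)] lt_n[OF that(2)]])
  qed
  have le_A: "A J \<subseteq> A I \<longleftrightarrow> I \<subseteq> J" if IJ: "I \<in> wall_complex" "J \<in> wall_complex" for I J
  proof
    assume AJ: "A J \<subseteq> A I"
    show "I \<subseteq> J"
    proof (rule subsetI, rule ccontr)
      fix i assume i: "i \<in> I" "i \<notin> J"
      obtain x where x: "x \<in> X" "J \<subseteq> walls n x" using IJ(2) unfolding wall_complex_def by blast
      obtain y where y: "y \<in> X" "J \<subseteq> walls n y" "i \<notin> walls n y"
        using face_walls_exact[OF n x i(2)] by blast
      have "poly_of n y \<in> A J" unfolding A_def using y(1,2) by blast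
      then have "poly_of n y \<in> A I" using AJ by blast
      then obtain w where w: "w \<in> X" "I \<subseteq> walls n w" "poly_of n y = poly_of n w"
        unfolding A_def by blast
      have "y = w" using poly_of_inj[OF _ _ _ _ w(3)] y(1) w(1) by (simp add: vslice_def)
      then show False using w(2) y(3) i(1) by blast
    qed
  next
    assume "I \<subseteq> J"
    then show "A J \<subseteq> A I" unfolding A_def by blast
  qed
  have boundary: "boundary_strata n s F = A ` wall_complex"
  proof -
    have strata: "strata n s F = A ` Pow {0<..<n}"
      using strata_eq_image[OF assms(2) z(3)] unfolding A_def c_def .
    have ne: "A I \<noteq> {} \<longleftrightarrow> I \<in> wall_complex" for I by (auto simp: wall_complex_def A_def)
    have "A ` Pow {0<..<n} - {{}} = A ` {I \<in> Pow {0<..<n}. A I \<noteq> {}}" by blast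
    also have "{I \<in> Pow {0<..<n}. A I \<noteq> {}} = wall_complex" unfolding ne using less_n by blast
    finally show ?thesis unfolding boundary_strata_def strata .
  qed
  have "poset_iso (A ` wall_complex) (\<supseteq>) ((\<lambda>I. convex hull (e ` I)) ` wall_complex) (\<subseteq>)"
  proof (rule poset_iso_via_index[where R = "(\<subseteq>)"])
    show "inj_on A wall_complex"
    proof (rule inj_onI)
      fix I J assume "I \<in> wall_complex" "J \<in> wall_complex" "A I = A J"
      then show "I = J" using le_A[of I J] le_A[of J I] by simp
    qed
    show "inj_on (\<lambda>I. convex hull (e ` I)) wall_complex"
    proof (rule inj_onI)
      fix I J assume "I \<in> wall_complex" "J \<in> wall_complex" "convex hull (e ` I) = convex hull (e ` J)"
      then show "I = J" using le_K[of I J] le_K[of J I] by simp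
    qed
  qed (fact le_A le_K)+
  moreover have "?K = (\<lambda>I. convex hull (e ` I)) ` wall_complex"
    unfolding facesK by (simp add: image_image)
  ultimately have "realizes_boundary_complex n s F ?K"
    using simplicial boundary by (simp add: realizes_boundary_complex_def)
  moreover have "combinatorial_sphere (int n - int s - 1) ?K"
  proof -
    have n0: "0 < n" using s2 sn by simp
    \<comment> \<open>The walls are numbered from 1 to \<open>n - 1\<close>, which leaves
      the basis vector \<open>e 0\<close> for the apex of the cones.\<close>
    have p: "e 0 \<in> Basis" using e(2) n0 by blast
    have "e 0 \<notin> e ` walls n x" for x
    proof
      assume "e 0 \<in> e ` walls n x"
      then obtain i where "i \<in> walls n x" "e 0 = e i" by blast
      then show False using inj_onD[OF e(1), of 0 i] n0 by (auto simp: walls_def)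
    qed
    then have p_notin: "e 0 \<notin> \<Union>?\<Phi>" by blast
    obtain \<sigma> where \<sigma>: "\<sigma> \<in> ?\<Phi>" and
      pl: "pl_homeomorphic (realization (faces ?\<Phi>)) (\<Union>(boundary_faces (convex hull (insert (e 0) \<sigma>))))"
      using two_way_shelling_sphere[OF shell \<Phi>_ne \<Phi>_Basis p p_notin] by blast
    obtain x where x: "x \<in> vertices" "\<sigma> = e ` walls n x" using \<sigma> by blast
    have "card (walls n x) + s = n"
      using card_values_add_walls[of n x] x(1) n0 by (simp add: vertices_def vslice_def)
    moreover have "card \<sigma> = card (walls n x)"
      unfolding x(2) by (rule card_image, rule inj_on_subset[OF e(1)]) (auto simp: walls_def)
    moreover have "e 0 \<notin> \<sigma>" using p_notin \<sigma> by blast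
    moreover have "finite \<sigma>" using x(2) by simp
    ultimately have "int (card (insert (e 0) \<sigma>)) = (int n - int s - 1 + 1) + 1" by simp
    moreover have "insert (e 0) \<sigma> \<subseteq> Basis" using \<sigma> \<Phi>_Basis p by blast
    ultimately have D: "(int n - int s - 1 + 1) simplex (convex hull (insert (e 0) \<sigma>))"
      using basis_affine_independent by (intro simplex_convex_hull) blast
    show ?thesis
    proof (rule combinatorial_sphereI[OF _ D])
      show "polytope_complex ?K" using simplicial by (rule simplicial_complex_polytope_complex)
      show "pl_homeomorphic (\<Union>?K) (\<Union>(boundary_faces (convex hull (insert (e 0) \<sigma>))))"
        using pl by (simp add: realization_def)
    qed
  qed
  ultimately show ?thesis by blast
qed

end
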